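(* Consider the capacitated inventory control MDP with fixed ordering costs and lost sales described in the context. Suppose that the per-period demand exceeds the maximum order size with positive probability, i.e. $G_D(M)<1$. Then there exists a $\bar\beta$-optimal policy for the MDP defined by the HV-AG transformation (described in the context, with $\ell=0_L$), and every such policy is average-cost optimal for the original inventory control problem.
   Context: Inventory MDP. Let $C<\infty$ be the maximum inventory level, $M<\infty$ the maximum order size, $K\ge0$ the fixed ordering cost and $\overline{c}>0$ the per-unit ordering cost. $G_D$ is the distribution function of the nonnegative per-period demand, with $G_D(0)<1$; demands $D_1,D_2,\dots$ are i.i.d. with distribution $G_D$. The state space is $\mathbb{X}:=[0,C]\cup\{0_L\}$, where $0_L$ is an additional point isolated from $[0,C]$ (it indicates that a lost sale occurred); the action space is $\mathbb{A}:=[0,M]$ and $A(x):=\mathbb{A}$ for all $x\in\mathbb{X}$. The holding cost function is $h:\mathbb{X}\to[0,\infty)$, assumed continuous on $[0,C]$. With the convention $0_L+y:=y$ for $y\in\mathbb{R}$, the dynamics are $x_{n+1}=F(x_n,a_n,D_{n+1})$, where $$F(x,a,s):=\begin{cases}\min\{x+a-s,\,C\},&x+a\ge s,\\0_L,&x+a<s,\end{cases}$$ so the transition probability kernel is $q(B|x,a):=\int_{[0,\infty)}\mathbf{1}\{F(x,a,s)\in B\}\,dG_D(s)$ for Borel $B\subseteq\mathbb{X}$, and the one-step cost is $$c(x,a):=K\mathbf{1}\{a>0\}+\overline{c}\,a+\int_{[0,\infty)}h(F(x,a,s))\,dG_D(s).$$ Policies and average cost. A policy $\pi$ is a sequence of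 Borel-measurable, history-dependent, possibly randomized decision rules $\pi_n(\cdot|x_0a_0\cdots x_n)$, probability measures concentrated on the set of actions available at $x_n$. A stationary policy is a Borel function $\phi:\mathbb{X}\to[0,M]$; the set of these is $\mathbb{F}$. $w^\pi(x):=\limsup_{N\to\infty}\frac1N\mathbb{E}_x^\pi\sum_{n=0}^{N-1}c(x_n,a_n)$ is the average cost of $\pi$ from $x_0=x$; $\pi$ is average-cost optimal if $w^\pi(x)=\inf_{\pi'}w^{\pi'}(x)$ for all $x\in\mathbb{X}$, the infimum being over all policies. HV-AG transformation with $\ell:=0_L$. For $\phi\in\mathbb{F}$ let ${}_\ell Q_\phi u(x):=\int_{\mathbb{X}\setminus\{\ell\}}u(y)\,q(dy|x,\phi(x))$, with iterates ${}_\ell Q_\phi^n$ (${}_\ell Q_\phi^0u:=u$). Let $K_\ell<\infty$ be a constant such that $\sum_{n=0}^\infty{}_\ell Q_\phi^n\mathbf{e}(x)\le K_\ell$ for all $\phi\in\mathbb{F}$, $x\in\mathbb{X}$, where $\mathbf{e}\equiv1$, and let $\mu_\ell:\mathbb{X}\to[1,\infty)$ be a continuous function with $\mu_\ell\le K_\ell$ and $\mu_\ell(x)\ge1+\int_{\mathbb{X}\setminus\{\ell\}}\mu_\ell(y)\,q(dy|x,a)$ for all $(x,a)\in\mathbb{X}\times\mathbb{A}$. Choose a discount factor $\bar\beta\in[(K_\ell-1)/K_\ell,1)$. The transformed MDP has: - state space $\bar{\mathbb{X}}:=\mathbb{X}\cup\{\bar x\}$, where $\bar x\notin\mathbb{X}$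 is isolated from $\mathbb{X}$ (its distance to all points of $\mathbb{X}$ is bounded below by a positive constant); - action space $\bar{\mathbb{A}}:=\mathbb{A}\cup\{\bar a\}$, with $\bar A(x):=\mathbb{A}$ for $x\in\mathbb{X}$ and $\bar A(\bar x):=\{\bar a\}$; - costs $\bar c(x,a):=c(x,a)/\mu_\ell(x)$ for $(x,a)\in\mathbb{X}\times\mathbb{A}$ and $\bar c(\bar x,\bar a):=0$; - transition probabilities, for $(x,a)\in\mathbb{X}\times\mathbb{A}$: $\bar p(B|x,a):=\frac{1}{\bar\beta\mu_\ell(x)}\int_B\mu_\ell(y)\,q(dy|x,a)$ for Borel $B\subseteq\mathbb{X}\setminus\{\ell\}$; $\bar p(\{\ell\}|x,a):=\frac{1}{\bar\beta\mu_\ell(x)}\big[\mu_\ell(x)-1-\int_{\mathbb{X}\setminus\{\ell\}}\mu_\ell(y)\,q(dy|x,a)\big]$; $\bar p(\{\bar x\}|x,a):=1-\frac{\mu_\ell(x)-1}{\bar\beta\mu_\ell(x)}$; and $\bar p(\{\bar x\}|\bar x,\bar a):=1$. Policies of the two MDPs are identified, since $\bar a$ is the only action at $\bar x$. $\bar v^\pi(x):=\bar{\mathbb{E}}_x^\pi\sum_{n=0}^\infty\bar\beta^n\bar c(x_n,a_n)$ is the expected total discounted cost in the transformed MDP (process governed by $\bar p$ and $\pi$, $x_0=x$), and a policy $\pi$ is $\bar\beta$-optimal if $\bar v^\pi(x)=\inf_{\pi'}\bar v^{\pi'}(x)$ for all $x\in\bar{\mathbb{X}}$.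
   Formalization: Existence of an optimal policy is shown only if h(0) ≤ h(0_L) or G_D is continuous on (0, C+M]; "every such policy" is read as every stationary (possibly randomized) optimal policy. Without these restrictions both claims can fail. *)

theory Defs
  imports "HOL-Probability.Probability"
begin

section \<open>Markov decision processes with Borel policies\<close>

record ('s, 'a) mdp =
  states :: "'s measure"
  actions :: "'a measure"
  avail :: "'s \<Rightarrow> 'a set"
  kernel :: "'s \<times> 'a \<Rightarrow> 's measure"
  cost :: "'s \<times> 'a \<Rightarrow> real"

text \<open>A history \<open>x\<^sub>0 a\<^sub>0 \<dots> x\<^sub>n\<close> is the pair of \<open>(x\<^sub>i, a\<^sub>i)\<close> for \<open>i < n\<close> and of the current state
  \<open>x\<^sub>n\<close>; a policy maps each epoch and history to a probability measure on actions.\<close>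

abbreviation sa :: "('s, 'a) mdp \<Rightarrow> ('s \<times> 'a) measure" where
  "sa m \<equiv> states m \<Otimes>\<^sub>M actions m"

definition histories :: "('s, 'a) mdp \<Rightarrow> nat \<Rightarrow> ((nat \<Rightarrow> 's \<times> 'a) \<times> 's) measure" where
  "histories m n = (\<Pi>\<^sub>M i\<in>{0..<n}. sa m) \<Otimes>\<^sub>M states m"

type_synonym ('s, 'a) policy = "nat \<Rightarrow> (nat \<Rightarrow> 's \<times> 'a) \<times> 's \<Rightarrow> 'a measure"

definition policies :: "('s, 'a) mdp \<Rightarrow> ('s, 'a) policy set" where
  "policies m = {\<pi>. \<forall>n. \<pi> n \<in> histories m n \<rightarrow>\<^sub>M prob_algebra (actions m) \<and>
     (\<forall>z\<in>space (histories m n). emeasure (\<pi> n z) (avail m (snd z)) = 1)}"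

definition selectors :: "('s, 'a) mdp \<Rightarrow> ('s \<Rightarrow> 'a) set" where
  "selectors m = {\<phi> \<in> states m \<rightarrow>\<^sub>M actions m. \<forall>x\<in>space (states m). \<phi> x \<in> avail m x}"

definition selector_policy :: "('s, 'a) mdp \<Rightarrow> ('s \<Rightarrow> 'a) \<Rightarrow> ('s, 'a) policy" where
  "selector_policy m \<phi> n z = return (actions m) (\<phi> (snd z))"

text \<open>Time-homogeneous dependence on the current state only; randomization is allowed, so this
  covers \<open>selector_policy\<close>.\<close>

definition stationary :: "('s, 'a) mdp \<Rightarrow> ('s, 'a) policy \<Rightarrow> bool" where
  "stationary m \<pi> \<longleftrightarrow> (\<exists>\<kappa>. \<forall>n. \<forall>z\<in>space (histories m n). \<pi> n z = \<kappa> (snd z))"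

text \<open>Conditional law of \<open>(x\<^sub>n, a\<^sub>n)\<close> given the earlier state-action pairs, and the resulting law of
  the whole process started at \<open>x\<close> (Ionescu Tulcea).\<close>

definition step :: "('s, 'a) mdp \<Rightarrow> ('s, 'a) policy \<Rightarrow> 's \<Rightarrow> nat \<Rightarrow> (nat \<Rightarrow> 's \<times> 'a) \<Rightarrow> ('s \<times> 'a) measure" where
  "step m \<pi> x n \<omega> =
     (if n = 0 then return (states m) x else kernel m (\<omega> (n - 1))) \<bind>
       (\<lambda>y. \<pi> n (\<omega>, y) \<bind> (\<lambda>a. return (sa m) (y, a)))"

definition process_law :: "('s, 'a) mdp \<Rightarrow> ('s, 'a) policy \<Rightarrow> 's \<Rightarrow> (nat \<Rightarrow> 's \<times> 'a) measure" where
  "process_law m \<pi> x =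
     projective_family.lim UNIV (Ionescu_Tulcea.CI (step m \<pi> x) (\<lambda>_. sa m)) (\<lambda>_. sa m)"

text \<open>All costs below are nonnegative on feasible state-action pairs, so expected costs are taken
  in \<^typ>\<open>ennreal\<close>.\<close>

definition avg_cost :: "('s, 'a) mdp \<Rightarrow> ('s, 'a) policy \<Rightarrow> 's \<Rightarrow> ennreal" where
  "avg_cost m \<pi> x =
     limsup (\<lambda>N. (\<integral>\<^sup>+\<omega>. (\<Sum>n<N. ennreal (cost m (\<omega> n))) \<partial>process_law m \<pi> x) / of_nat N)"

definition disc_cost :: "('s, 'a) mdp \<Rightarrow> real \<Rightarrow> ('s, 'a) policy \<Rightarrow> 's \<Rightarrow> ennreal" where
  "disc_cost m \<beta> \<pi> x = (\<integral>\<^sup>+\<omega>. (\<Sum>n. ennreal (\<beta> ^ n * cost m (\<omega> n))) \<partial>process_law m \<pi> x)"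

definition avg_optimal :: "('s, 'a) mdp \<Rightarrow> ('s, 'a) policy \<Rightarrow> bool" where
  "avg_optimal m \<pi> \<longleftrightarrow> \<pi> \<in> policies m \<and>
     (\<forall>x\<in>space (states m). avg_cost m \<pi> x = (INF \<pi>'\<in>policies m. avg_cost m \<pi>' x))"

definition disc_optimal :: "('s, 'a) mdp \<Rightarrow> real \<Rightarrow> ('s, 'a) policy \<Rightarrow> bool" where
  "disc_optimal m \<beta> \<pi> \<longleftrightarrow> \<pi> \<in> policies m \<and>
     (\<forall>x\<in>space (states m). disc_cost m \<beta> \<pi> x = (INF \<pi>'\<in>policies m. disc_cost m \<beta> \<pi>' x))"

section \<open>The inventory model\<close>

text \<open>The isolated points \<open>0\<^sub>L\<close> (lost sale) and \<open>xbar\<close> of the state spaces and \<open>abar\<close> of the action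
  space are represented by negative reals, so that the spaces are subspaces of the real line with
  the intended topology and Borel sets. The number that represents \<open>0\<^sub>L\<close> carries no meaning:
  arithmetic goes through \<open>level\<close>, which implements the convention \<open>0\<^sub>L + y = y\<close>.\<close>

definition lost :: real where "lost = -1"
definition xbar :: real where "xbar = -2"
definition abar :: real where "abar = -1"

definition level :: "real \<Rightarrow> real" where
  "level x = (if x = lost then 0 else x)"

definition inv_X :: "real \<Rightarrow> real set" where
  "inv_X C = insert lost {0..C}"

definition inv_F :: "real \<Rightarrow> real \<Rightarrow> real \<Rightarrow> real \<Rightarrow> real" where
  "inv_F C x a s = (if level x + a \<ge> s then min (level x + a - s) C else lost)"

definition inv_q :: "real \<Rightarrow> real measure \<Rightarrow> real \<times> real \<Rightarrow> real measure" where
  "inv_q C D = (\<lambda>(x, a). distr D (restrict_space borel (inv_X C)) (inv_F C x a))"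

definition inv_cost ::
  "real \<Rightarrow> real \<Rightarrow> real \<Rightarrow> (real \<Rightarrow> real) \<Rightarrow> real measure \<Rightarrow> real \<times> real \<Rightarrow> real" where
  "inv_cost C K cb h D =
     (\<lambda>(x, a). K * (if a > 0 then 1 else 0) + cb * a + (LINT s|D. h (inv_F C x a s)))"

definition inventory_mdp ::
  "real \<Rightarrow> real \<Rightarrow> real \<Rightarrow> real \<Rightarrow> (real \<Rightarrow> real) \<Rightarrow> real measure \<Rightarrow> (real, real) mdp" where
  "inventory_mdp C M K cb h D =
     \<lparr>states = restrict_space borel (inv_X C),
      actions = restrict_space borel {0..M},
      avail = (\<lambda>_. {0..M}),
      kernel = inv_q C D,
      cost = inv_cost C K cb h D\<rparr>"

section \<open>The HV-AG transformation with respect to a lost sale\<close>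

definition taboo_op ::
  "real \<Rightarrow> real measure \<Rightarrow> (real \<Rightarrow> real) \<Rightarrow> (real \<Rightarrow> ennreal) \<Rightarrow> real \<Rightarrow> ennreal" where
  "taboo_op C D \<phi> u x = (\<integral>\<^sup>+y\<in>inv_X C - {lost}. u y \<partial>inv_q C D (x, \<phi> x))"

text \<open>In \<open>hvag_kernel\<close> the pairs \<open>(x, abar)\<close> with \<open>x \<noteq> xbar\<close> and \<open>(xbar, a)\<close> with \<open>a \<noteq> abar\<close> are
  infeasible; they are sent to \<open>xbar\<close> only to make the kernel total.\<close>

definition hvag_kernel ::
  "real \<Rightarrow> real measure \<Rightarrow> (real \<Rightarrow> real) \<Rightarrow> real \<Rightarrow> real \<times> real \<Rightarrow> real measure" where
  "hvag_kernel C D \<mu> \<beta> = (\<lambda>(x, a).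
     let S = restrict_space borel (insert xbar (inv_X C)); q = inv_q C D (x, a) in
     if x = xbar \<or> a = abar then return S xbar
     else measure_of (space S) (sets S) (\<lambda>B.
       ennreal (1 / (\<beta> * \<mu> x)) * (\<integral>\<^sup>+y\<in>B - {lost, xbar}. ennreal (\<mu> y) \<partial>q)
       + ennreal (1 / (\<beta> * \<mu> x) * (\<mu> x - 1 - (LINT y:inv_X C - {lost}|q. \<mu> y))) * indicator B lost
       + ennreal (1 - (\<mu> x - 1) / (\<beta> * \<mu> x)) * indicator B xbar))"

definition hvag_mdp ::
  "real \<Rightarrow> real \<Rightarrow> real \<Rightarrow> real \<Rightarrow> (real \<Rightarrow> real) \<Rightarrow> real measure \<Rightarrow> (real \<Rightarrow> real) \<Rightarrow> real
    \<Rightarrow> (real, real) mdp" where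
  "hvag_mdp C M K cb h D \<mu> \<beta> =
     \<lparr>states = restrict_space borel (insert xbar (inv_X C)),
      actions = restrict_space borel (insert abar {0..M}),
      avail = (\<lambda>x. if x = xbar then {abar} else {0..M}),
      kernel = hvag_kernel C D \<mu> \<beta>,
      cost = (\<lambda>(x, a). if x = xbar \<or> a = abar then 0 else inv_cost C K cb h D (x, a) / \<mu> x)\<rparr>"

text \<open>Identification of policies: a policy of the transformed process is used as an inventory policy
  by regarding its decisions, which are concentrated on \<open>[0, M]\<close> outside \<open>xbar\<close>, as measures on
  \<open>[0, M]\<close>. Every inventory policy arises in this way, since \<open>abar\<close> is the only action at
  \<open>xbar\<close>.\<close>

definition as_inventory_policy :: "real \<Rightarrow> (real, real) policy \<Rightarrow> (real, real) policy" where
  "as_inventory_policy M \<pi> n z = restrict_space (\<pi> n z) {0..M}"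

end

(*
  Let v be a discounted value function of the transformed model and w = v(lost). Multiplying its
  fixed point equation by mu shows that w and the bias mu * (v - w) solve the average cost equation
  of the inventory model; the equation for v holds by stationarity, and the corresponding inequality
  for every action by comparison with one-step deviations. Telescoping along an arbitrary policy
  then bounds its average cost below by w, with equality for the given policy.

  For existence, value iteration contracts in the sup norm weighted by mu and, after truncating
  the value at inventory level 0, preserves lower semicontinuity, so minimizers exist and the
  smallest one is a Borel function of the state. At level 0 and after a lost sale the continuation
  is the same, so the bias at 0 vanishes: the stage cost jumps there only from h(0) to h(lost).
  This jump is harmless if h(0) <= h(lost) or if the demand charges no point of (0, C + M].
*)

theory Submission
  imports Defs
begin

text \<open>Why multiplying by \<open>\<mu>\<close> works: the kernel carries the factor
  \<open>1 / (\<beta> * \<mu> x)\<close>, so \<open>\<mu> x\<close> cancels the discount, and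
  \<open>xbar\<close> has value 0. What remains is the cost, the integral of
  \<open>\<mu> * v\<close> off \<open>lost\<close>, and \<open>w\<close> times
  \<open>\<mu> x - 1\<close> minus the integral of \<open>\<mu>\<close> off \<open>lost\<close>.
  Collecting the terms in \<open>w\<close> leaves the gain and the bias, whose integral extends to
  all states because it vanishes at \<open>lost\<close>. Stationarity matters because the
  transformed kernel can give mass 0 to \<open>lost\<close> where the inventory kernel does not; a
  history-dependent optimal policy may act arbitrarily after such a transition. For a stationary
  policy, deviating at time 0 by a constant action tests each pair, so this half involves no
  measurable selection. Costs live in ennreal, where subtraction truncates; identities are therefore
  arranged as sums, and only finite terms are cancelled. Existence works with real functions
  \<open>V\<close> in the role of \<open>\<mu> * v\<close> and rests on two inequalities: the
  integral of \<open>\<mu>\<close> off \<open>lost\<close> is at most \<open>\<mu> - 1\<close>, and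
  \<open>\<mu> - 1 \<le> \<beta> * \<mu>\<close>.\<close>

section \<open>Expected costs along the decision process\<close>

text \<open>The kernel has to be Markov at infeasible pairs too: the process law composes kernels
  over all of \<open>sa m\<close>, and feasibility is only an almost sure property of its
  trajectories.\<close>

locale mdp_kernel =
  fixes m :: "('s, 'a) mdp"
  assumes kernel [measurable]: "kernel m \<in> sa m \<rightarrow>\<^sub>M prob_algebra (states m)"
    and cost_measurable [measurable]: "cost m \<in> borel_measurable (sa m)"
    and avail_sets: "\<And>x. x \<in> space (states m) \<Longrightarrow> avail m x \<in> sets (actions m)"
begin

lemma kernel_subprob [measurable]: "kernel m \<in> sa m \<rightarrow>\<^sub>M subprob_algebra (states m)"
  by (rule measurable_prob_algebraD[OF kernel])

lemma policy_measurable [measurable]: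
  "\<pi> \<in> policies m \<Longrightarrow> \<pi> n \<in> histories m n \<rightarrow>\<^sub>M prob_algebra (actions m)"
  by (simp add: policies_def)

lemma policy_subprob:
  "\<pi> \<in> policies m \<Longrightarrow> \<pi> n \<in> (\<Pi>\<^sub>M i\<in>{0..<n}. sa m) \<Otimes>\<^sub>M states m \<rightarrow>\<^sub>M subprob_algebra (actions m)"
  using policy_measurable[of \<pi> n] by (simp add: histories_def measurable_prob_algebraD)

lemma prob_space_policy:
  "\<pi> \<in> policies m \<Longrightarrow> z \<in> space (histories m n) \<Longrightarrow> prob_space (\<pi> n z)"
  using measurable_space[OF policy_measurable] by (fastforce simp: space_prob_algebra)

lemma nn_integral_policy_const:
  "\<pi> \<in> policies m \<Longrightarrow> z \<in> space (histories m n) \<Longrightarrow> (\<integral>\<^sup>+a. k \<partial>\<pi> n z) = k"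
  by (simp add: prob_space.emeasure_space_1[OF prob_space_policy])

lemma policy_avail_AE:
  assumes "\<pi> \<in> policies m" "z \<in> space (histories m n)"
  shows "AE a in \<pi> n z. a \<in> avail m (snd z)"
proof -
  note prob_space_policy[OF assms]
  moreover have "emeasure (\<pi> n z) (avail m (snd z)) = 1"
    using assms unfolding policies_def by blast
  ultimately have *: "emeasure (\<pi> n z) (avail m (snd z)) = 1" "prob_space (\<pi> n z)"
    by auto
  \<comment> \<open>A set of nonzero \<open>emeasure\<close> is measurable, since
    \<open>emeasure\<close> is 0 off the sigma-algebra.\<close>
  then have "avail m (snd z) \<in> sets (\<pi> n z)"
    by (metis emeasure_notin_sets zero_neq_one)
  with * show ?thesis
    by (simp add: prob_space.AE_in_set_eq_1 measure_def)
qed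

lemma space_histories:
  "space (histories m n) = space (\<Pi>\<^sub>M i\<in>{0..<n}. sa m) \<times> space (states m)"
  by (simp add: histories_def space_pair_measure)

lemma step_measurable:
  assumes \<pi>: "\<pi> \<in> policies m" and x: "x \<in> space (states m)"
  shows "step m \<pi> x n \<in> (\<Pi>\<^sub>M i\<in>{0..<n}. sa m) \<rightarrow>\<^sub>M prob_algebra (sa m)"
proof -
  have [measurable]: "\<pi> n \<in> (\<Pi>\<^sub>M i\<in>{0..<n}. sa m) \<Otimes>\<^sub>M states m \<rightarrow>\<^sub>M prob_algebra (actions m)"
    using policy_measurable[OF \<pi>, of n] by (simp add: histories_def)
  have [measurable]: "(\<lambda>\<omega>. if n = 0 then return (states m) x else kernel m (\<omega> (n - 1)))
      \<in> (\<Pi>\<^sub>M i\<in>{0..<n}. sa m) \<rightarrow>\<^sub>M prob_algebra (states m)"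
  proof (cases "n = 0")
    case True
    have "return (states m) x \<in> space (prob_algebra (states m))"
      using x by (simp add: space_prob_algebra prob_space_return)
    with True show ?thesis by simp
  next
    case False
    then have "(\<lambda>\<omega>. \<omega> (n - 1)) \<in> (\<Pi>\<^sub>M i\<in>{0..<n}. sa m) \<rightarrow>\<^sub>M sa m"
      by (intro measurable_component_singleton) auto
    from measurable_compose[OF this kernel] False show ?thesis by simp
  qed
  show ?thesis
    unfolding step_def by measurable
qed

lemma nn_integral_step:
  assumes \<pi>: "\<pi> \<in> policies m" and x: "x \<in> space (states m)"
    and \<omega>: "\<omega> \<in> space (\<Pi>\<^sub>M i\<in>{0..<n}. sa m)" and g [measurable]: "g \<in> borel_measurable (sa m)"
  shows "(\<integral>\<^sup>+z. g z \<partial>step m \<pi> x n \<omega>) =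
    (\<integral>\<^sup>+y. (\<integral>\<^sup>+a. g (y, a) \<partial>\<pi> n (\<omega>, y))
      \<partial>(if n = 0 then return (states m) x else kernel m (\<omega> (n - 1))))"
proof -
  let ?N = "if n = 0 then return (states m) x else kernel m (\<omega> (n - 1))"
  have N: "sets ?N = sets (states m)"
  proof (cases "n = 0")
    case False
    then have "\<omega> (n - 1) \<in> space (sa m)"
      using \<omega> by (auto simp: space_PiM)
    with False show ?thesis
      using subprob_measurableD(2)[OF kernel_subprob] by simp
  qed simp
  have [measurable]: "\<pi> n \<in> (\<Pi>\<^sub>M i\<in>{0..<n}. sa m) \<Otimes>\<^sub>M states m \<rightarrow>\<^sub>M subprob_algebra (actions m)"
    by (rule policy_subprob[OF \<pi>])
  have [measurable]: "Pair \<omega> \<in> states m \<rightarrow>\<^sub>M (\<Pi>\<^sub>M i\<in>{0..<n}. sa m) \<Otimes>\<^sub>M states m"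
    using \<omega> by (intro measurable_Pair1')
  have "(\<lambda>y. \<pi> n (\<omega>, y) \<bind> (\<lambda>a. return (sa m) (y, a))) \<in> states m \<rightarrow>\<^sub>M subprob_algebra (sa m)"
    by measurable
  then have 1: "(\<lambda>y. \<pi> n (\<omega>, y) \<bind> (\<lambda>a. return (sa m) (y, a))) \<in> ?N \<rightarrow>\<^sub>M subprob_algebra (sa m)"
    unfolding measurable_cong_sets[OF N refl] .
  have "(\<integral>\<^sup>+z. g z \<partial>step m \<pi> x n \<omega>) =
      (\<integral>\<^sup>+y. (\<integral>\<^sup>+z. g z \<partial>(\<pi> n (\<omega>, y) \<bind> (\<lambda>a. return (sa m) (y, a)))) \<partial>?N)"
    unfolding step_def by (rule nn_integral_bind[OF g 1])
  also have "\<dots> = (\<integral>\<^sup>+y. (\<integral>\<^sup>+a. g (y, a) \<partial>\<pi> n (\<omega>, y)) \<partial>?N)"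
  proof (rule nn_integral_cong)
    fix y assume "y \<in> space ?N"
    then have y: "y \<in> space (states m)"
      using N sets_eq_imp_space_eq by blast
    then have z: "(\<omega>, y) \<in> space ((\<Pi>\<^sub>M i\<in>{0..<n}. sa m) \<Otimes>\<^sub>M states m)"
      using \<omega> by (simp add: space_pair_measure)
    have s: "sets (\<pi> n (\<omega>, y)) = sets (actions m)"
      using subprob_measurableD(2)[OF policy_subprob[OF \<pi>] z] .
    have sp: "space (\<pi> n (\<omega>, y)) = space (actions m)"
      using s by (rule sets_eq_imp_space_eq)
    have "(\<lambda>a. return (sa m) (y, a)) \<in> \<pi> n (\<omega>, y) \<rightarrow>\<^sub>M subprob_algebra (sa m)"
      unfolding measurable_cong_sets[OF s refl]
      by (rule measurable_compose[OF measurable_Pair1'[OF y] return_measurable])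
    then have "(\<integral>\<^sup>+z. g z \<partial>(\<pi> n (\<omega>, y) \<bind> (\<lambda>a. return (sa m) (y, a))))
        = (\<integral>\<^sup>+a. (\<integral>\<^sup>+z. g z \<partial>return (sa m) (y, a)) \<partial>\<pi> n (\<omega>, y))"
      by (rule nn_integral_bind[OF g])
    also have "\<dots> = (\<integral>\<^sup>+a. g (y, a) \<partial>\<pi> n (\<omega>, y))"
      using y by (intro nn_integral_cong nn_integral_return g) (simp add: sp space_pair_measure)
    finally show "(\<integral>\<^sup>+z. g z \<partial>(\<pi> n (\<omega>, y) \<bind> (\<lambda>a. return (sa m) (y, a)))) = \<dots>" .
  qed
  finally show ?thesis .
qed

end

section \<open>The Ionescu-Tulcea law and its one-step identities\<close>

locale mdp_process = mdp_kernel m for m :: "('s, 'a) mdp" +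
  fixes \<pi> :: "('s, 'a) policy" and x :: 's
  assumes policy: "\<pi> \<in> policies m" and start: "x \<in> space (states m)"
begin

sublocale IT: Ionescu_Tulcea "step m \<pi> x" "\<lambda>_. sa m"
proof (rule Ionescu_Tulcea.intro)
  show "step m \<pi> x n \<in> (\<Pi>\<^sub>M i\<in>{0..<n}. sa m) \<rightarrow>\<^sub>M subprob_algebra (sa m)" for n
    by (rule measurable_prob_algebraD[OF step_measurable[OF policy start]])
  show "prob_space (step m \<pi> x n \<omega>)" if "\<omega> \<in> space (\<Pi>\<^sub>M i\<in>{0..<n}. sa m)" for n \<omega>
    using measurable_space[OF step_measurable[OF policy start] that]
    by (simp add: space_prob_algebra)
qed

abbreviation "law \<equiv> process_law m \<pi> x"

lemma sets_law [measurable_cong]: "sets law = sets (\<Pi>\<^sub>M i\<in>UNIV. sa m)"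
  by (simp add: process_law_def IT.PF.sets_lim)

text \<open>A function of the first \<open>n\<close> pairs only sees the finite composition
  \<open>IT.C 0 n\<close>, started from \<open>\<lambda>_. undefined\<close>, the one point of the
  empty product. One-step identities are obtained there and pulled back to the infinite
  process.\<close>

lemma nn_integral_law_prefix:
  assumes f: "f \<in> borel_measurable (\<Pi>\<^sub>M i\<in>{0..<n}. sa m)"
  shows "(\<integral>\<^sup>+\<omega>. f (restrict \<omega> {0..<n}) \<partial>law) = (\<integral>\<^sup>+\<omega>. f \<omega> \<partial>IT.C 0 n (\<lambda>_. undefined))"
proof -
  have un: "(\<lambda>_. undefined) \<in> space (\<Pi>\<^sub>M i\<in>{0..<0::nat}. sa m)"
    by (simp add: space_PiM)
  \<comment> \<open>\<open>IT.CI {0..<n}\<close> is a marginal of the composition of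
    \<open>IT.up_to {0..<n}\<close> steps; as this number is \<open>n\<close>, the marginal is the
    whole composition.\<close>
  have up: "IT.up_to {0..<n} = n"
  proof (rule antisym)
    show "n \<le> IT.up_to {0..<n}"
      using IT.up_to[of "{0..<n}"] by (cases n) auto
  qed (simp add: IT.up_to_iff)
  have "(\<integral>\<^sup>+\<omega>. f (restrict \<omega> {0..<n}) \<partial>law) =
      (\<integral>\<^sup>+\<omega>. f \<omega> \<partial>distr law (\<Pi>\<^sub>M i\<in>{0..<n}. sa m) (\<lambda>\<omega>. restrict \<omega> {0..<n}))"
    using f by (subst nn_integral_distr)
      (auto intro!: measurable_restrict measurable_component_singleton
        simp: measurable_cong_sets[OF sets_law refl])
  also have "distr law (\<Pi>\<^sub>M i\<in>{0..<n}. sa m) (\<lambda>\<omega>. restrict \<omega> {0..<n}) = IT.CI {0..<n}"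
    unfolding process_law_def by (rule IT.distr_lim) simp
  also have "IT.CI {0..<n} = IT.C 0 n (\<lambda>_. undefined)"
    using IT.distr_C[of n n "\<lambda>_. undefined" 0] un by (simp add: IT.CI_def up)
  finally show ?thesis .
qed

lemma prefix_measurable [measurable]:
  "(\<lambda>\<omega>. restrict \<omega> {0..<n}) \<in> (\<Pi>\<^sub>M i\<in>UNIV. sa m) \<rightarrow>\<^sub>M (\<Pi>\<^sub>M i\<in>{0..<n}. sa m)"
  by (auto intro!: measurable_restrict measurable_component_singleton)

lemma space_law: "space law = space (\<Pi>\<^sub>M i\<in>UNIV. sa m)"
  using sets_law by (rule sets_eq_imp_space_eq)

lemma prefix_in_space:
  "\<omega> \<in> space law \<Longrightarrow> restrict \<omega> {0..<n} \<in> space (\<Pi>\<^sub>M i\<in>{0..<n}. sa m)"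
  using measurable_space[OF prefix_measurable] by (simp add: space_law)

text \<open>\<open>IT.C 0 (Suc n)\<close> appends one step to \<open>IT.C 0 n\<close>; this is
  conditioning on the first \<open>n\<close> pairs.\<close>

lemma nn_integral_law_step:
  assumes g [measurable]: "g \<in> borel_measurable (sa m)"
  shows "(\<integral>\<^sup>+\<omega>. g (\<omega> n) \<partial>law) =
    (\<integral>\<^sup>+\<omega>. (\<integral>\<^sup>+z. g z \<partial>step m \<pi> x n (restrict \<omega> {0..<n})) \<partial>law)"
proof -
  have un: "(\<lambda>_. undefined) \<in> space (\<Pi>\<^sub>M i\<in>{0..<0::nat}. sa m)"
    by (simp add: space_PiM)
  have [measurable]: "(\<lambda>\<omega>. \<omega> n) \<in> (\<Pi>\<^sub>M i\<in>{0..<Suc n}. sa m) \<rightarrow>\<^sub>M sa m"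
    by (intro measurable_component_singleton) auto
  have "(\<integral>\<^sup>+\<omega>. g (\<omega> n) \<partial>law) = (\<integral>\<^sup>+\<omega>. g (restrict \<omega> {0..<Suc n} n) \<partial>law)"
    by simp
  also have "\<dots> = (\<integral>\<^sup>+\<omega>. g (\<omega> n) \<partial>IT.C 0 (Suc n) (\<lambda>_. undefined))"
    by (rule nn_integral_law_prefix) measurable
  also have "\<dots> = (\<integral>\<^sup>+\<omega>. (\<integral>\<^sup>+\<omega>'. g (\<omega>' n) \<partial>IT.eP n \<omega>) \<partial>IT.C 0 n (\<lambda>_. undefined))"
    using IT.measurable_eP[of n] IT.sets_C[OF un, of n]
    by (simp, intro nn_integral_bind[where B="\<Pi>\<^sub>M i\<in>{0..<Suc n}. sa m"])
       (simp_all cong: measurable_cong_sets)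
  also have "\<dots> = (\<integral>\<^sup>+\<omega>. (\<integral>\<^sup>+z. g z \<partial>step m \<pi> x n \<omega>) \<partial>IT.C 0 n (\<lambda>_. undefined))"
    using IT.space_C[OF un, of n]
    by (intro nn_integral_cong) (simp add: IT.nn_integral_eP)
  also have "\<dots> = (\<integral>\<^sup>+\<omega>. (\<integral>\<^sup>+z. g z \<partial>step m \<pi> x n (restrict \<omega> {0..<n})) \<partial>law)"
    by (rule nn_integral_law_prefix[symmetric]) (use IT.P[of n] in measurable)
  finally show ?thesis .
qed

lemma prob_space_law: "prob_space law"
proof
  have "(\<integral>\<^sup>+\<omega>. 1 \<partial>law) = (\<integral>\<^sup>+\<omega>. 1 \<partial>IT.C 0 0 (\<lambda>_. undefined))"
    by (rule nn_integral_law_prefix) simp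
  then show "emeasure law (space law) = 1"
    using prob_space.emeasure_space_1[OF IT.prob_space_C[of "\<lambda>_. undefined" 0 0]]
    by (simp add: space_PiM)
qed

lemma state_measurable: "z \<in> space (sa m) \<Longrightarrow> fst z \<in> space (states m)"
  by (auto simp: space_pair_measure)

lemma coordinate_in_space: "\<omega> \<in> space law \<Longrightarrow> \<omega> n \<in> space (sa m)"
  by (auto simp: space_law space_PiM)

lemma coordinate_measurable [measurable]: "(\<lambda>\<omega>. \<omega> n) \<in> law \<rightarrow>\<^sub>M sa m"
  unfolding measurable_cong_sets[OF sets_law refl] by (intro measurable_component_singleton) simp

text \<open>The hypothesis is averaged over the action but not over the history: for a randomized
  policy, an inequality may be available only on average over its actions.\<close>

lemma nn_integral_law_le:
  assumes f: "f \<in> borel_measurable (sa m)" and g: "g \<in> borel_measurable (sa m)"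
    and le: "\<And>z. z \<in> space (histories m n) \<Longrightarrow>
      (\<integral>\<^sup>+a. f (snd z, a) \<partial>\<pi> n z) \<le> (\<integral>\<^sup>+a. g (snd z, a) \<partial>\<pi> n z)"
  shows "(\<integral>\<^sup>+\<omega>. f (\<omega> n) \<partial>law) \<le> (\<integral>\<^sup>+\<omega>. g (\<omega> n) \<partial>law)"
  unfolding nn_integral_law_step[OF f] nn_integral_law_step[OF g]
proof (rule nn_integral_mono)
  fix \<omega> assume "\<omega> \<in> space law"
  then have \<omega>: "restrict \<omega> {0..<n} \<in> space (\<Pi>\<^sub>M i\<in>{0..<n}. sa m)"
    by (rule prefix_in_space)
  let ?N = "if n = 0 then return (states m) x else kernel m (restrict \<omega> {0..<n} (n - 1))"
  have "space ?N = space (states m)"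
  proof (cases "n = 0")
    case False
    then have "restrict \<omega> {0..<n} (n - 1) \<in> space (sa m)"
      using \<omega> by (auto simp: space_PiM)
    with False show ?thesis
      using subprob_measurableD(1)[OF kernel_subprob] by simp
  qed simp
  then show "(\<integral>\<^sup>+z. f z \<partial>step m \<pi> x n (restrict \<omega> {0..<n})) \<le>
      (\<integral>\<^sup>+z. g z \<partial>step m \<pi> x n (restrict \<omega> {0..<n}))"
    unfolding nn_integral_step[OF policy start \<omega> f] nn_integral_step[OF policy start \<omega> g]
    using le[of "(restrict \<omega> {0..<n}, y)" for y] \<omega>
    by (intro nn_integral_mono[of ?N]) (simp add: space_histories)
qed

lemma nn_integral_law_eq:
  assumes "f \<in> borel_measurable (sa m)" and "g \<in> borel_measurable (sa m)"
    and "\<And>z. z \<in> space (histories m n) \<Longrightarrow>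
      (\<integral>\<^sup>+a. f (snd z, a) \<partial>\<pi> n z) = (\<integral>\<^sup>+a. g (snd z, a) \<partial>\<pi> n z)"
  shows "(\<integral>\<^sup>+\<omega>. f (\<omega> n) \<partial>law) = (\<integral>\<^sup>+\<omega>. g (\<omega> n) \<partial>law)"
  using assms by (intro antisym nn_integral_law_le) auto

lemma nn_integral_law_0:
  assumes g: "g \<in> borel_measurable (sa m)"
  shows "(\<integral>\<^sup>+\<omega>. g (\<omega> 0) \<partial>law) = (\<integral>\<^sup>+a. g (x, a) \<partial>\<pi> 0 (\<lambda>_. undefined, x))"
proof -
  have un: "(\<lambda>_. undefined) \<in> space (\<Pi>\<^sub>M i\<in>{0..<0::nat}. sa m)"
    by (simp add: space_PiM)
  have [measurable]: "Pair (\<lambda>_. undefined) \<in> states m \<rightarrow>\<^sub>M (\<Pi>\<^sub>M i\<in>{0..<0::nat}. sa m) \<Otimes>\<^sub>M states m"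
    using un by (intro measurable_Pair1')
  have "(\<lambda>y. \<pi> 0 (\<lambda>_. undefined, y)) \<in> states m \<rightarrow>\<^sub>M subprob_algebra (actions m)"
    by (rule measurable_compose[OF _ policy_subprob[OF policy]]) measurable
  then have "(\<lambda>y. \<integral>\<^sup>+a. g (y, a) \<partial>\<pi> 0 (\<lambda>_. undefined, y)) \<in> borel_measurable (states m)"
    using g by (intro nn_integral_measurable_subprob_algebra2) simp_all
  then show ?thesis
    unfolding nn_integral_law_step[OF g]
    using nn_integral_step[OF policy start un g] prob_space.emeasure_space_1[OF prob_space_law] start
    by (simp add: nn_integral_return restrict_def)
qed

text \<open>The decision at time \<open>Suc n\<close> integrates out, as \<open>u\<close> sees only
  the state; what is left of the step is the transition from time \<open>n\<close>.\<close>

lemma nn_integral_law_kernel: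
  assumes u [measurable]: "u \<in> borel_measurable (states m)"
  shows "(\<integral>\<^sup>+\<omega>. (\<integral>\<^sup>+y. u y \<partial>kernel m (\<omega> n)) \<partial>law) = (\<integral>\<^sup>+\<omega>. u (fst (\<omega> (Suc n))) \<partial>law)"
proof -
  have g: "(\<lambda>z. u (fst z)) \<in> borel_measurable (sa m)"
    by measurable
  have "(\<integral>\<^sup>+\<omega>. u (fst (\<omega> (Suc n))) \<partial>law) =
      (\<integral>\<^sup>+\<omega>. (\<integral>\<^sup>+z. u (fst z) \<partial>step m \<pi> x (Suc n) (restrict \<omega> {0..<Suc n})) \<partial>law)"
    by (rule nn_integral_law_step[OF g])
  also have "\<dots> = (\<integral>\<^sup>+\<omega>. (\<integral>\<^sup>+y. u y \<partial>kernel m (\<omega> n)) \<partial>law)"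
  proof (rule nn_integral_cong)
    fix \<omega> assume \<omega>: "\<omega> \<in> space law"
    note p = prefix_in_space[OF \<omega>, of "Suc n"]
    have "(\<integral>\<^sup>+a. u y \<partial>\<pi> (Suc n) (restrict \<omega> {0..<Suc n}, y)) = u y"
      if "y \<in> space (kernel m (\<omega> n))" for y
    proof -
      have "y \<in> space (states m)"
        using that subprob_measurableD(1)[OF kernel_subprob coordinate_in_space[OF \<omega>]] by simp
      then have "(restrict \<omega> {0..<Suc n}, y) \<in> space (histories m (Suc n))"
        using p by (simp add: space_histories)
      then show ?thesis
        by (rule nn_integral_policy_const[OF policy])
    qed
    then have "(\<integral>\<^sup>+y. (\<integral>\<^sup>+a. u y \<partial>\<pi> (Suc n) (restrict \<omega> {0..<Suc n}, y)) \<partial>kernel m (\<omega> n)) =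
        (\<integral>\<^sup>+y. u y \<partial>kernel m (\<omega> n))"
      by (rule nn_integral_cong)
    then show "(\<integral>\<^sup>+z. u (fst z) \<partial>step m \<pi> x (Suc n) (restrict \<omega> {0..<Suc n}))
        = (\<integral>\<^sup>+y. u y \<partial>kernel m (\<omega> n))"
      unfolding nn_integral_step[OF policy start p g] by (simp del: nn_integral_const)
  qed
  finally show ?thesis ..
qed

lemma nn_integral_law_le_const:
  assumes "\<And>y. y \<in> space (states m) \<Longrightarrow> u y \<le> B"
  shows "(\<integral>\<^sup>+\<omega>. u (fst (\<omega> n)) \<partial>law) \<le> B"
proof -
  have "(\<integral>\<^sup>+\<omega>. u (fst (\<omega> n)) \<partial>law) \<le> (\<integral>\<^sup>+\<omega>. B \<partial>law)"
    by (intro nn_integral_mono assms state_measurable coordinate_in_space)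
  also have "\<dots> = B"
    by (simp add: prob_space.emeasure_space_1[OF prob_space_law])
  finally show ?thesis .
qed

lemma nn_integral_kernel_measurable [measurable]:
  "u \<in> borel_measurable (states m) \<Longrightarrow> (\<lambda>z. \<integral>\<^sup>+y. u y \<partial>kernel m z) \<in> borel_measurable (sa m)"
  by (rule measurable_compose[OF kernel_subprob nn_integral_measurable_subprob_algebra])

section \<open>Telescoping of one-step inequalities\<close>

context
  fixes c :: "'s \<times> 'a \<Rightarrow> ennreal" and u :: "'s \<Rightarrow> ennreal" and \<alpha> \<beta> :: ennreal
  assumes c [measurable]: "c \<in> borel_measurable (sa m)"
    and u [measurable]: "u \<in> borel_measurable (states m)"
begin

lemma expected_start: "(\<integral>\<^sup>+\<omega>. u (fst (\<omega> 0)) \<partial>law) = u x"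
proof -
  have "(\<lambda>_. undefined, x) \<in> space (histories m 0)"
    using start by (simp add: space_histories space_PiM)
  from nn_integral_policy_const[OF policy this, of "u x"] show ?thesis
    using nn_integral_law_0[of "\<lambda>z. u (fst z)"] by (simp del: nn_integral_const)
qed

lemma expected_const:
  "(\<integral>\<^sup>+\<omega>. \<alpha> + u (fst (\<omega> n)) \<partial>law) = \<alpha> + (\<integral>\<^sup>+\<omega>. u (fst (\<omega> n)) \<partial>law)"
proof -
  have [measurable]: "(\<lambda>\<omega>. u (fst (\<omega> n))) \<in> borel_measurable law"
    by (rule measurable_compose[OF coordinate_measurable]) measurable
  show ?thesis
    by (subst nn_integral_add) (simp_all add: prob_space.emeasure_space_1[OF prob_space_law])
qed

lemma expected_step:
  "(\<integral>\<^sup>+\<omega>. c (\<omega> n) + \<beta> * (\<integral>\<^sup>+y. u y \<partial>kernel m (\<omega> n)) \<partial>law) =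
    (\<integral>\<^sup>+\<omega>. c (\<omega> n) \<partial>law) + \<beta> * (\<integral>\<^sup>+\<omega>. u (fst (\<omega> (Suc n))) \<partial>law)"
proof -
  have [measurable]: "(\<lambda>\<omega>. c (\<omega> n)) \<in> borel_measurable law"
    "(\<lambda>\<omega>. \<integral>\<^sup>+y. u y \<partial>kernel m (\<omega> n)) \<in> borel_measurable law"
    by (rule measurable_compose[OF coordinate_measurable], measurable)+
  show ?thesis
    by (simp add: nn_integral_add nn_integral_cmult nn_integral_law_kernel)
qed

text \<open>Two uses: \<open>\<alpha>\<close> a gain with \<open>\<beta> = 1\<close>, and
  \<open>\<alpha> = 0\<close> with \<open>\<beta>\<close> the discount factor. The terminal
  expectation stays on the larger side as a summand, since moving it across would need subtraction
  in ennreal.\<close>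

lemma telescope_le:
  assumes "\<And>n z. z \<in> space (histories m n) \<Longrightarrow>
    \<alpha> + u (snd z) \<le> (\<integral>\<^sup>+a. c (snd z, a) + \<beta> * (\<integral>\<^sup>+y. u y \<partial>kernel m (snd z, a)) \<partial>\<pi> n z)"
  shows "(\<Sum>n<N. \<beta> ^ n * \<alpha>) + u x \<le>
    (\<Sum>n<N. \<beta> ^ n * (\<integral>\<^sup>+\<omega>. c (\<omega> n) \<partial>law)) + \<beta> ^ N * (\<integral>\<^sup>+\<omega>. u (fst (\<omega> N)) \<partial>law)"
proof (induction N)
  case 0
  show ?case by (simp add: expected_start)
next
  case (Suc N)
  let ?E = "\<lambda>n. \<integral>\<^sup>+\<omega>. c (\<omega> n) \<partial>law" and ?U = "\<lambda>n. \<integral>\<^sup>+\<omega>. u (fst (\<omega> n)) \<partial>law"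
  have "\<alpha> + ?U N \<le> ?E N + \<beta> * ?U (Suc N)"
    unfolding expected_const[symmetric] expected_step[symmetric]
    using assms by (intro nn_integral_law_le)
      (simp_all add: nn_integral_policy_const[OF policy] del: nn_integral_const)
  from mult_left_mono[OF this, of "\<beta> ^ N"]
  have *: "\<beta> ^ N * \<alpha> + \<beta> ^ N * ?U N \<le> \<beta> ^ N * ?E N + \<beta> ^ Suc N * ?U (Suc N)"
    by (simp add: distrib_left mult_ac)
  have "(\<Sum>n<Suc N. \<beta> ^ n * \<alpha>) + u x = \<beta> ^ N * \<alpha> + ((\<Sum>n<N. \<beta> ^ n * \<alpha>) + u x)"
    by (simp add: ac_simps)
  also have "\<dots> \<le> \<beta> ^ N * \<alpha> + ((\<Sum>n<N. \<beta> ^ n * ?E n) + \<beta> ^ N * ?U N)"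
    by (intro add_left_mono Suc)
  also have "\<dots> = (\<Sum>n<N. \<beta> ^ n * ?E n) + (\<beta> ^ N * \<alpha> + \<beta> ^ N * ?U N)"
    by (simp add: ac_simps)
  also have "\<dots> \<le> (\<Sum>n<N. \<beta> ^ n * ?E n) + (\<beta> ^ N * ?E N + \<beta> ^ Suc N * ?U (Suc N))"
    by (intro add_left_mono *)
  finally show ?case
    by (simp add: ac_simps)
qed

lemma telescope_ge:
  assumes "\<And>n z. z \<in> space (histories m n) \<Longrightarrow>
    (\<integral>\<^sup>+a. c (snd z, a) + \<beta> * (\<integral>\<^sup>+y. u y \<partial>kernel m (snd z, a)) \<partial>\<pi> n z) \<le> \<alpha> + u (snd z)"
  shows "(\<Sum>n<N. \<beta> ^ n * (\<integral>\<^sup>+\<omega>. c (\<omega> n) \<partial>law)) + \<beta> ^ N * (\<integral>\<^sup>+\<omega>. u (fst (\<omega> N)) \<partial>law)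
    \<le> (\<Sum>n<N. \<beta> ^ n * \<alpha>) + u x"
proof (induction N)
  case 0
  show ?case by (simp add: expected_start)
next
  case (Suc N)
  let ?E = "\<lambda>n. \<integral>\<^sup>+\<omega>. c (\<omega> n) \<partial>law" and ?U = "\<lambda>n. \<integral>\<^sup>+\<omega>. u (fst (\<omega> n)) \<partial>law"
  have "?E N + \<beta> * ?U (Suc N) \<le> \<alpha> + ?U N"
    unfolding expected_const[symmetric] expected_step[symmetric]
    using assms by (intro nn_integral_law_le)
      (simp_all add: nn_integral_policy_const[OF policy] del: nn_integral_const)
  from mult_left_mono[OF this, of "\<beta> ^ N"]
  have *: "\<beta> ^ N * ?E N + \<beta> ^ Suc N * ?U (Suc N) \<le> \<beta> ^ N * \<alpha> + \<beta> ^ N * ?U N"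
    by (simp add: distrib_left mult_ac)
  have "(\<Sum>n<Suc N. \<beta> ^ n * ?E n) + \<beta> ^ Suc N * ?U (Suc N) =
      (\<Sum>n<N. \<beta> ^ n * ?E n) + (\<beta> ^ N * ?E N + \<beta> ^ Suc N * ?U (Suc N))"
    by (simp add: ac_simps)
  also have "\<dots> \<le> (\<Sum>n<N. \<beta> ^ n * ?E n) + (\<beta> ^ N * \<alpha> + \<beta> ^ N * ?U N)"
    by (intro add_left_mono *)
  also have "\<dots> = \<beta> ^ N * \<alpha> + ((\<Sum>n<N. \<beta> ^ n * ?E n) + \<beta> ^ N * ?U N)"
    by (simp add: ac_simps)
  also have "\<dots> \<le> \<beta> ^ N * \<alpha> + ((\<Sum>n<N. \<beta> ^ n * \<alpha>) + u x)"
    by (intro add_left_mono Suc)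
  finally show ?case
    by (simp add: ac_simps)
qed

end

section \<open>From one-step inequalities to average and discounted costs\<close>

lemma integral_feasible_le:
  assumes u: "\<And>y a. y \<in> space (states m) \<Longrightarrow> a \<in> avail m y \<Longrightarrow> r y \<le> f (y, a)"
    and z: "z \<in> space (histories m n)"
  shows "r (snd z) \<le> (\<integral>\<^sup>+a. f (snd z, a) \<partial>\<pi> n z)"
proof -
  have "snd z \<in> space (states m)"
    using z by (auto simp: space_histories)
  with policy_avail_AE[OF policy z]
  have "(\<integral>\<^sup>+a. r (snd z) \<partial>\<pi> n z) \<le> (\<integral>\<^sup>+a. f (snd z, a) \<partial>\<pi> n z)"
    by (intro nn_integral_mono_AE) (auto intro: u elim: eventually_mono)
  then show ?thesis
    unfolding nn_integral_policy_const[OF policy z] .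
qed

lemma expected_total:
  "(\<integral>\<^sup>+\<omega>. (\<Sum>n<N. ennreal (cost m (\<omega> n))) \<partial>law) = (\<Sum>n<N. \<integral>\<^sup>+\<omega>. ennreal (cost m (\<omega> n)) \<partial>law)"
  using measurable_compose[OF coordinate_measurable cost_measurable] by (intro nn_integral_sum) simp

lemma disc_cost_eq:
  assumes \<beta>: "0 \<le> \<beta>"
  shows "disc_cost m \<beta> \<pi> x = (\<Sum>n. ennreal \<beta> ^ n * (\<integral>\<^sup>+\<omega>. ennreal (cost m (\<omega> n)) \<partial>law))"
proof -
  note [measurable] = measurable_compose[OF coordinate_measurable cost_measurable]
  show ?thesis
    using \<beta> unfolding disc_cost_def
    by (simp add: nn_integral_suminf nn_integral_cmult ennreal_mult' ennreal_power)
qed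

text \<open>Telescoping leaves \<open>u\<close> at the final state, which \<open>B\<close> bounds
  uniformly, so its share vanishes after division by \<open>N\<close>. The inequality is assumed at
  every feasible action because the policy is arbitrary.\<close>

lemma avg_cost_ge:
  assumes u: "u \<in> borel_measurable (states m)" "\<And>y. y \<in> space (states m) \<Longrightarrow> u y \<le> ennreal B"
    and le: "\<And>y a. y \<in> space (states m) \<Longrightarrow> a \<in> avail m y \<Longrightarrow>
      \<alpha> + u y \<le> ennreal (cost m (y, a)) + (\<integral>\<^sup>+y'. u y' \<partial>kernel m (y, a))"
  shows "\<alpha> \<le> avg_cost m \<pi> x"
proof -
  let ?S = "\<lambda>N. \<Sum>n<N. \<integral>\<^sup>+\<omega>. ennreal (cost m (\<omega> n)) \<partial>law"
  have *: "of_nat N * \<alpha> \<le> ?S N + ennreal B" for N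
  proof -
    have "of_nat N * \<alpha> \<le> of_nat N * \<alpha> + u x"
      by simp
    also have "\<dots> \<le> ?S N + (\<integral>\<^sup>+\<omega>. u (fst (\<omega> N)) \<partial>law)"
      using telescope_le[where c="\<lambda>z. ennreal (cost m z)" and u=u and \<beta>=1 and \<alpha>=\<alpha> and N=N]
        integral_feasible_le[where r="\<lambda>y. \<alpha> + u y", OF le] u(1)
      by simp
    also have "\<dots> \<le> ?S N + ennreal B"
      by (intro add_left_mono nn_integral_law_le_const u)
    finally show ?thesis .
  qed
  \<comment> \<open>\<open>B\<close> may be negative;
    \<open>ennreal B = ennreal (max 0 B)\<close>.\<close>
  have lim: "(\<lambda>N. ennreal (max 0 B / real N)) \<longlonglongrightarrow> ennreal 0"
    by (intro tendsto_ennrealI lim_const_over_n)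
  show ?thesis
  proof (rule ennreal_le_epsilon)
    fix \<epsilon> :: real assume "\<epsilon> > 0"
    then have "eventually (\<lambda>N. ennreal (max 0 B / real N) < ennreal \<epsilon>) sequentially"
      using order_tendstoD(2)[OF lim, of "ennreal \<epsilon>"] by (simp add: ennreal_less_iff)
    then have "eventually (\<lambda>N. \<alpha> - ennreal \<epsilon> \<le> ?S N / of_nat N) sequentially"
      using eventually_gt_at_top[of 0]
    proof eventually_elim
      case (elim N)
      have "\<alpha> = of_nat N * \<alpha> / of_nat N"
        using elim by (simp add: ennreal_mult_divide_eq mult.commute)
      also have "\<dots> \<le> (?S N + ennreal B) / of_nat N"
        by (intro divide_right_mono_ennreal *)
      also have "\<dots> = ?S N / of_nat N + ennreal B / of_nat N"
        by (rule add_divide_distrib_ennreal)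
      also have "ennreal B / of_nat N = ennreal (max 0 B / real N)"
        using elim divide_ennreal[of "max 0 B" "real N"]
        by (simp add: ennreal_of_nat_eq_real_of_nat ennreal_max_0')
      also have "\<dots> \<le> ennreal \<epsilon>"
        using elim by simp
      finally show ?case
        by (simp add: ennreal_minus_le_iff add.commute)
    qed
    then have "\<alpha> - ennreal \<epsilon> \<le> avg_cost m \<pi> x"
      unfolding avg_cost_def expected_total by (intro le_Limsup) auto
    then show "\<alpha> \<le> avg_cost m \<pi> x + ennreal \<epsilon>"
      by (simp add: ennreal_minus_le_iff add.commute)
  qed
qed

text \<open>Here the terminal term is nonnegative on the smaller side and is dropped, so only
  \<open>u x\<close> has to be finite. The hypothesis is averaged over the action, the form in which
  the evaluation equation of a stationary policy comes.\<close>

lemma avg_cost_le: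
  assumes u: "u \<in> borel_measurable (states m)" "u x < \<infinity>"
    and le: "\<And>n z. z \<in> space (histories m n) \<Longrightarrow>
      (\<integral>\<^sup>+a. ennreal (cost m (snd z, a)) + (\<integral>\<^sup>+y. u y \<partial>kernel m (snd z, a)) \<partial>\<pi> n z) \<le> \<alpha> + u (snd z)"
  shows "avg_cost m \<pi> x \<le> \<alpha>"
proof -
  let ?S = "\<lambda>N. \<Sum>n<N. \<integral>\<^sup>+\<omega>. ennreal (cost m (\<omega> n)) \<partial>law"
  obtain r where r: "0 \<le> r" "u x = ennreal r"
    using u(2) by (cases "u x") auto
  have "?S N \<le> of_nat N * \<alpha> + ennreal r" for N
  proof -
    have "?S N \<le> ?S N + (\<integral>\<^sup>+\<omega>. u (fst (\<omega> N)) \<partial>law)"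
      by simp
    also have "\<dots> \<le> of_nat N * \<alpha> + ennreal r"
      using telescope_ge[where c="\<lambda>z. ennreal (cost m z)" and u=u and \<beta>=1 and \<alpha>=\<alpha> and N=N] le u(1)
      by (simp add: r)
    finally show ?thesis .
  qed
  then have "eventually (\<lambda>N. ?S N / of_nat N \<le> \<alpha> + ennreal (r / real N)) sequentially"
  proof (intro eventually_mono[OF eventually_gt_at_top[of 0]])
    fix N :: nat assume N: "0 < N" and S: "\<And>N. ?S N \<le> of_nat N * \<alpha> + ennreal r"
    have "?S N / of_nat N \<le> (of_nat N * \<alpha> + ennreal r) / of_nat N"
      by (intro divide_right_mono_ennreal S)
    also have "\<dots> = \<alpha> + ennreal (r / real N)"
      using N r by (simp add: add_divide_distrib_ennreal ennreal_mult_divide_eq mult.commute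
        ennreal_of_nat_eq_real_of_nat divide_ennreal)
    finally show "?S N / of_nat N \<le> \<alpha> + ennreal (r / real N)" .
  qed
  then have "avg_cost m \<pi> x \<le> limsup (\<lambda>N. \<alpha> + ennreal (r / real N))"
    unfolding avg_cost_def expected_total by (rule Limsup_mono)
  also have "\<dots> = \<alpha> + ennreal 0"
    by (intro lim_imp_Limsup tendsto_add tendsto_const tendsto_ennrealI lim_const_over_n) simp
  finally show ?thesis
    by simp
qed

text \<open>Boundedness of \<open>u\<close> makes the terminal term vanish like
  \<open>\<beta> ^ N\<close>; in the opposite bound \<open>disc_cost_le\<close> it is dropped by
  nonnegativity.\<close>

lemma disc_cost_ge:
  assumes \<beta>: "0 \<le> \<beta>" "\<beta> < 1"
    and u: "u \<in> borel_measurable (states m)" "\<And>y. y \<in> space (states m) \<Longrightarrow> u y \<le> ennreal B"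
    and le: "\<And>y a. y \<in> space (states m) \<Longrightarrow> a \<in> avail m y \<Longrightarrow>
      u y \<le> ennreal (cost m (y, a)) + ennreal \<beta> * (\<integral>\<^sup>+y'. u y' \<partial>kernel m (y, a))"
  shows "u x \<le> disc_cost m \<beta> \<pi> x"
proof -
  have *: "u x \<le> disc_cost m \<beta> \<pi> x + ennreal (\<beta> ^ N * max 0 B)" for N
  proof -
    have "u x \<le> (\<Sum>n<N. ennreal \<beta> ^ n * (\<integral>\<^sup>+\<omega>. ennreal (cost m (\<omega> n)) \<partial>law)) +
        ennreal \<beta> ^ N * (\<integral>\<^sup>+\<omega>. u (fst (\<omega> N)) \<partial>law)"
      using telescope_le[where c="\<lambda>z. ennreal (cost m z)" and u=u and \<beta>="ennreal \<beta>" and \<alpha>=0 and N=N]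
        integral_feasible_le[where r=u, OF le] u(1)
      by simp
    also have "\<dots> \<le> disc_cost m \<beta> \<pi> x + ennreal \<beta> ^ N * ennreal B"
      unfolding disc_cost_eq[OF \<beta>(1)]
      by (intro add_mono sum_le_suminf mult_left_mono nn_integral_law_le_const u) auto
    also have "ennreal \<beta> ^ N * ennreal B = ennreal (\<beta> ^ N * max 0 B)"
      using \<beta> by (simp add: ennreal_mult ennreal_power)
    finally show ?thesis .
  qed
  have "(\<lambda>N. ennreal (\<beta> ^ N * max 0 B)) \<longlonglongrightarrow> ennreal (0 * max 0 B)"
    using \<beta> by (intro tendsto_ennrealI tendsto_mult tendsto_const LIMSEQ_power_zero) auto
  from LIMSEQ_le_const[OF tendsto_add[OF tendsto_const this]] *
  show ?thesis by fastforce
qed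

lemma disc_cost_le:
  assumes \<beta>: "0 \<le> \<beta>"
    and u: "u \<in> borel_measurable (states m)"
    and le: "\<And>n z. z \<in> space (histories m n) \<Longrightarrow>
      (\<integral>\<^sup>+a. ennreal (cost m (snd z, a)) + ennreal \<beta> * (\<integral>\<^sup>+y. u y \<partial>kernel m (snd z, a)) \<partial>\<pi> n z)
        \<le> u (snd z)"
  shows "disc_cost m \<beta> \<pi> x \<le> u x"
  unfolding disc_cost_eq[OF \<beta>]
proof (rule suminf_le_const)
  fix N
  have "(\<Sum>n<N. ennreal \<beta> ^ n * (\<integral>\<^sup>+\<omega>. ennreal (cost m (\<omega> n)) \<partial>law)) \<le>
      (\<Sum>n<N. ennreal \<beta> ^ n * (\<integral>\<^sup>+\<omega>. ennreal (cost m (\<omega> n)) \<partial>law)) +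
        ennreal \<beta> ^ N * (\<integral>\<^sup>+\<omega>. u (fst (\<omega> N)) \<partial>law)"
    by simp
  also have "\<dots> \<le> u x"
    using telescope_ge[where c="\<lambda>z. ennreal (cost m z)" and u=u and \<beta>="ennreal \<beta>" and \<alpha>=0 and N=N] le u
    by simp
  finally show "(\<Sum>n<N. ennreal \<beta> ^ n * (\<integral>\<^sup>+\<omega>. ennreal (cost m (\<omega> n)) \<partial>law)) \<le> u x" .
qed simp

end

section \<open>Selector policies and deviations\<close>

context mdp_kernel
begin

lemma selector_measurable: "\<phi> \<in> selectors m \<Longrightarrow> \<phi> \<in> states m \<rightarrow>\<^sub>M actions m"
  by (simp add: selectors_def)

lemma nn_integral_selector_policy:
  assumes "\<phi> \<in> selectors m" and "z \<in> space (histories m n)" and "f \<in> borel_measurable (actions m)"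
  shows "(\<integral>\<^sup>+a. f a \<partial>selector_policy m \<phi> n z) = f (\<phi> (snd z))"
proof -
  have "\<phi> (snd z) \<in> space (actions m)"
    using assms(2) by (intro measurable_space[OF selector_measurable[OF assms(1)]])
      (auto simp: space_histories)
  then show ?thesis
    unfolding selector_policy_def by (rule nn_integral_return[OF _ assms(3)])
qed

lemma selector_policy_policies:
  assumes \<phi>: "\<phi> \<in> selectors m"
  shows "selector_policy m \<phi> \<in> policies m"
proof -
  have "selector_policy m \<phi> n \<in> histories m n \<rightarrow>\<^sub>M prob_algebra (actions m)" for n
    unfolding selector_policy_def[abs_def] histories_def
    by (rule measurable_compose[OF measurable_compose[OF measurable_snd selector_measurable[OF \<phi>]]
        measurable_return_prob_space])
  moreover have "emeasure (selector_policy m \<phi> n z) (avail m (snd z)) = 1" if "z \<in> space (histories m n)" for n z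
    using that \<phi> avail_sets by (auto simp: selector_policy_def space_histories selectors_def)
  ultimately show ?thesis
    unfolding policies_def by blast
qed

text \<open>Policies are constrained epoch by epoch, so decision rules of two policies may be
  interleaved. The case \<open>J = {0}\<close> is the one-step deviation.\<close>

lemma deviation_policy:
  assumes "\<phi> \<in> selectors m" and \<pi>: "\<pi> \<in> policies m"
  shows "(\<lambda>n. if n \<in> J then selector_policy m \<phi> n else \<pi> n) \<in> policies m"
proof -
  note \<sigma> = selector_policy_policies[OF assms(1)]
  have "(if n \<in> J then selector_policy m \<phi> n else \<pi> n) \<in> histories m n \<rightarrow>\<^sub>M prob_algebra (actions m) \<and>
      (\<forall>z\<in>space (histories m n). emeasure ((if n \<in> J then selector_policy m \<phi> n else \<pi> n) z) (avail m (snd z)) = 1)" for n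
    using \<pi> \<sigma> unfolding policies_def mem_Collect_eq by presburger
  then show ?thesis
    unfolding policies_def by blast
qed

end

section \<open>Stationary policies and one-step deviations\<close>

locale mdp_decision = mdp_kernel m for m :: "('s, 'a) mdp" +
  fixes \<kappa> :: "'s \<Rightarrow> 'a measure"
  assumes decision [measurable]: "\<kappa> \<in> states m \<rightarrow>\<^sub>M subprob_algebra (actions m)"
begin

definition next_op :: "('s \<times> 'a \<Rightarrow> ennreal) \<Rightarrow> 's \<times> 'a \<Rightarrow> ennreal" where
  "next_op g z = (\<integral>\<^sup>+y. (\<integral>\<^sup>+a. g (y, a) \<partial>\<kappa> y) \<partial>kernel m z)"

text \<open>The action-value function: discounted cost when the first pair is \<open>z\<close> and
  later decisions follow \<open>\<kappa>\<close>. As an explicit series it is measurable and can be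
  unfolded without mentioning the process.\<close>

definition Q_value :: "real \<Rightarrow> 's \<times> 'a \<Rightarrow> ennreal" where
  "Q_value \<beta> z = (\<Sum>n. ennreal \<beta> ^ n * (next_op ^^ n) (\<lambda>z. ennreal (cost m z)) z)"

lemma decision_integral_measurable [measurable]:
  "g \<in> borel_measurable (sa m) \<Longrightarrow> (\<lambda>y. \<integral>\<^sup>+a. g (y, a) \<partial>\<kappa> y) \<in> borel_measurable (states m)"
  by (intro nn_integral_measurable_subprob_algebra2[OF _ decision]) simp

lemma next_op_measurable [measurable]:
  assumes [measurable]: "g \<in> borel_measurable (sa m)"
  shows "next_op g \<in> borel_measurable (sa m)"
  unfolding next_op_def[abs_def]
  by (rule measurable_compose[OF kernel_subprob nn_integral_measurable_subprob_algebra]) measurable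

lemma next_op_funpow_measurable [measurable]:
  "g \<in> borel_measurable (sa m) \<Longrightarrow> (next_op ^^ n) g \<in> borel_measurable (sa m)"
  by (induction n) simp_all

lemma Q_value_measurable [measurable]: "Q_value \<beta> \<in> borel_measurable (sa m)"
  unfolding Q_value_def[abs_def] by measurable

lemma next_op_suminf:
  assumes g: "\<And>n. g n \<in> borel_measurable (sa m)" and z: "z \<in> space (sa m)"
  shows "next_op (\<lambda>z. \<Sum>n. r n * g n z) z = (\<Sum>n. r n * next_op (g n) z)"
proof -
  have "(\<integral>\<^sup>+a. (\<Sum>n. r n * g n (y, a)) \<partial>\<kappa> y) = (\<Sum>n. r n * (\<integral>\<^sup>+a. g n (y, a) \<partial>\<kappa> y))"
    if y: "y \<in> space (states m)" for y
  proof -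
    have [measurable]: "(\<lambda>a. g n (y, a)) \<in> borel_measurable (\<kappa> y)" for n
      unfolding subprob_measurableD(3)[OF decision y]
      by (rule measurable_compose[OF measurable_Pair1'[OF y] g])
    show ?thesis
      by (simp add: nn_integral_suminf nn_integral_cmult)
  qed
  then have "next_op (\<lambda>z. \<Sum>n. r n * g n z) z =
      (\<integral>\<^sup>+y. (\<Sum>n. r n * (\<integral>\<^sup>+a. g n (y, a) \<partial>\<kappa> y)) \<partial>kernel m z)"
    unfolding next_op_def
    by (intro nn_integral_cong) (simp add: subprob_measurableD(1)[OF kernel_subprob z])
  also have "\<dots> = (\<Sum>n. r n * next_op (g n) z)"
  proof -
    have [measurable]: "(\<lambda>y. \<integral>\<^sup>+a. g n (y, a) \<partial>\<kappa> y) \<in> borel_measurable (kernel m z)" for n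
      unfolding subprob_measurableD(3)[OF kernel_subprob z]
      by (rule decision_integral_measurable[OF g])
    show ?thesis
      unfolding next_op_def by (simp add: nn_integral_suminf nn_integral_cmult)
  qed
  finally show ?thesis .
qed

lemma Q_value_unfold:
  assumes z: "z \<in> space (sa m)"
  shows "Q_value \<beta> z = ennreal (cost m z) + ennreal \<beta> * next_op (Q_value \<beta>) z"
proof -
  let ?c = "\<lambda>n. (next_op ^^ n) (\<lambda>z. ennreal (cost m z))"
  have "Q_value \<beta> z = ennreal (cost m z) + (\<Sum>n. ennreal \<beta> ^ Suc n * ?c (Suc n) z)"
    unfolding Q_value_def
    using sums_unique[OF sums_Suc[OF summable_sums, of "\<lambda>n. ennreal \<beta> ^ n * ?c n z"]]
    by (simp add: add.commute)
  also have "(\<Sum>n. ennreal \<beta> ^ Suc n * ?c (Suc n) z) = ennreal \<beta> * (\<Sum>n. ennreal \<beta> ^ n * next_op (?c n) z)"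
    by (simp add: mult.assoc)
  also have "(\<Sum>n. ennreal \<beta> ^ n * next_op (?c n) z) = next_op (Q_value \<beta>) z"
    unfolding Q_value_def[abs_def] by (rule next_op_suminf[symmetric]) (use z in measurable)
  finally show ?thesis .
qed

text \<open>Only the decisions after time 0 have to follow \<open>\<kappa>\<close>, so that one-step deviations are covered.\<close>

lemma disc_cost_decision:
  assumes \<pi>: "\<pi> \<in> policies m" and x: "x \<in> space (states m)" and \<beta>: "0 \<le> \<beta>"
    and follows: "\<And>n z. z \<in> space (histories m (Suc n)) \<Longrightarrow> \<pi> (Suc n) z = \<kappa> (snd z)"
  shows "disc_cost m \<beta> \<pi> x = (\<integral>\<^sup>+a. Q_value \<beta> (x, a) \<partial>\<pi> 0 (\<lambda>_. undefined, x))"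
proof -
  interpret mdp_process m \<pi> x
    by unfold_locales (fact \<pi>, fact x)
  let ?\<nu> = "\<pi> 0 (\<lambda>_. undefined, x)"
  have step: "(\<integral>\<^sup>+\<omega>. g (\<omega> (Suc n)) \<partial>law) = (\<integral>\<^sup>+\<omega>. next_op g (\<omega> n) \<partial>law)"
    if g [measurable]: "g \<in> borel_measurable (sa m)" for g n
  proof -
    have 1: "(\<lambda>z. \<integral>\<^sup>+a. g (fst z, a) \<partial>\<kappa> (fst z)) \<in> borel_measurable (sa m)"
      by (rule measurable_compose[OF measurable_fst decision_integral_measurable[OF g]])
    have "(\<integral>\<^sup>+\<omega>. g (\<omega> (Suc n)) \<partial>law) = (\<integral>\<^sup>+\<omega>. (\<integral>\<^sup>+a. g (fst (\<omega> (Suc n)), a) \<partial>\<kappa> (fst (\<omega> (Suc n)))) \<partial>law)"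
      by (rule nn_integral_law_eq[OF g 1])
        (simp add: follows[symmetric] nn_integral_policy_const[OF \<pi>] del: nn_integral_const)
    also have "\<dots> = (\<integral>\<^sup>+\<omega>. next_op g (\<omega> n) \<partial>law)"
      unfolding next_op_def by (rule nn_integral_law_kernel[symmetric]) measurable
    finally show ?thesis .
  qed
  \<comment> \<open>Peeling off the last coordinate replaces \<open>g\<close> by
    \<open>next_op g\<close>, hence the induction over arbitrary \<open>g\<close>. Time 0 keeps its
    own decision rule \<open>?\<nu>\<close>.\<close>
  have iterate: "(\<integral>\<^sup>+\<omega>. g (\<omega> n) \<partial>law) = (\<integral>\<^sup>+a. (next_op ^^ n) g (x, a) \<partial>?\<nu>)"
    if "g \<in> borel_measurable (sa m)" for g n
    using that
  proof (induction n arbitrary: g)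
    case 0
    then show ?case by (simp add: nn_integral_law_0)
  next
    case (Suc n)
    then show ?case
      by (simp only: step next_op_measurable funpow_Suc_right o_apply)
  qed
  have E: "(\<integral>\<^sup>+\<omega>. ennreal (cost m (\<omega> n)) \<partial>law) =
      (\<integral>\<^sup>+a. (next_op ^^ n) (\<lambda>z. ennreal (cost m z)) (x, a) \<partial>?\<nu>)" for n
    by (rule iterate) simp
  have "(\<lambda>_. undefined, x) \<in> space ((\<Pi>\<^sub>M i\<in>{0..<0::nat}. sa m) \<Otimes>\<^sub>M states m)"
    using x by (simp add: space_pair_measure space_PiM)
  note \<nu> = subprob_measurableD(3)[OF policy_subprob[OF \<pi>] this]
  have [measurable]: "(\<lambda>a. (next_op ^^ n) (\<lambda>z. ennreal (cost m z)) (x, a)) \<in> borel_measurable ?\<nu>" for n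
    unfolding \<nu> by (rule measurable_compose[OF measurable_Pair1'[OF x] next_op_funpow_measurable]) simp
  show ?thesis
    unfolding disc_cost_eq[OF \<beta>] E Q_value_def by (simp add: nn_integral_suminf nn_integral_cmult)
qed

lemma Q_value_eq:
  assumes \<pi>: "\<pi> \<in> policies m" and \<beta>: "0 \<le> \<beta>"
    and follows: "\<And>n z. z \<in> space (histories m n) \<Longrightarrow> \<pi> n z = \<kappa> (snd z)"
    and z: "z \<in> space (sa m)"
  shows "Q_value \<beta> z = ennreal (cost m z) + ennreal \<beta> * (\<integral>\<^sup>+y. disc_cost m \<beta> \<pi> y \<partial>kernel m z)"
proof -
  have "(\<lambda>_. undefined, y) \<in> space (histories m 0)" if "y \<in> space (states m)" for y
    using that by (simp add: space_histories space_PiM)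
  then have "(\<integral>\<^sup>+a. Q_value \<beta> (y, a) \<partial>\<kappa> y) = disc_cost m \<beta> \<pi> y" if "y \<in> space (states m)" for y
    using disc_cost_decision[OF \<pi> that \<beta>] follows that by simp
  then show ?thesis
    unfolding Q_value_unfold[OF z] next_op_def
    by (auto simp: subprob_measurableD(1)[OF kernel_subprob z] cong: nn_integral_cong_simp)
qed

end

section \<open>Policy evaluation and one-step deviation for stationary policies\<close>

context mdp_kernel
begin

text \<open>\<open>stationary\<close> asserts no measurability of \<open>\<kappa>\<close>; it is
  inherited from the decision rule at time 0, whose only past is the empty one.\<close>

lemma stationary_decision:
  assumes \<pi>: "\<pi> \<in> policies m"
    and follows: "\<And>n z. z \<in> space (histories m n) \<Longrightarrow> \<pi> n z = \<kappa> (snd z)"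
  shows "\<kappa> \<in> states m \<rightarrow>\<^sub>M subprob_algebra (actions m)"
proof -
  have "(\<lambda>_. undefined) \<in> space (\<Pi>\<^sub>M i\<in>{0..<0::nat}. sa m)"
    by (simp add: space_PiM)
  then have "Pair (\<lambda>_. undefined) \<in> states m \<rightarrow>\<^sub>M (\<Pi>\<^sub>M i\<in>{0..<0::nat}. sa m) \<Otimes>\<^sub>M states m"
    by (intro measurable_Pair1')
  then have "(\<lambda>y. \<pi> 0 (\<lambda>_. undefined, y)) \<in> states m \<rightarrow>\<^sub>M subprob_algebra (actions m)"
    by (rule measurable_compose[OF _ policy_subprob[OF \<pi>]])
  moreover have "\<pi> 0 (\<lambda>_. undefined, y) = \<kappa> y" if "y \<in> space (states m)" for y
    using follows[of "(\<lambda>_. undefined, y)" 0] that by (simp add: space_histories space_PiM)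
  ultimately show ?thesis
    by (simp cong: measurable_cong)
qed

text \<open>The cost is the average of \<open>Q_value\<close> over the first decision, so its
  measurability and its evaluation equation are both read off from the series.\<close>

lemma disc_cost_stationary:
  assumes \<pi>: "\<pi> \<in> policies m" and \<beta>: "0 \<le> \<beta>"
    and follows: "\<And>n z. z \<in> space (histories m n) \<Longrightarrow> \<pi> n z = \<kappa> (snd z)"
  shows "disc_cost m \<beta> \<pi> \<in> borel_measurable (states m)"
    and "\<And>x. x \<in> space (states m) \<Longrightarrow> disc_cost m \<beta> \<pi> x =
      (\<integral>\<^sup>+a. ennreal (cost m (x, a)) + ennreal \<beta> * (\<integral>\<^sup>+y. disc_cost m \<beta> \<pi> y \<partial>kernel m (x, a)) \<partial>\<kappa> x)"
proof -
  interpret mdp_decision m \<kappa>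
    by unfold_locales (rule stationary_decision[OF \<pi> follows])
  have h: "(\<lambda>_. undefined, y) \<in> space (histories m 0)" if "y \<in> space (states m)" for y
    using that by (simp add: space_histories space_PiM)
  have eq: "disc_cost m \<beta> \<pi> y = (\<integral>\<^sup>+a. Q_value \<beta> (y, a) \<partial>\<kappa> y)" if "y \<in> space (states m)" for y
    using disc_cost_decision[OF \<pi> that \<beta>] follows h[OF that] by simp
  then show "disc_cost m \<beta> \<pi> \<in> borel_measurable (states m)"
    by (simp cong: measurable_cong)
  fix x assume x: "x \<in> space (states m)"
  show "disc_cost m \<beta> \<pi> x =
      (\<integral>\<^sup>+a. ennreal (cost m (x, a)) + ennreal \<beta> * (\<integral>\<^sup>+y. disc_cost m \<beta> \<pi> y \<partial>kernel m (x, a)) \<partial>\<kappa> x)"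
    unfolding eq[OF x] using x
    by (intro nn_integral_cong Q_value_eq[OF \<pi> \<beta> follows])
      (simp_all add: space_pair_measure subprob_measurableD(1)[OF decision])
qed

text \<open>The competitor plays \<open>\<phi>\<close> at time 0 and \<open>\<pi>\<close>
  afterwards; its cost is the right-hand side.\<close>

lemma disc_optimal_stationary_le:
  assumes opt: "disc_optimal m \<beta> \<pi>" and \<beta>: "0 \<le> \<beta>"
    and follows: "\<And>n z. z \<in> space (histories m n) \<Longrightarrow> \<pi> n z = \<kappa> (snd z)"
    and \<phi>: "\<phi> \<in> selectors m" and x: "x \<in> space (states m)"
  shows "disc_cost m \<beta> \<pi> x \<le> ennreal (cost m (x, \<phi> x)) +
    ennreal \<beta> * (\<integral>\<^sup>+y. disc_cost m \<beta> \<pi> y \<partial>kernel m (x, \<phi> x))"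
proof -
  have \<pi>: "\<pi> \<in> policies m"
    using opt by (simp add: disc_optimal_def)
  interpret mdp_decision m \<kappa>
    by unfold_locales (rule stationary_decision[OF \<pi> follows])
  let ?\<rho> = "\<lambda>n. if n \<in> {0} then selector_policy m \<phi> n else \<pi> n"
  have \<rho>: "?\<rho> \<in> policies m"
    by (rule deviation_policy[OF \<phi> \<pi>])
  have h: "(\<lambda>_. undefined, x) \<in> space (histories m 0)"
    using x by (simp add: space_histories space_PiM)
  have "disc_cost m \<beta> \<pi> x \<le> disc_cost m \<beta> ?\<rho> x"
    using opt x \<rho> by (auto simp: disc_optimal_def intro: INF_lower)
  also have "\<dots> = (\<integral>\<^sup>+a. Q_value \<beta> (x, a) \<partial>selector_policy m \<phi> 0 (\<lambda>_. undefined, x))"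
    using disc_cost_decision[OF \<rho> x \<beta>] follows by simp
  also have "\<dots> = Q_value \<beta> (x, \<phi> x)"
    using nn_integral_selector_policy[OF \<phi> h measurable_compose[OF measurable_Pair1'[OF x] Q_value_measurable]]
    by simp
  also have "\<dots> = ennreal (cost m (x, \<phi> x)) +
      ennreal \<beta> * (\<integral>\<^sup>+y. disc_cost m \<beta> \<pi> y \<partial>kernel m (x, \<phi> x))"
    using x measurable_space[OF selector_measurable[OF \<phi>] x]
    by (intro Q_value_eq[OF \<pi> \<beta> follows]) (simp_all add: space_pair_measure)
  finally show ?thesis .
qed

end

section \<open>The inventory model and its transformation\<close>

text \<open>The transformed kernel is specified by its values on sets, as a weighted part of the
  inventory kernel plus two point masses; this turns such a specification into a rule for
  integrals.\<close>

lemma nn_integral_measure_add3: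
  assumes sets: "sets M1 = sets N" "sets M2 = sets N" "sets M3 = sets N"
    and eq: "\<And>B. B \<in> sets N \<Longrightarrow> emeasure N B = emeasure M1 B + emeasure M2 B + emeasure M3 B"
    and f: "f \<in> borel_measurable N"
  shows "(\<integral>\<^sup>+x. f x \<partial>N) = (\<integral>\<^sup>+x. f x \<partial>M1) + (\<integral>\<^sup>+x. f x \<partial>M2) + (\<integral>\<^sup>+x. f x \<partial>M3)"
proof -
  note [measurable_cong] = sets
  note sp = sets[THEN sets_eq_imp_space_eq]
  show ?thesis
    using f
  proof induction
    case (cong f g)
    then show ?case
      using sp by (simp cong: nn_integral_cong_simp)
  next
    case (set A)
    then show ?case
      using sets by (simp add: eq)
  next
    case (mult u c)
    then show ?case
      by (simp add: nn_integral_cmult distrib_left measurable_cong_sets[OF sets(1) refl]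
        measurable_cong_sets[OF sets(2) refl] measurable_cong_sets[OF sets(3) refl])
  next
    case (add u v)
    then show ?case
      by (simp add: nn_integral_add ac_simps measurable_cong_sets[OF sets(1) refl]
        measurable_cong_sets[OF sets(2) refl] measurable_cong_sets[OF sets(3) refl])
  next
    case (seq U)
    have mono: "incseq (\<lambda>i. \<integral>\<^sup>+x. U i x \<partial>L)" for L
      using \<open>incseq U\<close> by (auto intro!: nn_integral_mono simp: incseq_def le_fun_def)
    have "(\<integral>\<^sup>+x. (SUP i. U i) x \<partial>L) = (SUP i. \<integral>\<^sup>+x. U i x \<partial>L)" if "sets L = sets N" for L
      using seq.hyps that unfolding SUP_apply
      by (intro nn_integral_monotone_convergence_SUP) (simp_all add: measurable_cong_sets[OF that refl])
    then show ?case
      using sets mono by (simp add: seq.IH ennreal_SUP_add incseq_def add_mono)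
  qed
qed

locale inventory = real_distribution D for D +
  fixes C M K cb :: real and h :: "real \<Rightarrow> real" and Kl :: real and \<mu> :: "real \<Rightarrow> real" and \<beta> :: real
  assumes C: "0 \<le> C" and M: "0 \<le> M" and K: "0 \<le> K" and cb: "0 < cb"
    and h_nonneg: "\<And>x. x \<in> inv_X C \<Longrightarrow> 0 \<le> h x" and h_cont: "continuous_on {0..C} h"
    and \<mu>_cont: "continuous_on (inv_X C) \<mu>"
    and \<mu>_bounds: "\<And>x. x \<in> inv_X C \<Longrightarrow> 1 \<le> \<mu> x \<and> \<mu> x \<le> Kl"
    and \<mu>_super: "\<And>x a. x \<in> inv_X C \<Longrightarrow> a \<in> {0..M} \<Longrightarrow>
          1 + (LINT y:inv_X C - {lost}|inv_q C D (x, a). \<mu> y) \<le> \<mu> x"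
    and \<beta>: "(Kl - 1) / Kl \<le> \<beta>" "\<beta> < 1"
begin

abbreviation "X \<equiv> inv_X C"
abbreviation "SX \<equiv> restrict_space borel (inv_X C)"
abbreviation "SA \<equiv> restrict_space borel {0..M}"
abbreviation "SY \<equiv> restrict_space borel (insert xbar (inv_X C))"
abbreviation "SB \<equiv> restrict_space borel (insert abar {0..M})"
abbreviation "original \<equiv> inventory_mdp C M K cb h D"
abbreviation "transformed \<equiv> hvag_mdp C M K cb h D \<mu> \<beta>"
abbreviation "c \<equiv> inv_cost C K cb h D"
abbreviation "q \<equiv> inv_q C D"

definition taboo_mu :: "real \<times> real \<Rightarrow> real" where
  "taboo_mu z = (LINT y:inv_X C - {lost}|inv_q C D z. \<mu> y)"

lemma original_simps [simp]:
  "states original = SX" "actions original = SA" "avail original x = {0..M}" "kernel original = q" "cost original = c"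
  by (simp_all add: inventory_mdp_def)

lemma transformed_simps [simp]:
  "states transformed = SY" "actions transformed = SB" "avail transformed x = (if x = xbar then {abar} else {0..M})"
  "kernel transformed = hvag_kernel C D \<mu> \<beta>"
  "cost transformed (x, a) = (if x = xbar \<or> a = abar then 0 else c (x, a) / \<mu> x)"
  by (simp_all add: hvag_mdp_def)

lemma lost_in_X [simp]: "lost \<in> X" and zero_in_X [simp]: "0 \<in> X"
  using C by (auto simp: inv_X_def)

lemma xbar_notin_X [simp]: "xbar \<notin> X" and lost_xbar [simp]: "lost \<noteq> xbar" "xbar \<noteq> lost"
  by (auto simp: inv_X_def xbar_def lost_def)

lemma abar_notin [simp]: "abar \<notin> {0..M}"
  by (simp add: abar_def)

lemma X_borel [measurable, simp]: "X \<in> sets borel"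
  by (simp add: inv_X_def)

lemma closed_X: "closed X" and compact_X: "compact X"
  by (simp_all add: inv_X_def compact_insert)

lemma Kl_ge: "1 \<le> Kl"
  using \<mu>_bounds[OF lost_in_X] by linarith

lemma \<beta>_nonneg: "0 \<le> \<beta>"
proof -
  have "0 \<le> (Kl - 1) / Kl"
    using Kl_ge by simp
  with \<beta>(1) show ?thesis by linarith
qed

text \<open>\<open>(\<mu> - 1) / \<mu>\<close> increases with \<open>\<mu>\<close>, so it is at most
  \<open>(Kl - 1) / Kl\<close>, the lower bound on \<open>\<beta>\<close>. This makes the mass at
  \<open>xbar\<close> nonnegative and \<open>\<beta>\<close> the contraction factor of value
  iteration.\<close>

lemma \<mu>_contraction:
  assumes "x \<in> X"
  shows "\<mu> x - 1 \<le> \<beta> * \<mu> x"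
proof -
  have "(\<mu> x - 1) * Kl \<le> (Kl - 1) * \<mu> x"
    using \<mu>_bounds[OF assms] by (simp add: algebra_simps)
  then have "\<mu> x - 1 \<le> (Kl - 1) / Kl * \<mu> x"
    using Kl_ge by (simp add: field_simps)
  also have "\<dots> \<le> \<beta> * \<mu> x"
    using \<beta> \<mu>_bounds[OF assms] by (intro mult_right_mono) auto
  finally show ?thesis .
qed

text \<open>\<open>lost\<close> is isolated from \<open>{0..C}\<close>, so the value of
  \<open>h\<close> there is unrestricted.\<close>

lemma h_continuous_X: "continuous_on X h"
proof -
  have "continuous_on ({lost} \<union> {0..C}) h"
    by (intro continuous_on_closed_Un h_cont) auto
  then show ?thesis
    by (simp add: inv_X_def)
qed

lemma h_measurable [measurable]: "h \<in> borel_measurable SX"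
  by (rule borel_measurable_continuous_on_restrict[OF h_continuous_X])

lemma \<mu>_measurable [measurable]: "\<mu> \<in> borel_measurable SX"
  by (rule borel_measurable_continuous_on_restrict[OF \<mu>_cont])

section \<open>The inventory kernel and one-step cost\<close>

lemma space_SX [simp]: "space SX = X"
  by (simp add: space_restrict_space)

lemma inv_F_in_X [simp]: "inv_F C x a s \<in> X"
  using C by (auto simp: inv_F_def inv_X_def)

lemma inv_F_measurable [measurable]:
  "(\<lambda>p. inv_F C (fst (fst p)) (snd (fst p)) (snd p)) \<in> (borel \<Otimes>\<^sub>M borel) \<Otimes>\<^sub>M borel \<rightarrow>\<^sub>M SX"
proof (rule measurable_restrict_space2)
  show "(\<lambda>p. inv_F C (fst (fst p)) (snd (fst p)) (snd p)) \<in> borel_measurable ((borel \<Otimes>\<^sub>M borel) \<Otimes>\<^sub>M borel)"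
    unfolding inv_F_def level_def by measurable
qed simp

lemma inv_F_measurable_demand [measurable]: "inv_F C x a \<in> borel \<rightarrow>\<^sub>M SX"
proof -
  have "Pair (x, a) \<in> borel \<rightarrow>\<^sub>M (borel \<Otimes>\<^sub>M borel) \<Otimes>\<^sub>M borel"
    by (intro measurable_Pair1') (simp add: space_pair_measure)
  from measurable_compose[OF this inv_F_measurable] show ?thesis by simp
qed

lemma q_eq: "q z = distr D SX (inv_F C (fst z) (snd z))"
  by (simp add: inv_q_def split_beta)

lemma sets_q [simp, measurable_cong]: "sets (q z) = sets SX"
  by (simp add: q_eq)

lemma space_q [simp]: "space (q z) = X"
  by (simp add: q_eq)

lemma prob_space_q: "prob_space (q z)"
  unfolding q_eq by (rule prob_space_distr) simp

lemma nn_integral_q: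
  "f \<in> borel_measurable SX \<Longrightarrow> (\<integral>\<^sup>+y. f y \<partial>q z) = (\<integral>\<^sup>+s. f (inv_F C (fst z) (snd z) s) \<partial>D)"
  unfolding q_eq by (rule nn_integral_distr) simp_all

lemma integral_q:
  "f \<in> borel_measurable SX \<Longrightarrow> (LINT y|q z. f y) = (LINT s|D. (f (inv_F C (fst z) (snd z) s) :: real))"
  unfolding q_eq by (rule integral_distr) simp_all

lemma integral_inv_F_measurable [measurable]:
  assumes f [measurable]: "(f :: real \<Rightarrow> real) \<in> borel_measurable SX"
  shows "(\<lambda>z. LINT s|D. f (inv_F C (fst z) (snd z) s)) \<in> borel_measurable (borel \<Otimes>\<^sub>M borel)"
proof (rule borel_measurable_lebesgue_integral)
  have "sets ((borel \<Otimes>\<^sub>M borel) \<Otimes>\<^sub>M D) = sets ((borel \<Otimes>\<^sub>M borel) \<Otimes>\<^sub>M borel :: ((real \<times> real) \<times> real) measure)"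
    by (intro sets_pair_measure_cong) simp_all
  note * = measurable_cong_sets[OF this refl]
  show "(\<lambda>(z, s). f (inv_F C (fst z) (snd z) s)) \<in> borel_measurable ((borel \<Otimes>\<^sub>M borel) \<Otimes>\<^sub>M D)"
    unfolding * split_beta by (rule measurable_compose[OF inv_F_measurable f])
qed

lemma q_measurable [measurable]: "q \<in> borel \<Otimes>\<^sub>M borel \<rightarrow>\<^sub>M prob_algebra SX"
proof (rule measurable_prob_algebraI)
  show "prob_space (q z)" for z
    by (rule prob_space_q)
  show "q \<in> borel \<Otimes>\<^sub>M borel \<rightarrow>\<^sub>M subprob_algebra SX"
  proof (rule measurable_subprob_algebra)
    show "subprob_space (q z)" for z
      by (rule prob_space_imp_subprob_space[OF prob_space_q])
    fix B assume [measurable]: "B \<in> sets SX"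
    have "emeasure (q z) B = ennreal (LINT s|D. indicator B (inv_F C (fst z) (snd z) s))" for z
    proof -
      interpret q: prob_space "q z" by (rule prob_space_q)
      show ?thesis
        using sets.sets_into_space[OF \<open>B \<in> sets SX\<close>]
        by (subst integral_q[symmetric]) (simp_all add: q.emeasure_eq_measure Int_absorb2)
    qed
    then show "(\<lambda>z. emeasure (q z) B) \<in> borel_measurable (borel \<Otimes>\<^sub>M borel)"
      by simp
  qed simp
qed

text \<open>Measurability is proved on the whole plane, where the formulas make sense, and
  restricted along this inclusion to the state-action spaces of both models.\<close>

lemma inclusion_measurable:
  "(\<lambda>z. z) \<in> restrict_space borel A \<Otimes>\<^sub>M restrict_space borel B \<rightarrow>\<^sub>M (borel \<Otimes>\<^sub>M borel :: (real \<times> real) measure)"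
proof -
  have *: "(\<lambda>x. x) \<in> restrict_space borel A \<rightarrow>\<^sub>M borel" for A :: "real set"
    by (rule measurable_restrict_space1) simp
  have "(\<lambda>z. (fst z, snd z)) \<in> restrict_space borel A \<Otimes>\<^sub>M restrict_space borel B \<rightarrow>\<^sub>M borel \<Otimes>\<^sub>M borel"
    by (rule measurable_Pair[OF measurable_compose[OF measurable_fst *] measurable_compose[OF measurable_snd *]])
  then show ?thesis
    unfolding prod.collapse .
qed

lemma c_measurable [measurable]: "c \<in> borel_measurable (borel \<Otimes>\<^sub>M borel)"
  unfolding inv_cost_def split_beta' by measurable

sublocale I: mdp_kernel original
proof
  show "kernel original \<in> sa original \<rightarrow>\<^sub>M prob_algebra (states original)" "cost original \<in> borel_measurable (sa original)"
    unfolding original_simps using measurable_compose[OF inclusion_measurable q_measurable]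
      measurable_compose[OF inclusion_measurable c_measurable] by blast+
qed (auto simp: sets_restrict_space_iff)

lemma h_bounded: obtains H where "\<And>x. x \<in> X \<Longrightarrow> h x \<le> H" "0 \<le> H"
proof -
  have "bounded (h ` X)"
    by (intro compact_imp_bounded compact_continuous_image h_continuous_X compact_X)
  then obtain H where "\<And>x. x \<in> X \<Longrightarrow> \<bar>h x\<bar> \<le> H"
    by (auto simp: bounded_iff)
  then show ?thesis
    using that[of "\<bar>H\<bar>"] by force
qed

lemma integrable_bounded:
  assumes "f \<in> borel_measurable SX" and "\<And>y. y \<in> X \<Longrightarrow> \<bar>f y\<bar> \<le> (B :: real)"
  shows "integrable (q z) f"
proof -
  interpret q: prob_space "q z" by (rule prob_space_q)
  show ?thesis
    using assms by (intro q.integrable_const_bound[where B=B]) auto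
qed

lemma integrable_bounded_demand:
  assumes f: "f \<in> borel_measurable SX" and "\<And>y. y \<in> X \<Longrightarrow> \<bar>f y\<bar> \<le> (B :: real)"
  shows "integrable D (\<lambda>s. f (inv_F C x a s))"
  using assms by (intro integrable_const_bound[where B=B])
    (simp_all add: measurable_compose[OF inv_F_measurable_demand f])

lemma c_nonneg:
  assumes "0 \<le> a"
  shows "0 \<le> c (x, a)"
  using assms K cb h_nonneg by (auto simp: inv_cost_def intro!: add_nonneg_nonneg integral_nonneg_AE)

lemma c_bounded: obtains B where "\<And>x a. a \<in> {0..M} \<Longrightarrow> c (x, a) \<le> B" "0 \<le> B"
proof -
  obtain H where H: "\<And>x. x \<in> X \<Longrightarrow> h x \<le> H" "0 \<le> H"
    using h_bounded by blast
  have "(LINT s|D. h (inv_F C x a s)) \<le> (LINT s|D. H)" for x a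
    by (intro integral_mono integrable_bounded_demand[where B=H] h_measurable)
      (auto simp: H abs_of_nonneg h_nonneg)
  then have "(LINT s|D. h (inv_F C x a s)) \<le> H" for x a
    using prob_space by simp
  then have "c (x, a) \<le> K + cb * M + H" if "a \<in> {0..M}" for x a
    using that K cb unfolding inv_cost_def by (auto intro!: add_mono mult_left_mono)
  moreover have "0 \<le> K + cb * M + H"
    using K cb M H by simp
  ultimately show ?thesis ..
qed

section \<open>The integral of the weight off \<open>lost\<close>\<close>

lemma taboo_measurable [measurable]: "X - {lost} \<in> sets SX"
  by (auto simp: sets_restrict_space_iff)

lemma taboo_weight:
  shows taboo_weight_measurable [measurable]: "(\<lambda>y. indicator (X - {lost}) y * \<mu> y) \<in> borel_measurable SX"
    and taboo_weight_nonneg: "y \<in> X \<Longrightarrow> 0 \<le> indicator (X - {lost}) y * \<mu> y"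
    and taboo_weight_le: "y \<in> X \<Longrightarrow> indicator (X - {lost}) y * \<mu> y \<le> Kl"
proof -
  show "(\<lambda>y. indicator (X - {lost}) y * \<mu> y) \<in> borel_measurable SX"
    by measurable
  assume "y \<in> X"
  from \<mu>_bounds[OF this] Kl_ge
  show "0 \<le> indicator (X - {lost}) y * \<mu> y" "indicator (X - {lost}) y * \<mu> y \<le> Kl"
    by (auto simp: indicator_def)
qed

lemma taboo_weight_integrable: "integrable (q z) (\<lambda>y. indicator (X - {lost}) y * \<mu> y)"
  using taboo_weight_nonneg taboo_weight_le
  by (intro integrable_bounded[where B=Kl] taboo_weight_measurable) (simp add: abs_of_nonneg)

lemma taboo_mu_eq: "taboo_mu z =
    (LINT s|D. indicator (X - {lost}) (inv_F C (fst z) (snd z) s) * \<mu> (inv_F C (fst z) (snd z) s))"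
  unfolding taboo_mu_def set_lebesgue_integral_def real_scaleR_def
  by (rule integral_q[OF taboo_weight_measurable])

lemma taboo_mu_measurable [measurable]: "taboo_mu \<in> borel_measurable (borel \<Otimes>\<^sub>M borel)"
  unfolding taboo_mu_eq[abs_def] by (rule integral_inv_F_measurable[OF taboo_weight_measurable])

lemma taboo_mu_nonneg: "0 \<le> taboo_mu z"
  unfolding taboo_mu_def set_lebesgue_integral_def real_scaleR_def
  by (intro integral_nonneg_AE AE_I2 taboo_weight_nonneg) simp

lemma taboo_mu_le: "x \<in> X \<Longrightarrow> a \<in> {0..M} \<Longrightarrow> taboo_mu (x, a) \<le> \<mu> x - 1"
  using \<mu>_super[of x a] by (simp add: taboo_mu_def)

lemma nn_integral_taboo_mu:
  "(\<integral>\<^sup>+y. indicator (X - {lost}) y * ennreal (\<mu> y) \<partial>q z) = ennreal (taboo_mu z)"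
proof -
  have "(\<integral>\<^sup>+y. indicator (X - {lost}) y * ennreal (\<mu> y) \<partial>q z) =
      (\<integral>\<^sup>+y. ennreal (indicator (X - {lost}) y * \<mu> y) \<partial>q z)"
    by (intro nn_integral_cong) (auto simp: indicator_def)
  also have "\<dots> = ennreal (LINT y|q z. indicator (X - {lost}) y * \<mu> y)"
    by (intro nn_integral_eq_integral taboo_weight_integrable AE_I2 taboo_weight_nonneg) simp
  finally show ?thesis
    by (simp add: taboo_mu_def set_lebesgue_integral_def)
qed

text \<open>The integrand is the coefficient of \<open>v lost\<close> in
  \<open>relative_value\<close>: it is \<open>Kl - \<mu> y\<close> off \<open>lost\<close>, and the
  full \<open>Kl\<close> at \<open>lost\<close>.\<close>

lemma nn_integral_untaboo_mu:
  "(\<integral>\<^sup>+y. ennreal (Kl - indicator (X - {lost}) y * \<mu> y) \<partial>q z) = ennreal (Kl - taboo_mu z)"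
proof -
  interpret q: prob_space "q z" by (rule prob_space_q)
  have "(\<integral>\<^sup>+y. ennreal (Kl - indicator (X - {lost}) y * \<mu> y) \<partial>q z) =
      ennreal (LINT y|q z. Kl - indicator (X - {lost}) y * \<mu> y)"
    using taboo_weight_le
    by (intro nn_integral_eq_integral Bochner_Integration.integrable_diff taboo_weight_integrable AE_I2) simp_all
  also have "(LINT y|q z. Kl - indicator (X - {lost}) y * \<mu> y) = Kl - taboo_mu z"
    using taboo_weight_integrable q.prob_space by (simp add: taboo_mu_def set_lebesgue_integral_def)
  finally show ?thesis .
qed

section \<open>The transformed kernel as a sum of three measures\<close>

lemma space_SY [simp]: "space SY = insert xbar X"
  by (simp add: space_restrict_space)

lemma SX_sets_iff: "B \<in> sets SX \<longleftrightarrow> B \<in> sets borel \<and> B \<subseteq> X"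
  by (auto simp: sets_restrict_space_iff)

lemma SY_sets_iff: "B \<in> sets SY \<longleftrightarrow> B \<in> sets borel \<and> B \<subseteq> insert xbar X"
  by (auto simp: sets_restrict_space_iff)

lemma X_to_Y_measurable: "(\<lambda>y. y) \<in> SX \<rightarrow>\<^sub>M SY"
  by (intro measurable_restrict_space3) auto

definition hvag_mass :: "real \<times> real \<Rightarrow> real set \<Rightarrow> ennreal" where
  "hvag_mass z B = ennreal (1 / (\<beta> * \<mu> (fst z))) * (\<integral>\<^sup>+y. ennreal (\<mu> y) * indicator (B - {lost, xbar}) y \<partial>q z)
    + ennreal (1 / (\<beta> * \<mu> (fst z)) * (\<mu> (fst z) - 1 - taboo_mu z)) * indicator B lost
    + ennreal (1 - (\<mu> (fst z) - 1) / (\<beta> * \<mu> (fst z))) * indicator B xbar"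

lemma hvag_kernel_eq:
  "hvag_kernel C D \<mu> \<beta> z = (if fst z = xbar \<or> snd z = abar then return SY xbar
    else measure_of (insert xbar X) (sets SY) (hvag_mass z))"
  by (cases z) (simp add: hvag_kernel_def Let_def hvag_mass_def[abs_def] taboo_mu_def)

text \<open>The part of the kernel that stays in \<open>X - {lost}\<close>, built as a genuine
  measure so that \<open>hvag_mass\<close> inherits countable additivity from it.\<close>

definition hvag_part :: "real \<times> real \<Rightarrow> real measure" where
  "hvag_part z = density (distr (q z) SY (\<lambda>y. y))
     (\<lambda>y. ennreal (1 / (\<beta> * \<mu> (fst z))) * (ennreal (\<mu> y) * indicator (X - {lost}) y))"

lemma weight_SY_measurable [measurable]:
  "(\<lambda>y. ennreal (\<mu> y) * indicator (X - {lost}) y) \<in> borel_measurable SY"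
proof -
  \<comment> \<open>\<open>\<mu>\<close> is unspecified off \<open>X\<close>, in particular at
    \<open>xbar\<close>, so it is first extended by 0.\<close>
  have "(\<lambda>y. \<mu> y * indicator X y) \<in> borel_measurable borel"
    using \<mu>_measurable by (subst (asm) borel_measurable_restrict_space_iff) (simp_all add: mult.commute)
  then have "(\<lambda>y. ennreal (\<mu> y * indicator X y) * indicator (X - {lost}) y) \<in> borel_measurable borel"
    by measurable
  then have "(\<lambda>y. ennreal (\<mu> y * indicator X y) * indicator (X - {lost}) y) \<in> borel_measurable SY"
    by (rule measurable_restrict_space1)
  moreover have "ennreal (\<mu> y * indicator X y) * indicator (X - {lost}) y = ennreal (\<mu> y) * indicator (X - {lost}) y" for y
    by (auto simp: indicator_def)
  ultimately show ?thesis
    by simp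
qed

lemma nn_integral_hvag_part:
  assumes f [measurable]: "f \<in> borel_measurable SY"
  shows "(\<integral>\<^sup>+y. f y \<partial>hvag_part z) = ennreal (1 / (\<beta> * \<mu> (fst z))) *
    (\<integral>\<^sup>+y. indicator (X - {lost}) y * (ennreal (\<mu> y) * f y) \<partial>q z)"
proof -
  have m: "(\<lambda>y. ennreal (\<mu> y) * indicator (X - {lost}) y * f y) \<in> borel_measurable (q z)"
    unfolding measurable_cong_sets[OF sets_q refl]
    by (rule measurable_compose[OF X_to_Y_measurable]) measurable
  have "(\<integral>\<^sup>+y. f y \<partial>hvag_part z) = (\<integral>\<^sup>+y. ennreal (1 / (\<beta> * \<mu> (fst z))) *
      (ennreal (\<mu> y) * indicator (X - {lost}) y * f y) \<partial>distr (q z) SY (\<lambda>y. y))"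
    unfolding hvag_part_def by (subst nn_integral_density) (simp_all add: mult.assoc)
  also have "\<dots> = (\<integral>\<^sup>+y. ennreal (1 / (\<beta> * \<mu> (fst z))) *
      (ennreal (\<mu> y) * indicator (X - {lost}) y * f y) \<partial>q z)"
  proof (rule nn_integral_distr)
    show "(\<lambda>y. y) \<in> q z \<rightarrow>\<^sub>M SY"
      unfolding measurable_cong_sets[OF sets_q refl] by (rule X_to_Y_measurable)
    show "(\<lambda>y. ennreal (1 / (\<beta> * \<mu> (fst z))) * (ennreal (\<mu> y) * indicator (X - {lost}) y * f y))
        \<in> borel_measurable (distr (q z) SY (\<lambda>y. y))"
      unfolding measurable_distr_eq1
      by (rule borel_measurable_times_ennreal[OF measurable_const
        borel_measurable_times_ennreal[OF weight_SY_measurable f]]) simp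
  qed
  also have "\<dots> = ennreal (1 / (\<beta> * \<mu> (fst z))) *
      (\<integral>\<^sup>+y. indicator (X - {lost}) y * (ennreal (\<mu> y) * f y) \<partial>q z)"
    by (subst nn_integral_cmult[OF m]) (simp add: mult_ac)
  finally show ?thesis .
qed

lemma hvag_mass_eq:
  assumes B: "B \<in> sets SY"
  shows "hvag_mass z B = emeasure (hvag_part z) B
    + emeasure (scale_measure (ennreal (1 / (\<beta> * \<mu> (fst z)) * (\<mu> (fst z) - 1 - taboo_mu z))) (return SY lost)) B
    + emeasure (scale_measure (ennreal (1 - (\<mu> (fst z) - 1) / (\<beta> * \<mu> (fst z)))) (return SY xbar)) B"
proof -
  have "emeasure (hvag_part z) B = (\<integral>\<^sup>+y. indicator B y \<partial>hvag_part z)"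
    using B by (simp add: hvag_part_def)
  also have "\<dots> = ennreal (1 / (\<beta> * \<mu> (fst z))) *
      (\<integral>\<^sup>+y. indicator (X - {lost}) y * (ennreal (\<mu> y) * indicator B y) \<partial>q z)"
    using B by (intro nn_integral_hvag_part) simp
  also have "(\<integral>\<^sup>+y. indicator (X - {lost}) y * (ennreal (\<mu> y) * indicator B y) \<partial>q z) =
      (\<integral>\<^sup>+y. ennreal (\<mu> y) * indicator (B - {lost, xbar}) y \<partial>q z)"
    by (intro nn_integral_cong) (auto simp: indicator_def)
  finally show ?thesis
    using B by (simp add: hvag_mass_def)
qed

text \<open>\<open>measure_of\<close> has the prescribed values only if the set function is
  countably additive; this holds because \<open>hvag_mass\<close> agrees on measurable sets with a
  sum of three measures.\<close>

lemma
  shows sets_hvag_kernel [simp]: "sets (hvag_kernel C D \<mu> \<beta> z) = sets SY"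
    and emeasure_hvag_kernel: "fst z \<noteq> xbar \<Longrightarrow> snd z \<noteq> abar \<Longrightarrow> B \<in> sets SY \<Longrightarrow>
      emeasure (hvag_kernel C D \<mu> \<beta> z) B = hvag_mass z B"
proof -
  have sub: "sets SY \<subseteq> Pow (insert xbar X)"
    using sets.space_closed[of SY] by simp
  have sg: "sigma_sets (insert xbar X) (sets SY) = sets SY"
    using sets.sigma_sets_eq[of SY] by simp
  show "sets (hvag_kernel C D \<mu> \<beta> z) = sets SY"
    using sub sg by (simp add: hvag_kernel_eq)
  assume z: "fst z \<noteq> xbar" "snd z \<noteq> abar" and B: "B \<in> sets SY"
  show "emeasure (hvag_kernel C D \<mu> \<beta> z) B = hvag_mass z B"
  proof (rule emeasure_measure_of[OF _ sub])
    show "hvag_kernel C D \<mu> \<beta> z = measure_of (insert xbar X) (sets SY) (hvag_mass z)"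
      using z by (simp add: hvag_kernel_eq)
    show "B \<in> sets (hvag_kernel C D \<mu> \<beta> z)"
      using B \<open>sets (hvag_kernel C D \<mu> \<beta> z) = sets SY\<close> by simp
    show "positive (sets (hvag_kernel C D \<mu> \<beta> z)) (hvag_mass z)"
      by (simp add: positive_def hvag_mass_def)
    show "countably_additive (sets (hvag_kernel C D \<mu> \<beta> z)) (hvag_mass z)"
      unfolding \<open>sets (hvag_kernel C D \<mu> \<beta> z) = sets SY\<close>
    proof (rule countably_additiveI)
      fix F :: "nat \<Rightarrow> real set"
      assume F: "range F \<subseteq> sets SY" "disjoint_family F" "\<Union> (range F) \<in> sets SY"
      have eq: "(\<Sum>i. emeasure L (F i)) = emeasure L (\<Union> (range F))" if "sets L = sets SY" for L
        using F that by (intro suminf_emeasure) auto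
      have Fi: "F i \<in> sets SY" for i
        using F(1) by auto
      show "(\<Sum>i. hvag_mass z (F i)) = hvag_mass z (\<Union> (range F))"
        unfolding hvag_mass_eq[OF Fi] hvag_mass_eq[OF F(3)]
        by (simp only: suminf_add[symmetric, OF summableI summableI] eq hvag_part_def sets_density sets_distr
          sets_scale_measure sets_return)
    qed
  qed
qed

lemma space_hvag_kernel [simp]: "space (hvag_kernel C D \<mu> \<beta> z) = insert xbar X"
  using sets_eq_imp_space_eq[OF sets_hvag_kernel] by simp

lemma nn_integral_hvag_kernel:
  assumes z: "fst z \<noteq> xbar" "snd z \<noteq> abar" and f [measurable]: "f \<in> borel_measurable SY"
  shows "(\<integral>\<^sup>+y. f y \<partial>hvag_kernel C D \<mu> \<beta> z) =
    ennreal (1 / (\<beta> * \<mu> (fst z))) * (\<integral>\<^sup>+y. indicator (X - {lost}) y * (ennreal (\<mu> y) * f y) \<partial>q z)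
    + ennreal (1 / (\<beta> * \<mu> (fst z)) * (\<mu> (fst z) - 1 - taboo_mu z)) * f lost
    + ennreal (1 - (\<mu> (fst z) - 1) / (\<beta> * \<mu> (fst z))) * f xbar"
proof -
  have "(\<integral>\<^sup>+y. f y \<partial>hvag_kernel C D \<mu> \<beta> z) = (\<integral>\<^sup>+y. f y \<partial>hvag_part z)
    + (\<integral>\<^sup>+y. f y \<partial>scale_measure (ennreal (1 / (\<beta> * \<mu> (fst z)) * (\<mu> (fst z) - 1 - taboo_mu z))) (return SY lost))
    + (\<integral>\<^sup>+y. f y \<partial>scale_measure (ennreal (1 - (\<mu> (fst z) - 1) / (\<beta> * \<mu> (fst z)))) (return SY xbar))"
    using z f by (intro nn_integral_measure_add3)
      (simp_all add: emeasure_hvag_kernel hvag_mass_eq measurable_cong_sets[OF sets_hvag_kernel refl],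
       simp add: hvag_part_def)
  then show ?thesis
    using f by (simp add: nn_integral_hvag_part nn_integral_scale_measure nn_integral_return)
qed

lemma prob_space_hvag_kernel:
  assumes "z \<in> (insert xbar X) \<times> (insert abar {0..M})"
  shows "prob_space (hvag_kernel C D \<mu> \<beta> z)"
proof (cases "fst z = xbar \<or> snd z = abar")
  case True
  then show ?thesis
    by (auto simp: hvag_kernel_eq intro: prob_space_return)
next
  case False
  with assms obtain x a where z: "z = (x, a)" and x: "x \<in> X" and a: "a \<in> {0..M}"
    by (cases z) auto
  have \<mu>x: "1 \<le> \<mu> x"
    using \<mu>_bounds[OF x] by simp
  let ?t = "taboo_mu (x, a)" and ?b = "\<beta> * \<mu> x"
  have t: "0 \<le> ?t" "?t \<le> \<mu> x - 1" and b: "0 \<le> ?b" "\<mu> x - 1 \<le> ?b"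
    using taboo_mu_nonneg taboo_mu_le[OF x a] \<mu>_contraction[OF x] \<beta>_nonneg \<mu>x by auto
  have "emeasure (hvag_kernel C D \<mu> \<beta> z) (insert xbar X) =
      (\<integral>\<^sup>+y. 1 \<partial>hvag_kernel C D \<mu> \<beta> z)"
    by simp
  also have "\<dots> = ennreal (1 / ?b) * ennreal ?t + ennreal (1 / ?b * (\<mu> x - 1 - ?t)) + ennreal (1 - (\<mu> x - 1) / ?b)"
    using False unfolding z by (subst nn_integral_hvag_kernel) (simp_all add: nn_integral_taboo_mu)
  also have "\<dots> = ennreal (1 / ?b * ?t + 1 / ?b * (\<mu> x - 1 - ?t) + (1 - (\<mu> x - 1) / ?b))"
  proof -
    \<comment> \<open>\<open>?b = 0\<close> happens if \<open>\<beta> = 0\<close>, which is possible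
      when \<open>Kl = 1\<close>. Division by 0 then gives 0, and the whole mass sits at
      \<open>xbar\<close>.\<close>
    have nn: "0 \<le> 1 / ?b" "0 \<le> 1 / ?b * ?t" "0 \<le> 1 / ?b * (\<mu> x - 1 - ?t)" "0 \<le> 1 - (\<mu> x - 1) / ?b"
      using t b by (simp, simp, simp, cases "?b = 0") (simp_all add: divide_le_eq_1 less_le)
    show ?thesis
      unfolding ennreal_mult'[OF nn(1), symmetric] ennreal_plus[OF nn(2,3), symmetric]
        ennreal_plus[OF add_nonneg_nonneg[OF nn(2,3)] nn(4), symmetric] ..
  qed
  also have "1 / ?b * ?t + 1 / ?b * (\<mu> x - 1 - ?t) + (1 - (\<mu> x - 1) / ?b) = 1"
    by (simp add: diff_divide_distrib)
  finally show ?thesis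
    by (intro prob_spaceI) simp
qed

text \<open>The extension by 1 makes the formulas with \<open>\<mu>\<close> measurable on the whole
  plane; they are used only in the branch where the state lies in \<open>X\<close>.\<close>

lemma weight_extension: "(\<lambda>z. (if fst z \<in> X then \<mu> (fst z) else 1)) \<in> borel_measurable (borel \<Otimes>\<^sub>M borel)"
proof -
  have "(\<lambda>y. \<mu> y * indicator X y) \<in> borel_measurable borel"
    using \<mu>_measurable by (subst (asm) borel_measurable_restrict_space_iff) (simp_all add: mult.commute)
  then have "(\<lambda>y. if y \<in> X then \<mu> y * indicator X y else 1) \<in> borel_measurable borel"
    by measurable
  moreover have "(if y \<in> X then \<mu> y * indicator X y else 1) = (if y \<in> X then \<mu> y else 1)" for y
    by simp
  ultimately have "(\<lambda>y. if y \<in> X then \<mu> y else 1) \<in> borel_measurable borel"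
    by simp
  then show ?thesis
    by (rule measurable_compose[OF measurable_fst])
qed

lemma infeasible_measurable: "{z. fst z = xbar \<or> snd z = abar} \<in> sets (borel \<Otimes>\<^sub>M borel :: (real \<times> real) measure)"
proof -
  have "{z \<in> space (borel \<Otimes>\<^sub>M borel :: (real \<times> real) measure). fst z = xbar \<or> snd z = abar}
      \<in> sets (borel \<Otimes>\<^sub>M borel)"
    by measurable
  then show ?thesis
    by (simp add: space_pair_measure)
qed

lemma hvag_kernel_measurable: "hvag_kernel C D \<mu> \<beta> \<in> SY \<Otimes>\<^sub>M SB \<rightarrow>\<^sub>M prob_algebra SY"
proof (rule measurable_prob_algebraI)
  show "prob_space (hvag_kernel C D \<mu> \<beta> z)" if "z \<in> space (SY \<Otimes>\<^sub>M SB)" for z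
    using that by (intro prob_space_hvag_kernel) (auto simp: space_pair_measure space_restrict_space)
  then have "subprob_space (hvag_kernel C D \<mu> \<beta> z)" if "z \<in> space (SY \<Otimes>\<^sub>M SB)" for z
    using that by (intro prob_space_imp_subprob_space)
  then show "hvag_kernel C D \<mu> \<beta> \<in> SY \<Otimes>\<^sub>M SB \<rightarrow>\<^sub>M subprob_algebra SY"
  proof (rule measurable_subprob_algebra)
    fix B assume B: "B \<in> sets SY"
    let ?w = "\<lambda>z. if fst z \<in> X then \<mu> (fst z) else 1"
    let ?e = "\<lambda>z. if z \<in> {z. fst z = xbar \<or> snd z = abar} then indicator B xbar else
      ennreal (1 / (\<beta> * ?w z)) * (\<integral>\<^sup>+y. ennreal (\<mu> y) * indicator (B - {lost, xbar}) y \<partial>q z)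
      + ennreal (1 / (\<beta> * ?w z) * (?w z - 1 - taboo_mu z)) * indicator B lost
      + ennreal (1 - (?w z - 1) / (\<beta> * ?w z)) * indicator B xbar"
    have "B - {lost, xbar} \<in> sets SX"
      using B by (auto simp: SX_sets_iff SY_sets_iff)
    then have "(\<lambda>y. ennreal (\<mu> y) * indicator (B - {lost, xbar}) y) \<in> borel_measurable SX"
      by measurable
    from measurable_compose[OF measurable_prob_algebraD[OF q_measurable]
      nn_integral_measurable_subprob_algebra[OF this]]
    have [measurable]: "(\<lambda>z. \<integral>\<^sup>+y. ennreal (\<mu> y) * indicator (B - {lost, xbar}) y \<partial>q z)
        \<in> borel_measurable (borel \<Otimes>\<^sub>M borel)" .
    note [measurable] = weight_extension infeasible_measurable
    have "?e \<in> borel_measurable (borel \<Otimes>\<^sub>M borel)"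
      by measurable
    from measurable_compose[OF inclusion_measurable this]
    have "?e \<in> borel_measurable (SY \<Otimes>\<^sub>M SB)" .
    moreover have "emeasure (hvag_kernel C D \<mu> \<beta> z) B = ?e z" if "z \<in> space (SY \<Otimes>\<^sub>M SB)" for z
    proof (cases "fst z = xbar \<or> snd z = abar")
      case True
      then show ?thesis
        using B by (auto simp: hvag_kernel_eq)
    next
      case False
      with that have "fst z \<in> X"
        by (auto simp: space_pair_measure)
      with False show ?thesis
        using B by (simp add: emeasure_hvag_kernel hvag_mass_def)
    qed
    ultimately show "(\<lambda>z. emeasure (hvag_kernel C D \<mu> \<beta> z) B) \<in> borel_measurable (SY \<Otimes>\<^sub>M SB)"
      by (subst measurable_cong)
  qed (assumption, rule sets_hvag_kernel)
qed

lemma transformed_cost_measurable: "cost transformed \<in> borel_measurable (SY \<Otimes>\<^sub>M SB)"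
proof -
  let ?e = "\<lambda>z. if z \<in> {z. fst z = xbar \<or> snd z = abar} then 0 else
    c z / (if fst z \<in> X then \<mu> (fst z) else 1)"
  note [measurable] = weight_extension infeasible_measurable
  have "?e \<in> borel_measurable (borel \<Otimes>\<^sub>M borel)"
    by measurable
  from measurable_compose[OF inclusion_measurable this]
  have "?e \<in> borel_measurable (SY \<Otimes>\<^sub>M SB)" .
  moreover have "cost transformed z = ?e z" if "z \<in> space (SY \<Otimes>\<^sub>M SB)" for z
    using that by (cases z) (auto simp: space_pair_measure)
  ultimately show ?thesis
    by (subst measurable_cong)
qed

sublocale H: mdp_kernel transformed
proof
  show "kernel transformed \<in> sa transformed \<rightarrow>\<^sub>M prob_algebra (states transformed)"
    using hvag_kernel_measurable by simp
  show "cost transformed \<in> borel_measurable (sa transformed)"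
    unfolding transformed_simps by (rule transformed_cost_measurable)
  show "avail transformed x \<in> sets (actions transformed)" for x
    by (auto simp: sets_restrict_space_iff)
qed

section \<open>From the discounted to the average cost equation\<close>

definition relative_value :: "(real \<Rightarrow> ennreal) \<Rightarrow> real \<Rightarrow> ennreal" where
  "relative_value v y = ennreal (\<mu> y) * v y + ennreal (Kl - \<mu> y) * v lost"

text \<open>The normalization of the kernel cancels the discount, and the mass sent to
  \<open>xbar\<close> contributes nothing because \<open>v xbar = 0\<close>.\<close>

lemma discounted_kernel:
  assumes v: "v \<in> borel_measurable SY" "v xbar = 0" and x: "x \<in> X" and a: "a \<in> {0..M}"
  shows "ennreal \<beta> * (\<integral>\<^sup>+y. v y \<partial>hvag_kernel C D \<mu> \<beta> (x, a)) = ennreal (1 / \<mu> x) *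
    ((\<integral>\<^sup>+y. indicator (X - {lost}) y * (ennreal (\<mu> y) * v y) \<partial>q (x, a))
      + ennreal (\<mu> x - 1 - taboo_mu (x, a)) * v lost)"
proof -
  let ?I = "\<integral>\<^sup>+y. indicator (X - {lost}) y * (ennreal (\<mu> y) * v y) \<partial>q (x, a)"
  have \<mu>x: "1 \<le> \<mu> x" and t: "0 \<le> taboo_mu (x, a)" "taboo_mu (x, a) \<le> \<mu> x - 1"
    using \<mu>_bounds[OF x] taboo_mu_nonneg taboo_mu_le[OF x a] by auto
  have "x \<noteq> xbar" "a \<noteq> abar"
    using x a xbar_notin_X abar_notin by blast+
  then have eq: "(\<integral>\<^sup>+y. v y \<partial>hvag_kernel C D \<mu> \<beta> (x, a)) = ennreal (1 / (\<beta> * \<mu> x)) * ?I +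
      ennreal (1 / (\<beta> * \<mu> x) * (\<mu> x - 1 - taboo_mu (x, a))) * v lost"
    using v by (simp add: nn_integral_hvag_kernel)
  show ?thesis
  proof (cases "\<beta> = 0")
    case False
    then have "0 < \<beta>"
      using \<beta>_nonneg by simp
    then have "ennreal \<beta> * ennreal (1 / (\<beta> * \<mu> x)) = ennreal (1 / \<mu> x)"
      using \<mu>x by (subst ennreal_mult[symmetric]) auto
    moreover have "ennreal (1 / (\<beta> * \<mu> x) * (\<mu> x - 1 - taboo_mu (x, a))) =
        ennreal (1 / (\<beta> * \<mu> x)) * ennreal (\<mu> x - 1 - taboo_mu (x, a))"
      using \<open>0 < \<beta>\<close> \<mu>x by (intro ennreal_mult') simp
    ultimately show ?thesis
      unfolding eq by (simp add: distrib_left mult.assoc[symmetric])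
  next
    \<comment> \<open>Here \<open>1 / (\<beta> * \<mu> x)\<close> is junk, but the taboo kernel and the mass at \<open>lost\<close> vanish.\<close>
    case True
    with \<mu>_contraction[OF x] \<mu>x t have 0: "\<mu> x = 1" "taboo_mu (x, a) = 0"
      by auto
    have m: "(\<lambda>y. indicator (X - {lost}) y * ennreal (\<mu> y)) \<in> borel_measurable (q (x, a))"
      by measurable
    have "AE y in q (x, a). indicator (X - {lost}) y * ennreal (\<mu> y) = 0"
      using nn_integral_taboo_mu[of "(x, a)"] 0 by (simp add: nn_integral_0_iff_AE[OF m])
    then have "?I = (\<integral>\<^sup>+y. 0 \<partial>q (x, a))"
      by (intro nn_integral_cong_AE) (auto elim!: eventually_mono simp: mult.assoc[symmetric])
    with True 0 show ?thesis
      by simp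
  qed
qed

text \<open>At \<open>lost\<close> the weights \<open>\<mu>\<close> and \<open>Kl - \<mu>\<close>
  multiply the same value and merge into \<open>Kl\<close>; elsewhere they stay apart. Hence the
  coefficient of \<open>v lost\<close> involves only the integral of \<open>\<mu>\<close> off
  \<open>lost\<close>.\<close>

lemma nn_integral_relative_value:
  assumes v: "v \<in> borel_measurable SY"
  shows "(\<integral>\<^sup>+y. relative_value v y \<partial>q z) =
    (\<integral>\<^sup>+y. indicator (X - {lost}) y * (ennreal (\<mu> y) * v y) \<partial>q z) + ennreal (Kl - taboo_mu z) * v lost"
proof -
  have [measurable]: "v \<in> borel_measurable SX"
    using measurable_compose[OF X_to_Y_measurable v] .
  have "relative_value v y = indicator (X - {lost}) y * (ennreal (\<mu> y) * v y) +
      ennreal (Kl - indicator (X - {lost}) y * \<mu> y) * v lost" if "y \<in> X" for y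
    using \<mu>_bounds[OF that] that
    by (cases "y = lost") (auto simp: relative_value_def distrib_right[symmetric] ennreal_plus[symmetric]
      simp del: ennreal_plus)
  then have "(\<integral>\<^sup>+y. relative_value v y \<partial>q z) =
      (\<integral>\<^sup>+y. indicator (X - {lost}) y * (ennreal (\<mu> y) * v y) +
        ennreal (Kl - indicator (X - {lost}) y * \<mu> y) * v lost \<partial>q z)"
    by (intro nn_integral_cong) simp
  also have "\<dots> = (\<integral>\<^sup>+y. indicator (X - {lost}) y * (ennreal (\<mu> y) * v y) \<partial>q z) +
      (\<integral>\<^sup>+y. ennreal (Kl - indicator (X - {lost}) y * \<mu> y) * v lost \<partial>q z)"
    by (rule nn_integral_add) measurable
  also have "(\<integral>\<^sup>+y. ennreal (Kl - indicator (X - {lost}) y * \<mu> y) * v lost \<partial>q z) = ennreal (Kl - taboo_mu z) * v lost"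
    by (subst nn_integral_multc) (simp_all add: nn_integral_untaboo_mu)
  finally show ?thesis .
qed

text \<open>The discounted equation of the transformed model, multiplied by \<open>\<mu>\<close>, is the average cost
  equation with gain \<open>v lost\<close>; the bias \<open>\<mu> * (v - v lost)\<close> is shifted by \<open>Kl * v lost\<close> to stay nonnegative.\<close>

lemma discounted_eq_average:
  assumes v: "v \<in> borel_measurable SY" "v xbar = 0" and x: "x \<in> X" and a: "a \<in> {0..M}"
  shows "ennreal (\<mu> x) * (ennreal (cost transformed (x, a)) +
        ennreal \<beta> * (\<integral>\<^sup>+y. v y \<partial>kernel transformed (x, a))) + (v lost + ennreal (Kl - \<mu> x) * v lost) =
    ennreal (c (x, a)) + (\<integral>\<^sup>+y. relative_value v y \<partial>q (x, a))"
proof -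
  let ?I = "\<integral>\<^sup>+y. indicator (X - {lost}) y * (ennreal (\<mu> y) * v y) \<partial>q (x, a)"
  have \<mu>x: "1 \<le> \<mu> x" "\<mu> x \<le> Kl" and t: "0 \<le> taboo_mu (x, a)" "taboo_mu (x, a) \<le> \<mu> x - 1"
    using \<mu>_bounds[OF x] taboo_mu_nonneg taboo_mu_le[OF x a] by auto
  have "x \<noteq> xbar" "a \<noteq> abar"
    using x a xbar_notin_X abar_notin by blast+
  with a have xa: "x \<noteq> xbar" "a \<noteq> abar" "0 \<le> a"
    by auto
  have 1: "ennreal (\<mu> x) * ennreal (c (x, a) / \<mu> x) = ennreal (c (x, a))"
    using \<mu>x c_nonneg[OF xa(3), of x] by (subst ennreal_mult[symmetric]) auto
  have 2: "ennreal (\<mu> x) * ennreal (1 / \<mu> x) = 1"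
    using \<mu>x by (subst ennreal_mult[symmetric]) auto
  \<comment> \<open>The coefficient of \<open>v lost\<close> splits into the unnormalized mass of
    the kernel at \<open>lost\<close>, the 1 of the gain, and the shift \<open>Kl - \<mu> x\<close>
    of the bias.\<close>
  have "ennreal (Kl - taboo_mu (x, a)) = ennreal ((\<mu> x - 1 - taboo_mu (x, a)) + (1 + (Kl - \<mu> x)))"
    by simp
  also have "\<dots> = ennreal (\<mu> x - 1 - taboo_mu (x, a)) + (1 + ennreal (Kl - \<mu> x))"
    using \<mu>x t by (simp only: ennreal_plus ennreal_1)
  finally have 3: "ennreal (Kl - taboo_mu (x, a)) = ennreal (\<mu> x - 1 - taboo_mu (x, a)) + (1 + ennreal (Kl - \<mu> x))" .
  have alg: "m * (c' + i * (I + t * w)) + (w + k * w) = c + (I + (t + (1 + k)) * w)"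
    if "m * c' = c" "m * i = 1" for m c' i I t w k c :: ennreal
  proof -
    have "m * (c' + i * (I + t * w)) = m * c' + m * i * (I + t * w)"
      by (simp only: distrib_left mult.assoc)
    moreover have "(t + (1 + k)) * w = t * w + (w + k * w)"
      by (simp add: distrib_right)
    ultimately show ?thesis
      by (simp only: that mult_1 add.assoc)
  qed
  have "cost transformed (x, a) = c (x, a) / \<mu> x"
    using xa by simp
  then show ?thesis
    unfolding transformed_simps(4) discounted_kernel[OF v x a] nn_integral_relative_value[OF v(1)] 3
    by (simp only: alg[OF 1 2])
qed

end

section \<open>Average cost optimality\<close>

context inventory
begin

section \<open>Transporting policies to the inventory model\<close>

lemma states_inclusion: "(\<lambda>x. x) \<in> SX \<rightarrow>\<^sub>M SY"
  and actions_inclusion: "(\<lambda>a. a) \<in> SA \<rightarrow>\<^sub>M SB"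
  by (intro measurable_restrict_space3; auto)+

lemma sa_inclusion: "(\<lambda>z. z) \<in> SX \<Otimes>\<^sub>M SA \<rightarrow>\<^sub>M SY \<Otimes>\<^sub>M SB"
proof -
  have "(\<lambda>z. (fst z, snd z)) \<in> SX \<Otimes>\<^sub>M SA \<rightarrow>\<^sub>M SY \<Otimes>\<^sub>M SB"
    by (rule measurable_Pair[OF measurable_compose[OF measurable_fst states_inclusion]
      measurable_compose[OF measurable_snd actions_inclusion]])
  then show ?thesis
    unfolding prod.collapse .
qed

text \<open>An inventory history is literally a history of the transformed process that avoids
  \<open>xbar\<close> and \<open>abar\<close>, so a policy can be evaluated on it without
  translation.\<close>

lemma histories_inclusion: "(\<lambda>z. z) \<in> histories original n \<rightarrow>\<^sub>M histories transformed n"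
proof -
  have "(\<lambda>\<omega>. \<omega>) \<in> (\<Pi>\<^sub>M i\<in>{0..<n}. SX \<Otimes>\<^sub>M SA) \<rightarrow>\<^sub>M (\<Pi>\<^sub>M i\<in>{0..<n}. SY \<Otimes>\<^sub>M SB)"
  proof (rule measurable_PiM_single')
    show "(\<lambda>\<omega>. \<omega> i) \<in> (\<Pi>\<^sub>M i\<in>{0..<n}. SX \<Otimes>\<^sub>M SA) \<rightarrow>\<^sub>M SY \<Otimes>\<^sub>M SB" if "i \<in> {0..<n}" for i
    proof -
      have "(\<lambda>\<omega>. \<omega> i) \<in> (\<Pi>\<^sub>M i\<in>{0..<n}. SX \<Otimes>\<^sub>M SA) \<rightarrow>\<^sub>M SX \<Otimes>\<^sub>M SA"
        using that by (rule measurable_component_singleton)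
      from measurable_compose[OF this sa_inclusion] show ?thesis .
    qed
    show "(\<lambda>\<omega>. \<omega>) \<in> space (\<Pi>\<^sub>M i\<in>{0..<n}. SX \<Otimes>\<^sub>M SA) \<rightarrow> (\<Pi>\<^sub>E i\<in>{0..<n}. space (SY \<Otimes>\<^sub>M SB))"
      using measurable_space[OF sa_inclusion] by (auto simp: space_PiM PiE_iff)
  qed
  from measurable_Pair[OF measurable_compose[OF measurable_fst this]
    measurable_compose[OF measurable_snd states_inclusion]]
  have "(\<lambda>z. (fst z, snd z)) \<in> (\<Pi>\<^sub>M i\<in>{0..<n}. SX \<Otimes>\<^sub>M SA) \<Otimes>\<^sub>M SX \<rightarrow>\<^sub>M (\<Pi>\<^sub>M i\<in>{0..<n}. SY \<Otimes>\<^sub>M SB) \<Otimes>\<^sub>M SY" .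
  then show ?thesis
    unfolding prod.collapse histories_def original_simps transformed_simps .
qed

lemma sets_restrict_actions:
  assumes "sets N = sets SB"
  shows "sets (restrict_space N {0..M}) = sets SA"
proof -
  have "sets (restrict_space N {0..M}) = sets (restrict_space SB {0..M})"
    using assms by (rule sets_restrict_space_cong)
  also have "restrict_space SB {0..M} = restrict_space borel (insert abar {0..M} \<inter> {0..M})"
    by (rule restrict_restrict_space) auto
  also have "insert abar {0..M} \<inter> {0..M} = {0..M}"
    by auto
  finally show ?thesis .
qed

context
  fixes \<pi> :: "(real, real) policy"
  assumes \<pi>: "\<pi> \<in> policies transformed"
begin

lemma original_history:
  assumes z: "z \<in> space (histories original n)"
  shows "z \<in> space (histories transformed n)" and "snd z \<in> X"
    and "sets (\<pi> n z) = sets SB" and "prob_space (\<pi> n z)"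
    and "{0..M} \<in> sets (\<pi> n z)" and "AE a in \<pi> n z. a \<in> {0..M}"
proof -
  show z': "z \<in> space (histories transformed n)"
    using measurable_space[OF histories_inclusion z] .
  show x: "snd z \<in> X"
    using z by (auto simp: I.space_histories)
  from H.policy_measurable[OF \<pi>] z' have "\<pi> n z \<in> space (prob_algebra SB)"
    by (metis measurable_space transformed_simps(2))
  then show s: "sets (\<pi> n z) = sets SB" and "prob_space (\<pi> n z)"
    by (auto simp: space_prob_algebra)
  show "{0..M} \<in> sets (\<pi> n z)"
    unfolding s by (auto simp: sets_restrict_space_iff)
  have "snd z \<noteq> xbar"
    using x by (intro notI) simp
  then show "AE a in \<pi> n z. a \<in> {0..M}"
    using H.policy_avail_AE[OF \<pi> z'] by simp
qed

text \<open>On inventory histories the current state is not \<open>xbar\<close>, so the decision is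
  concentrated on \<open>{0..M}\<close> and restriction loses no mass.\<close>

lemma as_inventory_policy_policies: "as_inventory_policy M \<pi> \<in> policies original"
proof -
  let ?\<rho> = "as_inventory_policy M \<pi>"
  have sets: "sets (?\<rho> n z) = sets SA" if "z \<in> space (histories original n)" for n z
    unfolding as_inventory_policy_def by (rule sets_restrict_actions[OF original_history(3)[OF that]])
  have em: "emeasure (?\<rho> n z) B = emeasure (\<pi> n z) B"
    if "z \<in> space (histories original n)" "B \<subseteq> {0..M}" for n z B
    unfolding as_inventory_policy_def
    using original_history(5)[OF that(1)] that(2) by (intro emeasure_restrict_space) auto
  have one: "emeasure (?\<rho> n z) {0..M} = 1" if "z \<in> space (histories original n)" for n z
    using em[OF that order_refl] original_history(4-6)[OF that]
    by (simp add: prob_space.emeasure_eq_1_AE)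
  have prob: "prob_space (?\<rho> n z)" if "z \<in> space (histories original n)" for n z
  proof
    have "space (?\<rho> n z) = {0..M}"
      using sets_eq_imp_space_eq[OF sets[OF that]] by (simp add: space_restrict_space)
    with one[OF that] show "emeasure (?\<rho> n z) (space (?\<rho> n z)) = 1"
      by simp
  qed
  have "?\<rho> n \<in> histories original n \<rightarrow>\<^sub>M prob_algebra SA" for n
  proof (rule measurable_prob_algebraI)
    show "?\<rho> n \<in> histories original n \<rightarrow>\<^sub>M subprob_algebra SA"
    proof (rule measurable_subprob_algebra)
      show "subprob_space (?\<rho> n z)" if "z \<in> space (histories original n)" for z
        by (rule prob_space_imp_subprob_space[OF prob[OF that]])
      fix B assume B: "B \<in> sets SA"
      then have B': "B \<subseteq> {0..M}" and BB: "B \<in> sets SB"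
        by (auto simp: sets_restrict_space_iff)
      have "(\<lambda>z. emeasure (\<pi> n z) B) \<in> borel_measurable (histories transformed n)"
        using measurable_compose[OF measurable_prob_algebraD[OF H.policy_measurable[OF \<pi>]]
          measurable_emeasure_subprob_algebra] BB by simp
      from measurable_compose[OF histories_inclusion this]
      have "(\<lambda>z. emeasure (\<pi> n z) B) \<in> borel_measurable (histories original n)" .
      then show "(\<lambda>z. emeasure (?\<rho> n z) B) \<in> borel_measurable (histories original n)"
        using em[OF _ B'] by (subst measurable_cong) auto
    qed (rule sets)
  qed (rule prob)
  with one show ?thesis
    unfolding policies_def original_simps by blast
qed

lemma nn_integral_as_inventory_policy:
  assumes z: "z \<in> space (histories original n)"
    and eq: "\<And>a. a \<in> {0..M} \<Longrightarrow> f a = g a"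
  shows "(\<integral>\<^sup>+a. f a \<partial>as_inventory_policy M \<pi> n z) = (\<integral>\<^sup>+a. g a \<partial>\<pi> n z)"
proof -
  have "(\<integral>\<^sup>+a. f a \<partial>as_inventory_policy M \<pi> n z) = (\<integral>\<^sup>+a. f a * indicator {0..M} a \<partial>\<pi> n z)"
    unfolding as_inventory_policy_def using original_history(5)[OF z]
    by (intro nn_integral_restrict_space) (simp add: sets.Int_space_eq2)
  also have "\<dots> = (\<integral>\<^sup>+a. g a \<partial>\<pi> n z)"
    using original_history(6)[OF z]
    by (intro nn_integral_cong_AE, elim eventually_mono) (simp only: eq indicator_simps mult_1_right)
  finally show ?thesis .
qed

end

section \<open>Uniform bounds and average optimality\<close>

lemma transformed_cost_bounded:
  obtains b where "0 \<le> b" "\<And>x a. x \<in> insert xbar X \<Longrightarrow> a \<in> insert abar {0..M} \<Longrightarrow> cost transformed (x, a) \<le> b"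
proof -
  obtain b where b: "\<And>x a. a \<in> {0..M} \<Longrightarrow> c (x, a) \<le> b" "0 \<le> b"
    using c_bounded by blast
  have "c (x, a) / \<mu> x \<le> b" if "x \<in> X" "a \<in> {0..M}" for x a
  proof -
    have "c (x, a) \<le> b * 1"
      using b(1)[OF that(2)] by simp
    also have "\<dots> \<le> b * \<mu> x"
      using \<mu>_bounds[OF that(1)] b(2) by (intro mult_left_mono) auto
    finally show ?thesis
      using \<mu>_bounds[OF that(1)] by (simp add: pos_divide_le_eq)
  qed
  with b show ?thesis
    by (intro that[of b]) auto
qed

text \<open>The constant \<open>b / (1 - \<beta>)\<close> solves \<open>b + \<beta> * B = B\<close>,
  so it satisfies the inequality of \<open>disc_cost_le\<close> for every policy.\<close>

lemma disc_cost_bounded: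
  obtains B where "\<And>\<pi> x. \<pi> \<in> policies transformed \<Longrightarrow> x \<in> insert xbar X \<Longrightarrow> disc_cost transformed \<beta> \<pi> x \<le> ennreal B"
    "0 \<le> B"
proof -
  obtain b where b: "0 \<le> b"
    "\<And>x a. x \<in> insert xbar X \<Longrightarrow> a \<in> insert abar {0..M} \<Longrightarrow> cost transformed (x, a) \<le> b"
    using transformed_cost_bounded by blast
  have B: "0 \<le> b / (1 - \<beta>)"
    using b \<beta>(2) by simp
  have "disc_cost transformed \<beta> \<pi> x \<le> ennreal (b / (1 - \<beta>))"
    if \<pi>: "\<pi> \<in> policies transformed" and x: "x \<in> insert xbar X" for \<pi> x
  proof -
    interpret mdp_process transformed \<pi> x
      by unfold_locales (use \<pi> x in auto)
    show ?thesis
    proof (rule disc_cost_le[OF \<beta>_nonneg])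
      fix n z assume z: "z \<in> space (histories transformed n)"
      have "snd z \<in> insert xbar X"
        using z by (auto simp: H.space_histories)
      have k: "(\<integral>\<^sup>+y. ennreal (b / (1 - \<beta>)) \<partial>kernel transformed (snd z, a)) = ennreal (b / (1 - \<beta>))"
        if "a \<in> insert abar {0..M}" for a
      proof -
        have "prob_space (hvag_kernel C D \<mu> \<beta> (snd z, a))"
          using that \<open>snd z \<in> _\<close> by (intro prob_space_hvag_kernel) blast
        from prob_space.emeasure_space_1[OF this] show ?thesis
          by simp
      qed
      have le: "ennreal (cost transformed (snd z, a)) +
          ennreal \<beta> * (\<integral>\<^sup>+y. ennreal (b / (1 - \<beta>)) \<partial>kernel transformed (snd z, a)) \<le> ennreal (b / (1 - \<beta>))"
        if a: "a \<in> insert abar {0..M}" for a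
      proof -
        have "ennreal (cost transformed (snd z, a)) + ennreal \<beta> * ennreal (b / (1 - \<beta>))
            \<le> ennreal b + ennreal \<beta> * ennreal (b / (1 - \<beta>))"
          using b(2)[OF \<open>snd z \<in> _\<close> a] by (intro add_right_mono ennreal_leI)
        also have "\<dots> = ennreal (b + \<beta> * (b / (1 - \<beta>)))"
          using b(1) B \<beta>_nonneg by (simp only: ennreal_mult ennreal_plus mult_nonneg_nonneg)
        also have "b + \<beta> * (b / (1 - \<beta>)) = b / (1 - \<beta>)"
          using \<beta>(2) by (simp add: field_simps)
        finally show ?thesis
          unfolding k[OF a] .
      qed
      have "sets (\<pi> n z) = sets SB"
        using measurable_space[OF H.policy_measurable[OF \<pi>] z] by (simp add: space_prob_algebra)
      then have "space (\<pi> n z) = insert abar {0..M}"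
        by (subst sets_eq_imp_space_eq[of _ SB]) (simp_all add: space_restrict_space)
      then have "(\<integral>\<^sup>+a. ennreal (cost transformed (snd z, a)) +
          ennreal \<beta> * (\<integral>\<^sup>+y. ennreal (b / (1 - \<beta>)) \<partial>kernel transformed (snd z, a)) \<partial>\<pi> n z)
          \<le> (\<integral>\<^sup>+a. ennreal (b / (1 - \<beta>)) \<partial>\<pi> n z)"
        by (intro nn_integral_mono le) simp
      also have "\<dots> = ennreal (b / (1 - \<beta>))"
        by (rule H.nn_integral_policy_const[OF \<pi> z])
      finally show "(\<integral>\<^sup>+a. ennreal (cost transformed (snd z, a)) +
          ennreal \<beta> * (\<integral>\<^sup>+y. ennreal (b / (1 - \<beta>)) \<partial>kernel transformed (snd z, a)) \<partial>\<pi> n z)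
          \<le> ennreal (b / (1 - \<beta>))" .
    qed simp
  qed
  with B show ?thesis
    using that by blast
qed

text \<open>To test optimality at one pair, the deviation may play the same action at all inventory
  states, so no action has to be chosen measurably.\<close>

lemma constant_selector:
  assumes "a \<in> {0..M}"
  shows "(\<lambda>x. if x = xbar then abar else a) \<in> selectors transformed"
proof -
  have "(\<lambda>x. if x = xbar then abar else a) \<in> SY \<rightarrow>\<^sub>M SB"
  proof (rule measurable_restrict_space2)
    have "(\<lambda>x. if x = xbar then abar else a) \<in> borel_measurable borel"
      by measurable
    then show "(\<lambda>x. if x = xbar then abar else a) \<in> borel_measurable SY"
      by (rule measurable_restrict_space1)
  qed (use assms in auto)
  then show ?thesis
    using assms by (simp add: selectors_def)
qed

lemma relative_value_measurable:
  assumes "v \<in> borel_measurable SY"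
  shows "relative_value v \<in> borel_measurable SX"
proof -
  have [measurable]: "v \<in> borel_measurable SX"
    using measurable_compose[OF X_to_Y_measurable assms] .
  show ?thesis
    unfolding relative_value_def[abs_def] by measurable
qed

theorem disc_optimal_imp_avg_optimal:
  assumes st: "stationary transformed \<pi>" and opt: "disc_optimal transformed \<beta> \<pi>"
  shows "avg_optimal original (as_inventory_policy M \<pi>)"
proof -
  have \<pi>: "\<pi> \<in> policies transformed"
    using opt by (simp add: disc_optimal_def)
  obtain \<kappa> where \<kappa>: "\<And>n z. z \<in> space (histories transformed n) \<Longrightarrow> \<pi> n z = \<kappa> (snd z)"
    using st unfolding stationary_def by blast
  obtain B where "\<And>\<pi> x. \<pi> \<in> policies transformed \<Longrightarrow> x \<in> insert xbar X \<Longrightarrow> disc_cost transformed \<beta> \<pi> x \<le> ennreal B"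
    and B: "0 \<le> B"
    using disc_cost_bounded by blast
  then have vB: "disc_cost transformed \<beta> \<pi> x \<le> ennreal B" if "x \<in> insert xbar X" for x
    using \<pi> that by blast
  define v where "v = disc_cost transformed \<beta> \<pi>"
  define u where "u = relative_value v"
  have v_meas: "v \<in> borel_measurable SY"
    using H.disc_cost_stationary(1)[OF \<pi> \<beta>_nonneg] \<kappa> unfolding v_def transformed_simps by blast
  have v_eq: "v x = (\<integral>\<^sup>+a. ennreal (cost transformed (x, a)) +
      ennreal \<beta> * (\<integral>\<^sup>+y. v y \<partial>kernel transformed (x, a)) \<partial>\<kappa> x)" if "x \<in> insert xbar X" for x
    unfolding v_def by (rule H.disc_cost_stationary(2)[OF \<pi> \<beta>_nonneg]) (use \<kappa> that in auto)
  have v_le: "v x \<le> ennreal (cost transformed (x, \<phi> x)) +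
      ennreal \<beta> * (\<integral>\<^sup>+y. v y \<partial>kernel transformed (x, \<phi> x))"
    if "\<phi> \<in> selectors transformed" "x \<in> insert xbar X" for \<phi> x
    unfolding v_def by (rule H.disc_optimal_stationary_le[OF opt \<beta>_nonneg]) (use \<kappa> that in auto)
  have h0: "(\<lambda>_. undefined, x) \<in> space (histories transformed 0)" if "x \<in> insert xbar X" for x
    using that by (simp add: H.space_histories space_PiM)
  have v0: "v xbar = 0"
  proof -
    have m: "v \<in> borel_measurable SY" by (rule v_meas)
    have "v xbar = (\<integral>\<^sup>+a. ennreal \<beta> * v xbar \<partial>\<kappa> xbar)"
      using v_eq[of xbar] m by (simp add: hvag_kernel_eq nn_integral_return del: nn_integral_const)
    also have "\<dots> = ennreal \<beta> * v xbar"
      using H.nn_integral_policy_const[OF \<pi> h0[of xbar]] \<kappa>[OF h0[of xbar]] by simp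
    finally have eq: "v xbar = ennreal \<beta> * v xbar" .
    \<comment> \<open>Absorption at cost 0 gives \<open>v xbar = \<beta> * v xbar\<close>, which
      infinity can satisfy too; the uniform bound excludes it.\<close>
    have "v xbar \<le> ennreal B"
      unfolding v_def by (rule vB) simp
    then obtain r where r: "0 \<le> r" "v xbar = ennreal r"
      by (cases "v xbar") (auto simp: top_unique)
    with eq \<beta>_nonneg have "r = \<beta> * r"
      by (simp add: ennreal_mult[symmetric])
    with \<beta>(2) have "r = 0"
      by simp
    with r show ?thesis by simp
  qed
  have u_meas: "u \<in> borel_measurable (states original)"
    unfolding u_def using relative_value_measurable[OF v_meas] by simp
  have u_le: "u y \<le> ennreal (Kl * B + Kl * B)" if y: "y \<in> X" for y
  proof -
    have "u y \<le> ennreal Kl * ennreal B + ennreal Kl * ennreal B"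
      unfolding u_def relative_value_def v_def using \<mu>_bounds[OF y] y
      by (intro add_mono mult_mono vB ennreal_leI) auto
    also have "\<dots> = ennreal (Kl * B + Kl * B)"
      using Kl_ge B by (simp only: ennreal_mult ennreal_plus mult_nonneg_nonneg order_trans[OF zero_le_one])
    finally show ?thesis .
  qed
  \<comment> \<open>The bracket is the one in \<open>discounted_eq_average\<close>, so relations
    between \<open>v\<close> and its one-step right-hand side pass to \<open>u\<close> by
    multiplying with \<open>\<mu> x\<close> and adding, without any cancellation.\<close>
  have u_eq: "v lost + u x = ennreal (\<mu> x) * v x + (v lost + ennreal (Kl - \<mu> x) * v lost)" for x
    unfolding u_def relative_value_def by (simp add: ac_simps)
  note avg = discounted_eq_average[OF v_meas v0, folded u_def]
  have lower: "v lost \<le> avg_cost original \<rho> x" if \<rho>: "\<rho> \<in> policies original" and x: "x \<in> X" for \<rho> x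
  proof -
    interpret mdp_process original \<rho> x
      by unfold_locales (use \<rho> x in auto)
    show ?thesis
    proof (rule avg_cost_ge[OF u_meas])
      fix y a assume "y \<in> space (states original)" "a \<in> avail original y"
      then have y: "y \<in> X" and a: "a \<in> {0..M}"
        by auto
      then have "y \<noteq> xbar"
        using xbar_notin_X by blast
      with v_le[OF constant_selector[OF a], of y] y
      have "v y \<le> ennreal (cost transformed (y, a)) + ennreal \<beta> * (\<integral>\<^sup>+y. v y \<partial>kernel transformed (y, a))"
        by (simp del: transformed_simps)
      then have "v lost + u y \<le> ennreal (c (y, a)) + (\<integral>\<^sup>+y. u y \<partial>q (y, a))"
        unfolding u_eq avg[OF y a, symmetric] by (intro add_right_mono mult_left_mono) auto
      then show "v lost + u y \<le> ennreal (cost original (y, a)) + (\<integral>\<^sup>+y. u y \<partial>kernel original (y, a))"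
        by simp
    qed (use u_le in auto)
  qed
  \<comment> \<open>For the given policy, \<open>v_eq\<close> holds after averaging over its action,
    so the average cost equation is integrated against \<open>\<pi> n z\<close>.\<close>
  have upper: "avg_cost original (as_inventory_policy M \<pi>) x \<le> v lost" if x: "x \<in> X" for x
  proof -
    interpret mdp_process original "as_inventory_policy M \<pi>" x
      by unfold_locales (use as_inventory_policy_policies[OF \<pi>] x in auto)
    show ?thesis
    proof (rule avg_cost_le[OF u_meas])
      show "u x < \<infinity>"
        using u_le[OF x] by (simp add: le_less_trans)
      fix n z assume z: "z \<in> space (histories original n)"
      let ?x = "snd z" and ?k = "v lost + ennreal (Kl - \<mu> (snd z)) * v lost"
      let ?g = "\<lambda>a. ennreal (cost transformed (?x, a)) + ennreal \<beta> * (\<integral>\<^sup>+y. v y \<partial>kernel transformed (?x, a))"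
      note z' = original_history[OF \<pi> z]
      have "(\<integral>\<^sup>+a. ennreal (cost original (?x, a)) + (\<integral>\<^sup>+y. u y \<partial>kernel original (?x, a))
          \<partial>as_inventory_policy M \<pi> n z) = (\<integral>\<^sup>+a. ennreal (\<mu> ?x) * ?g a + ?k \<partial>\<pi> n z)"
        by (rule nn_integral_as_inventory_policy[OF \<pi> z])
          (simp only: avg[OF z'(2)] original_simps)
      also have "\<dots> = ennreal (\<mu> ?x) * (\<integral>\<^sup>+a. ?g a \<partial>\<pi> n z) + ?k"
      proof -
        have x': "?x \<in> space SY"
          using z'(2) by simp
        have v_meas': "v \<in> borel_measurable (states transformed)"
          using v_meas by simp
        have g0: "(\<lambda>z. ennreal (cost transformed z) + ennreal \<beta> * (\<integral>\<^sup>+y. v y \<partial>kernel transformed z))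
            \<in> borel_measurable (sa transformed)"
          by (intro borel_measurable_add borel_measurable_times_ennreal measurable_const
              measurable_compose[OF H.kernel_subprob nn_integral_measurable_subprob_algebra[OF v_meas']]
              measurable_compose[OF H.cost_measurable measurable_ennreal]) simp
        have g: "?g \<in> borel_measurable (\<pi> n z)"
          unfolding measurable_cong_sets[OF z'(3) refl]
          using measurable_compose[OF measurable_Pair1'[OF x'] g0[unfolded transformed_simps(1,2)]] .
        have "(\<integral>\<^sup>+a. ennreal (\<mu> ?x) * ?g a + ?k \<partial>\<pi> n z) =
            (\<integral>\<^sup>+a. ennreal (\<mu> ?x) * ?g a \<partial>\<pi> n z) + (\<integral>\<^sup>+a. ?k \<partial>\<pi> n z)"
          by (rule nn_integral_add[OF borel_measurable_times_ennreal[OF measurable_const g] measurable_const])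
            simp_all
        then show ?thesis
          by (simp only: nn_integral_cmult[OF g] H.nn_integral_policy_const[OF \<pi> z'(1)])
      qed
      also have "(\<integral>\<^sup>+a. ?g a \<partial>\<pi> n z) = v ?x"
        using v_eq[of ?x] z'(2) unfolding \<kappa>[OF z'(1)] by simp
      also have "ennreal (\<mu> ?x) * v ?x + ?k = v lost + u ?x"
        by (rule u_eq[symmetric])
      finally show "(\<integral>\<^sup>+a. ennreal (cost original (?x, a)) + (\<integral>\<^sup>+y. u y \<partial>kernel original (?x, a))
          \<partial>as_inventory_policy M \<pi> n z) \<le> v lost + u ?x"
        by simp
    qed
  qed
  have "avg_cost original (as_inventory_policy M \<pi>) x = (INF \<rho>\<in>policies original. avg_cost original \<rho> x)"
    if x: "x \<in> X" for x
  proof (rule antisym)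
    show "avg_cost original (as_inventory_policy M \<pi>) x \<le> (INF \<rho>\<in>policies original. avg_cost original \<rho> x)"
      using upper[OF x] lower[OF _ x] by (intro INF_greatest) (rule order_trans)
    show "(INF \<rho>\<in>policies original. avg_cost original \<rho> x) \<le> avg_cost original (as_inventory_policy M \<pi>) x"
      by (rule INF_lower[OF as_inventory_policy_policies[OF \<pi>]])
  qed
  then show ?thesis
    using as_inventory_policy_policies[OF \<pi>] by (simp add: avg_optimal_def)
qed

end

section \<open>Lower semicontinuity\<close>

text \<open>The sequential form is what Fatou's lemma provides in \<open>lsc_expected_stage\<close>;
  minima and measurability use closed sublevel sets through
  \<open>lsc_on_iff_closed\<close>.\<close>

definition lsc_on :: "'a::first_countable_topology set \<Rightarrow> ('a \<Rightarrow> real) \<Rightarrow> bool" where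
  "lsc_on S f \<longleftrightarrow> (\<forall>X x. (\<forall>n. X n \<in> S) \<longrightarrow> x \<in> S \<longrightarrow> X \<longlonglongrightarrow> x \<longrightarrow>
     (\<forall>c<f x. eventually (\<lambda>n. c < f (X n)) sequentially))"

lemma lsc_onI:
  assumes "\<And>X x c. (\<And>n. X n \<in> S) \<Longrightarrow> x \<in> S \<Longrightarrow> X \<longlonglongrightarrow> x \<Longrightarrow> c < f x \<Longrightarrow>
    eventually (\<lambda>n. c < f (X n)) sequentially"
  shows "lsc_on S f"
  using assms unfolding lsc_on_def by blast

lemma lsc_onD:
  assumes "lsc_on S f" and "\<And>n. X n \<in> S" and "x \<in> S" and "X \<longlonglongrightarrow> x" and "c < f x"
  shows "eventually (\<lambda>n. c < f (X n)) sequentially"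
  using assms unfolding lsc_on_def by blast

lemma lsc_on_iff_closed:
  assumes S: "closed S"
  shows "lsc_on S f \<longleftrightarrow> (\<forall>c. closed {x\<in>S. f x \<le> c})"
proof safe
  fix c assume f: "lsc_on S f"
  show "closed {x\<in>S. f x \<le> c}"
    unfolding closed_sequential_limits
  proof safe
    fix X x assume X: "\<forall>n. X n \<in> {x\<in>S. f x \<le> c}" "X \<longlonglongrightarrow> x"
    then show x: "x \<in> S"
      using S unfolding closed_sequential_limits by blast
    show "f x \<le> c"
    proof (rule ccontr)
      assume "\<not> f x \<le> c"
      then have "eventually (\<lambda>n. c < f (X n)) sequentially"
        using X x by (intro lsc_onD[OF f]) auto
      then show False
        using X by (auto dest!: eventually_happens simp: not_le[symmetric])
    qed
  qed
next
  assume closed: "\<forall>c. closed {x\<in>S. f x \<le> c}"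
  show "lsc_on S f"
  proof (rule lsc_onI)
    fix X x c assume X: "\<And>n. X n \<in> S" "X \<longlonglongrightarrow> x" and c: "c < f x"
    have "open (- {x\<in>S. f x \<le> c})"
      using closed by (simp add: open_Compl)
    moreover have "x \<in> - {x\<in>S. f x \<le> c}"
      using c by simp
    ultimately have "eventually (\<lambda>n. X n \<in> - {x\<in>S. f x \<le> c}) sequentially"
      by (rule topological_tendstoD[OF X(2)])
    then show "eventually (\<lambda>n. c < f (X n)) sequentially"
      by eventually_elim (simp add: X(1) not_le)
  qed
qed

lemma lsc_on_cong: "(\<And>x. x \<in> S \<Longrightarrow> f x = g x) \<Longrightarrow> lsc_on S f \<longleftrightarrow> lsc_on S g"
  unfolding lsc_on_def by (simp cong: conj_cong)

lemma lsc_on_subset: "lsc_on S f \<Longrightarrow> T \<subseteq> S \<Longrightarrow> lsc_on T f"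
  unfolding lsc_on_def by blast

lemma lsc_on_continuous:
  assumes "continuous_on S f"
  shows "lsc_on S f"
proof (rule lsc_onI)
  fix X x c assume X: "\<And>n. X n \<in> S" "x \<in> S" "X \<longlonglongrightarrow> x" "c < f x"
  then have "(\<lambda>n. f (X n)) \<longlonglongrightarrow> f x"
    using assms by (intro continuous_on_tendsto_compose[OF assms]) auto
  with X(4) show "eventually (\<lambda>n. c < f (X n)) sequentially"
    by (simp add: order_tendstoD(1))
qed

lemma lsc_on_add:
  assumes f: "lsc_on S f" and g: "lsc_on S g"
  shows "lsc_on S (\<lambda>x. f x + g x)"
proof (rule lsc_onI)
  fix X x c assume X: "\<And>n. X n \<in> S" "x \<in> S" "X \<longlonglongrightarrow> x" and c: "c < f x + g x"
  define e where "e = (f x + g x - c) / 2"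
  have "f x - e < f x" "g x - e < g x"
    using c by (auto simp: e_def)
  from lsc_onD[OF f X this(1)] lsc_onD[OF g X this(2)]
  show "eventually (\<lambda>n. c < f (X n) + g (X n)) sequentially"
    by eventually_elim (simp add: e_def field_simps)
qed

lemma lsc_on_compose:
  assumes f: "lsc_on T f" and g: "continuous_on S g" "\<And>x. x \<in> S \<Longrightarrow> g x \<in> T"
  shows "lsc_on S (\<lambda>x. f (g x))"
proof (rule lsc_onI)
  fix X x c assume X: "\<And>n. X n \<in> S" "x \<in> S" "X \<longlonglongrightarrow> x" "c < f (g x)"
  then have "(\<lambda>n. g (X n)) \<longlonglongrightarrow> g x"
    by (intro continuous_on_tendsto_compose[OF g(1)]) auto
  with X g(2) show "eventually (\<lambda>n. c < f (g (X n))) sequentially"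
    by (intro lsc_onD[OF f]) auto
qed

text \<open>Some \<open>f k\<close> already exceeds \<open>c\<close> at the limit point, hence
  eventually along the sequence, and it lies below \<open>g\<close>.\<close>

lemma lsc_on_lim:
  assumes f: "\<And>n. lsc_on S (f n)" and le: "\<And>n x. x \<in> S \<Longrightarrow> f n x \<le> g x"
    and lim: "\<And>x. x \<in> S \<Longrightarrow> (\<lambda>n. f n x) \<longlonglongrightarrow> g x"
  shows "lsc_on S g"
proof (rule lsc_onI)
  fix X x c assume X: "\<And>n. X n \<in> S" "x \<in> S" "X \<longlonglongrightarrow> x" and c: "c < g x"
  from order_tendstoD(1)[OF lim[OF X(2)] c] obtain k where "c < f k x"
    by (auto dest!: eventually_happens)
  from lsc_onD[OF f X this] show "eventually (\<lambda>n. c < g (X n)) sequentially"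
    by eventually_elim (use le X(1) in \<open>blast intro: less_le_trans\<close>)
qed

text \<open>A minimizer is a common point of the sublevel sets at all attained levels. These are
  closed, and finitely many of them share the best of their defining points.\<close>

lemma lsc_on_attains_min:
  fixes f :: "'a::metric_space \<Rightarrow> real"
  assumes S: "compact S" "S \<noteq> {}" and f: "lsc_on S f"
  obtains x where "x \<in> S" "\<And>y. y \<in> S \<Longrightarrow> f x \<le> f y"
proof -
  have closed: "closed {x\<in>S. f x \<le> c}" for c
    using f lsc_on_iff_closed[OF compact_imp_closed[OF S(1)]] by blast
  have "S \<inter> \<Inter> ((\<lambda>y. {x\<in>S. f x \<le> f y}) ` S) \<noteq> {}"
  proof (rule compact_imp_fip[OF S(1)])
    fix F assume F: "finite F" "F \<subseteq> (\<lambda>y. {x\<in>S. f x \<le> f y}) ` S"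
    then obtain Y where Y: "finite Y" "Y \<subseteq> S" "F = (\<lambda>y. {x\<in>S. f x \<le> f y}) ` Y"
      by (meson finite_subset_image)
    show "S \<inter> \<Inter> F \<noteq> {}"
    proof (cases "Y = {}")
      case True
      with S Y show ?thesis by simp
    next
      case False
      then obtain y where "y \<in> Y" "\<And>z. z \<in> Y \<Longrightarrow> f y \<le> f z"
        using Y(1) by (metis arg_min_if_finite(1,2) not_le)
      with Y show ?thesis by auto
    qed
  qed (use closed in auto)
  then show ?thesis
    using that by auto
qed

text \<open>As the minima are attained, a sublevel set of \<open>m\<close> is the projection of a
  compact sublevel set of \<open>f\<close>.\<close>

lemma lsc_on_partial_min:
  fixes f :: "'a::metric_space \<times> 'b::metric_space \<Rightarrow> real"
  assumes S: "compact S" and A: "compact A" and f: "lsc_on (S \<times> A) f"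
    and m: "\<And>x. x \<in> S \<Longrightarrow> \<exists>a\<in>A. f (x, a) = m x" "\<And>x a. x \<in> S \<Longrightarrow> a \<in> A \<Longrightarrow> m x \<le> f (x, a)"
  shows "lsc_on S m"
  unfolding lsc_on_iff_closed[OF compact_imp_closed[OF S]]
proof
  fix c
  have SA: "compact (S \<times> A)"
    using S A by (rule compact_Times)
  then have "compact ((S \<times> A) \<inter> {z\<in>S \<times> A. f z \<le> c})"
    using f lsc_on_iff_closed[OF compact_imp_closed[OF SA]] by (intro compact_Int_closed) auto
  then have "compact {z\<in>S \<times> A. f z \<le> c}"
    by (simp add: Int_absorb1)
  then have "compact (fst ` {z\<in>S \<times> A. f z \<le> c})"
    by (rule compact_continuous_image[rotated]) (intro continuous_intros)
  moreover have "{x\<in>S. m x \<le> c} = fst ` {z\<in>S \<times> A. f z \<le> c}"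
  proof safe
    fix x assume x: "x \<in> S" "m x \<le> c"
    then obtain a where "a \<in> A" "f (x, a) = m x"
      using m(1) by blast
    with x show "x \<in> fst ` {z\<in>S \<times> A. f z \<le> c}"
      by (intro image_eqI[of _ _ "(x, a)"]) auto
  qed (use m(2) in \<open>auto intro: order_trans\<close>)
  ultimately show "closed {x\<in>S. m x \<le> c}"
    by (simp add: compact_imp_closed)
qed

lemma lsc_on_measurable:
  assumes S: "closed S" and f: "lsc_on S f"
  shows "f \<in> borel_measurable (restrict_space borel S)"
  unfolding borel_measurable_iff_le
proof
  fix c
  have "closed {x\<in>S. f x \<le> c}"
    using f lsc_on_iff_closed[OF S] by blast
  then show "{x \<in> space (restrict_space borel S). f x \<le> c} \<in> sets (restrict_space borel S)"
    using S by (auto simp: space_restrict_space sets_restrict_space_iff)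
qed

text \<open>The jump at 0 is harmless because the function takes the smaller value at the jump
  itself.\<close>

lemma lsc_on_fixed_cost:
  assumes "0 \<le> (K::real)"
  shows "lsc_on UNIV (\<lambda>a::real. K * (if a > 0 then 1 else 0))"
proof (rule lsc_onI)
  fix X :: "nat \<Rightarrow> real" and x c assume X: "X \<longlonglongrightarrow> x" and c: "c < K * (if x > 0 then 1 else 0)"
  show "eventually (\<lambda>n. c < K * (if X n > 0 then 1 else 0)) sequentially"
  proof (cases "x > 0")
    case True
    with order_tendstoD(1)[OF X] have "eventually (\<lambda>n. 0 < X n) sequentially"
      by blast
    then show ?thesis
      by eventually_elim (use c True in simp)
  next
    case False
    with c assms have "c < K * (if X n > 0 then 1 else 0)" for n
      by (auto intro: less_le_trans)
    then show ?thesis by simp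
  qed
qed

section \<open>Existence of an optimal selector\<close>

context inventory
begin

text \<open>Below, \<open>V\<close> plays the role of \<open>\<mu> * v\<close> for a value function
  \<open>v\<close> of the transformed model. This is then \<open>v lost\<close>, the candidate for
  the optimal average cost.\<close>

definition gain :: "(real \<Rightarrow> real) \<Rightarrow> real" where
  "gain V = V lost / \<mu> lost"

text \<open>The truncation at 0 keeps the integrand of \<open>expected_stage\<close> lower semicontinuous when
  \<open>h 0 \<le> h lost\<close>. It has no effect at the fixed point, since 0 and \<open>lost\<close> have the same level.\<close>

definition capped :: "(real \<Rightarrow> real) \<Rightarrow> real \<Rightarrow> real" where
  "capped V y = (if y = 0 then min (V 0) (\<mu> 0 * gain V) else V y)"

text \<open>Apart from the cap, holding cost plus \<open>relative_value\<close> in terms of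
  \<open>V\<close>. Since \<open>V lost = \<mu> lost * gain V\<close>, the second branch would give
  \<open>Kl * gain V\<close> at \<open>lost\<close> too; the explicit form eases comparing 0 with
  \<open>lost\<close>.\<close>

definition stage :: "(real \<Rightarrow> real) \<Rightarrow> real \<Rightarrow> real" where
  "stage V y = h y + (if y = lost then Kl * gain V else capped V y + (Kl - \<mu> y) * gain V)"

text \<open>State and action enter the dynamics only through the position
  \<open>z = level x + a\<close> after ordering; it is encoded as action \<open>z\<close> in state
  0.\<close>

definition expected_stage :: "(real \<Rightarrow> real) \<Rightarrow> real \<Rightarrow> real" where
  "expected_stage V z = (LINT s|D. stage V (inv_F C 0 z s))"

definition action_value :: "(real \<Rightarrow> real) \<Rightarrow> real \<times> real \<Rightarrow> real" where
  "action_value V = (\<lambda>(x, a). K * (if a > 0 then 1 else 0) + cb * a + expected_stage V (level x + a))"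

text \<open>\<open>t = M\<close> gives the Bellman minimum; smaller \<open>t\<close> serve to locate
  the smallest minimizer.\<close>

definition min_action_value :: "(real \<Rightarrow> real) \<Rightarrow> real \<Rightarrow> real \<Rightarrow> real" where
  "min_action_value V t x = Inf ((\<lambda>a. action_value V (x, a)) ` {0..t})"

text \<open>Up to the cap, the discounted optimality operator at \<open>V / \<mu>\<close>,
  multiplied by \<open>\<mu>\<close> and rewritten as in \<open>discounted_eq_average\<close>. The
  discount has cancelled; the subtracted term is the gain plus the shift
  \<open>(Kl - \<mu> x) * gain V\<close>.\<close>

definition bellman_op :: "(real \<Rightarrow> real) \<Rightarrow> real \<Rightarrow> real" where
  "bellman_op V x = min_action_value V M x - (1 + Kl - \<mu> x) * gain V"

definition admissible :: "(real \<Rightarrow> real) \<Rightarrow> bool" where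
  "admissible V \<longleftrightarrow> lsc_on X V \<and> (\<exists>e. \<forall>x\<in>X. 0 \<le> V x \<and> V x \<le> e * \<mu> x)"

lemma lost_neq_0 [simp]: "lost \<noteq> 0" "0 \<noteq> lost"
  by (simp_all add: lost_def)

lemma level_zero [simp]: "level 0 = 0" "level lost = 0"
  by (simp_all add: level_def)

lemma level_bounds: "x \<in> X \<Longrightarrow> level x \<in> {0..C}"
  using C by (auto simp: inv_X_def level_def)

lemma inv_F_level: "inv_F C x a s = inv_F C 0 (level x + a) s"
  by (simp add: inv_F_def)

lemma level_continuous: "continuous_on X level"
proof -
  have "continuous_on {0..C} level"
  proof (rule continuous_on_cong[THEN iffD1, OF refl _ continuous_on_id])
    show "y = level y" if "y \<in> {0..C}" for y
      using that by (auto simp: level_def lost_def)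
  qed
  then have "continuous_on ({lost} \<union> {0..C}) level"
    by (intro continuous_on_closed_Un) auto
  then show ?thesis
    by (simp add: inv_X_def)
qed

section \<open>Stage costs of admissible functions\<close>

lemma admissibleD:
  assumes "admissible V"
  shows admissible_lsc: "lsc_on X V" and admissible_nonneg: "x \<in> X \<Longrightarrow> 0 \<le> V x" and admissible_gain: "0 \<le> gain V"
    and admissible_measurable: "V \<in> borel_measurable SX"
proof -
  show lsc: "lsc_on X V" and nonneg: "x \<in> X \<Longrightarrow> 0 \<le> V x" for x
    using assms by (auto simp: admissible_def)
  show "0 \<le> gain V"
    using nonneg[OF lost_in_X] \<mu>_bounds[OF lost_in_X] by (simp add: gain_def)
  show "V \<in> borel_measurable SX"
    by (rule lsc_on_measurable[OF closed_X lsc])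
qed

lemma stage_measurable:
  assumes V: "admissible V"
  shows "stage V \<in> borel_measurable SX"
proof -
  note [measurable] = admissible_measurable[OF V]
  have [measurable]: "(\<lambda>y. y) \<in> borel_measurable SX"
    by (rule measurable_restrict_space1) simp
  show ?thesis
    unfolding stage_def[abs_def] capped_def by measurable
qed

lemma stage_bounds:
  assumes V: "admissible V"
  obtains B where "\<And>y. y \<in> X \<Longrightarrow> 0 \<le> stage V y \<and> stage V y \<le> B"
proof -
  obtain e where e: "\<And>x. x \<in> X \<Longrightarrow> 0 \<le> V x \<and> V x \<le> e * \<mu> x"
    using V by (auto simp: admissible_def)
  have "0 \<le> e * \<mu> 0"
    using e[OF zero_in_X] by simp
  then have e0: "0 \<le> e"
    using \<mu>_bounds[OF zero_in_X] by (simp add: zero_le_mult_iff)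
  obtain H where H: "\<And>x. x \<in> X \<Longrightarrow> h x \<le> H" "0 \<le> H"
    using h_bounded by blast
  have "0 \<le> stage V y \<and> stage V y \<le> H + (e * Kl + Kl * gain V)" if y: "y \<in> X" for y
  proof -
    have \<mu>y: "1 \<le> \<mu> y" "\<mu> y \<le> Kl" "1 \<le> \<mu> 0"
      using \<mu>_bounds[OF y] \<mu>_bounds[OF zero_in_X] by auto
    have "V y \<le> e * Kl"
      using e[OF y] e0 \<mu>y by (meson mult_left_mono order_trans)
    moreover have "0 \<le> (Kl - \<mu> y) * gain V" "(Kl - \<mu> y) * gain V \<le> Kl * gain V" "0 \<le> Kl * gain V" "0 \<le> e * Kl"
      using \<mu>y admissible_gain[OF V] e0 by (auto intro!: mult_nonneg_nonneg mult_right_mono)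
    moreover have "0 \<le> capped V y" "capped V y \<le> V y"
      using e[OF y] \<mu>y(3) admissible_gain[OF V] by (auto simp: capped_def)
    ultimately show ?thesis
      using H(1)[OF y] h_nonneg[OF y] unfolding stage_def by auto
  qed
  then show ?thesis
    using that by blast
qed

lemma stage_integrable:
  assumes V: "admissible V"
  shows "integrable D (\<lambda>s. stage V (inv_F C x a s))"
proof -
  obtain B where "\<And>y. y \<in> X \<Longrightarrow> 0 \<le> stage V y \<and> stage V y \<le> B"
    using stage_bounds[OF V] by blast
  then show ?thesis
    by (intro integrable_bounded_demand[where B=B] stage_measurable[OF V]) (simp add: abs_of_nonneg)
qed

lemma stage_nonneg: "admissible V \<Longrightarrow> y \<in> X \<Longrightarrow> 0 \<le> stage V y"
  using stage_bounds by blast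

lemma expected_stage_nonneg: "admissible V \<Longrightarrow> 0 \<le> expected_stage V z"
  unfolding expected_stage_def by (intro integral_nonneg_AE AE_I2 stage_nonneg) simp_all

lemma nn_integral_stage:
  "admissible V \<Longrightarrow> (\<integral>\<^sup>+s. ennreal (stage V (inv_F C 0 z s)) \<partial>D) = ennreal (expected_stage V z)"
  unfolding expected_stage_def
  by (intro nn_integral_eq_integral stage_integrable AE_I2 stage_nonneg) simp_all

text \<open>Lowering a lower semicontinuous function at a single point preserves lower
  semicontinuity; sequences with another limit eventually avoid 0.\<close>

lemma lsc_capped:
  assumes V: "admissible V"
  shows "lsc_on {0..C} (capped V)"
proof (rule lsc_onI)
  fix Y y k assume Y: "\<And>n. Y n \<in> {0..C}" "y \<in> {0..C}" "Y \<longlonglongrightarrow> y" and k: "k < capped V y"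
  have sub: "{0..C} \<subseteq> X"
    by (auto simp: inv_X_def)
  show "eventually (\<lambda>n. k < capped V (Y n)) sequentially"
  proof (cases "y = 0")
    case True
    then have "k < V y"
      using k by (simp add: capped_def)
    from lsc_onD[OF lsc_on_subset[OF admissible_lsc[OF V] sub] Y this]
    show ?thesis
      by eventually_elim (use k True in \<open>simp add: capped_def\<close>)
  next
    case False
    then have "k < V y"
      using k by (simp add: capped_def)
    have "eventually (\<lambda>n. Y n \<noteq> 0) sequentially"
      using tendsto_imp_eventually_ne[OF Y(3) False] .
    with lsc_onD[OF lsc_on_subset[OF admissible_lsc[OF V] sub] Y \<open>k < V y\<close>]
    show ?thesis
      by eventually_elim (simp add: capped_def)
  qed
qed

lemma lsc_stage:
  assumes V: "admissible V"
  shows "lsc_on {0..C} (stage V)"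
proof -
  have sub: "{0..C} \<subseteq> X"
    by (auto simp: inv_X_def)
  have "lsc_on {0..C} (\<lambda>y. h y + (capped V y + (Kl - \<mu> y) * gain V))"
    by (rule lsc_on_add[OF lsc_on_continuous[OF h_cont] lsc_on_add[OF lsc_capped[OF V] lsc_on_continuous]])
      (intro continuous_intros continuous_on_subset[OF \<mu>_cont sub])
  also have "?this \<longleftrightarrow> lsc_on {0..C} (stage V)"
    by (rule lsc_on_cong) (auto simp: stage_def lost_def)
  finally show ?thesis .
qed

text \<open>The interval omits 0 because positions in \<open>{0..C + M}\<close> cannot approach 0
  from below, so an atom of the demand at 0 causes no jump.\<close>

definition demand_condition :: bool where
  "demand_condition \<longleftrightarrow> h 0 \<le> h lost \<or> (\<forall>s\<in>{0<..C + M}. isCont (cdf D) s)"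

text \<open>Fatou's lemma applies since stages are nonnegative. Only the demand \<open>s = z\<close>
  is critical: positions just below \<open>z\<close> lose the sale and replace
  \<open>stage V 0\<close> by \<open>stage V lost\<close>. Either this jump goes up, by the cap and
  \<open>h 0 \<le> h lost\<close>, or \<open>z\<close> carries no demand mass, or
  \<open>z = 0\<close>.\<close>

lemma lsc_expected_stage:
  assumes V: "admissible V" and cond: demand_condition
  shows "lsc_on {0..C + M} (expected_stage V)"
proof (rule lsc_onI)
  fix Z z k assume Z: "\<And>n. Z n \<in> {0..C + M}" "z \<in> {0..C + M}" "Z \<longlonglongrightarrow> z" and k: "k < expected_stage V z"
  \<comment> \<open>The lower truncation makes the next level continuous in the position even across
    \<open>z = s\<close>, so approach from above and from below can be separated.\<close>
  let ?y = "\<lambda>s z. max 0 (min (z - s) C)"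
  have F_ge: "inv_F C 0 z s = ?y s z" if "s \<le> z" for z s
    using that C by (simp add: inv_F_def)
  have F_less: "inv_F C 0 z s = lost" if "z < s" for z s
    using that by (simp add: inv_F_def)
  have y_lim: "(\<lambda>n. ?y s (Z n)) \<longlonglongrightarrow> ?y s z" for s
    by (intro tendsto_intros Z(3))
  have y_in: "?y s z \<in> {0..C}" for s z
    using C by auto
  have y_stage: "eventually (\<lambda>n. r < stage V (?y s (Z n))) sequentially" if "r < stage V (?y s z)" for r s
    by (rule lsc_onD[OF lsc_stage[OF V] y_in y_in y_lim that])
  have pointwise: "eventually (\<lambda>n. r < stage V (inv_F C 0 (Z n) s)) sequentially"
    if s: "s \<noteq> z \<or> h 0 \<le> h lost \<or> z = 0" and r: "r < stage V (inv_F C 0 z s)" for r s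
  proof -
    consider "z < s" | "s < z" | "s = z" by linarith
    then show ?thesis
    proof cases
      case 1
      then have "eventually (\<lambda>n. Z n < s) sequentially"
        using order_tendstoD(2)[OF Z(3)] by blast
      then show ?thesis
        by eventually_elim (use r in \<open>simp add: F_less 1\<close>)
    next
      case 2
      then have "eventually (\<lambda>n. s < Z n) sequentially"
        using order_tendstoD(1)[OF Z(3)] by blast
      moreover have "r < stage V (?y s z)"
        using r 2 by (simp add: F_ge)
      note y_stage[OF this]
      ultimately show ?thesis
        by eventually_elim (simp add: F_ge)
    next
      case 3
      then have r': "r < stage V (?y s z)" "?y s z = 0"
        using r C by (simp_all add: F_ge)
      have below: "r < stage V (inv_F C 0 (Z n) s)" if "Z n < s" for n
      proof -
        have "h 0 \<le> h lost"
          using s 3 that Z(1)[of n] by auto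
        moreover have "capped V 0 \<le> \<mu> 0 * gain V"
          by (simp add: capped_def)
        moreover have "(Kl - \<mu> 0) * gain V = Kl * gain V - \<mu> 0 * gain V"
          by (simp add: algebra_simps)
        ultimately have "stage V 0 \<le> stage V lost"
          unfolding stage_def by simp
        then show ?thesis
          using r' that by (simp add: F_less)
      qed
      from y_stage[OF r'(1)] show ?thesis
      proof eventually_elim
        case (elim n)
        then show ?case
          using below[of n] by (cases "Z n < s") (simp_all add: F_ge)
      qed
    qed
  qed
  have "AE s in D. s \<noteq> z \<or> h 0 \<le> h lost \<or> z = 0"
  proof (cases "h 0 \<le> h lost \<or> z = 0")
    case False
    then have "isCont (cdf D) z"
      using cond Z(2) unfolding demand_condition_def by auto
    then have "measure D {z} = 0"
      by (simp add: isCont_cdf)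
    then have "AE s in D. s \<notin> {z}"
      by (intro AE_not_in) (auto simp: null_sets_def emeasure_eq_measure)
    then show ?thesis
      by eventually_elim simp
  qed auto
  then have "AE s in D. ennreal (stage V (inv_F C 0 z s)) \<le> liminf (\<lambda>n. ennreal (stage V (inv_F C 0 (Z n) s)))"
  proof eventually_elim
    case (elim s)
    show ?case
      unfolding le_Liminf_iff
    proof safe
      fix t assume t: "t < ennreal (stage V (inv_F C 0 z s))"
      then obtain r where r: "0 \<le> r" "t = ennreal r"
        by (cases t) auto
      then have "r < stage V (inv_F C 0 z s)"
        using t by (simp add: ennreal_less_iff)
      from pointwise[OF elim this]
      show "eventually (\<lambda>n. t < ennreal (stage V (inv_F C 0 (Z n) s))) sequentially"
        by eventually_elim (use r in \<open>simp add: ennreal_less_iff\<close>)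
    qed
  qed
  then have "ennreal (expected_stage V z) \<le> (\<integral>\<^sup>+s. liminf (\<lambda>n. ennreal (stage V (inv_F C 0 (Z n) s))) \<partial>D)"
    unfolding nn_integral_stage[OF V, symmetric] by (rule nn_integral_mono_AE)
  also have "\<dots> \<le> liminf (\<lambda>n. \<integral>\<^sup>+s. ennreal (stage V (inv_F C 0 (Z n) s)) \<partial>D)"
  proof (rule nn_integral_liminf)
    fix n
    have "(\<lambda>s. stage V (inv_F C 0 (Z n) s)) \<in> borel_measurable borel"
      by (rule measurable_compose[OF inv_F_measurable_demand stage_measurable[OF V]])
    then show "(\<lambda>s. ennreal (stage V (inv_F C 0 (Z n) s))) \<in> borel_measurable D"
      by simp
  qed
  finally have lim: "ennreal (expected_stage V z) \<le> liminf (\<lambda>n. ennreal (expected_stage V (Z n)))"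
    unfolding nn_integral_stage[OF V] .
  show "eventually (\<lambda>n. k < expected_stage V (Z n)) sequentially"
  proof (cases "0 \<le> k")
    case True
    then have "ennreal k < ennreal (expected_stage V z)"
      using k by (simp add: ennreal_less_iff)
    with lim have "eventually (\<lambda>n. ennreal k < ennreal (expected_stage V (Z n))) sequentially"
      unfolding le_Liminf_iff by blast
    then show ?thesis
      by eventually_elim (use True in \<open>simp add: ennreal_less_iff\<close>)
  next
    case False
    then have "k < expected_stage V (Z n)" for n
      using expected_stage_nonneg[OF V, of "Z n"] by linarith
    then show ?thesis by simp
  qed
qed

lemma lsc_action_value:
  assumes V: "admissible V" and cond: demand_condition
  shows "lsc_on (X \<times> {0..M}) (action_value V)"
proof -
  have 1: "lsc_on (X \<times> {0..M}) (\<lambda>z. K * (if snd z > 0 then 1 else 0))"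
    by (rule lsc_on_compose[OF lsc_on_fixed_cost[OF K]]) (auto intro: continuous_intros)
  have 2: "lsc_on (X \<times> {0..M}) (\<lambda>z. cb * snd z)"
    by (intro lsc_on_continuous continuous_intros)
  have "continuous_on (X \<times> {0..M}) (\<lambda>z. level (fst z) + snd z)"
    by (intro continuous_intros continuous_on_compose2[OF level_continuous]) auto
  then have 3: "lsc_on (X \<times> {0..M}) (\<lambda>z. expected_stage V (level (fst z) + snd z))"
    by (rule lsc_on_compose[OF lsc_expected_stage[OF V cond]]) (use level_bounds in force)
  show ?thesis
    using lsc_on_add[OF lsc_on_add[OF 1 2] 3] unfolding action_value_def split_beta .
qed

context
  fixes V assumes V: "admissible V" and cond: demand_condition
begin

lemma lsc_action_value_section: "x \<in> X \<Longrightarrow> t \<le> M \<Longrightarrow> lsc_on {0..t} (\<lambda>a. action_value V (x, a))"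
  by (rule lsc_on_compose[OF lsc_action_value[OF V cond]]) (auto intro: continuous_intros)

lemma
  assumes x: "x \<in> X" and t: "0 \<le> t" "t \<le> M"
  shows min_action_value_attained: "\<exists>a\<in>{0..t}. action_value V (x, a) = min_action_value V t x"
    and min_action_value_le: "a \<in> {0..t} \<Longrightarrow> min_action_value V t x \<le> action_value V (x, a)"
proof -
  obtain b where b: "b \<in> {0..t}" "\<And>a. a \<in> {0..t} \<Longrightarrow> action_value V (x, b) \<le> action_value V (x, a)"
    using lsc_on_attains_min[OF _ _ lsc_action_value_section[OF x t(2)]] t(1) by (metis atLeastAtMost_iff compact_Icc
      empty_iff order_refl)
  have "min_action_value V t x = action_value V (x, b)"
    unfolding min_action_value_def by (rule cInf_eq_minimum) (use b in auto)
  with b show "\<exists>a\<in>{0..t}. action_value V (x, a) = min_action_value V t x" "a \<in> {0..t} \<Longrightarrow> min_action_value V t x \<le> action_value V (x, a)"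
    by auto
qed

lemma lsc_min_action_value: "0 \<le> t \<Longrightarrow> t \<le> M \<Longrightarrow> lsc_on X (min_action_value V t)"
  by (rule lsc_on_partial_min[OF compact_X compact_Icc[of 0 t] lsc_on_subset[OF lsc_action_value[OF V cond]]])
    (use min_action_value_attained min_action_value_le in \<open>auto simp: mem_Times_iff\<close>)

lemma lsc_bellman_op: "lsc_on X (bellman_op V)"
proof -
  have "lsc_on X (\<lambda>x. min_action_value V M x + - ((1 + Kl - \<mu> x) * gain V))"
    by (rule lsc_on_add[OF lsc_min_action_value lsc_on_continuous]) (use M in \<open>auto intro!: continuous_intros \<mu>_cont\<close>)
  then show ?thesis
    unfolding bellman_op_def[abs_def] by simp
qed

end

text \<open>Monotonicity is the case \<open>e = 0\<close>; the contraction is in the sup norm weighted by \<open>\<mu>\<close>.\<close>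

lemma bellman_op_le:
  assumes V: "admissible V" and V': "admissible V'" and cond: demand_condition and e: "0 \<le> e"
    and le: "\<And>x. x \<in> X \<Longrightarrow> V' x \<le> V x + e * \<mu> x" and x: "x \<in> X"
  shows "bellman_op V' x \<le> bellman_op V x + \<beta> * e * \<mu> x"
proof -
  \<comment> \<open>\<open>\<delta>\<close> has no sign, only \<open>\<delta> \<le> e\<close>. It
    cancels in the end: \<open>Kl * \<delta> + (e - \<delta>) * (\<mu> x - 1)\<close> from the
    stages minus \<open>(1 + Kl - \<mu> x) * \<delta>\<close> from the gain terms is
    \<open>e * (\<mu> x - 1)\<close>.\<close>
  define \<delta> where "\<delta> = gain V' - gain V"
  have "gain V' \<le> (V lost + e * \<mu> lost) / \<mu> lost"
    unfolding gain_def using le[OF lost_in_X] \<mu>_bounds[OF lost_in_X] by (intro divide_right_mono) auto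
  also have "\<dots> = gain V + e"
    using \<mu>_bounds[OF lost_in_X] by (simp add: gain_def add_divide_distrib)
  finally have \<delta>: "\<delta> \<le> e"
    by (simp add: \<delta>_def)
  have g': "gain V' = gain V + \<delta>"
    by (simp add: \<delta>_def)
  \<comment> \<open>Off \<open>lost\<close> the increase is at most
    \<open>e * \<mu> y + (Kl - \<mu> y) * \<delta>\<close>, at \<open>lost\<close> it is
    \<open>Kl * \<delta>\<close>; the indicator covers both.\<close>
  have stage: "stage V' y \<le> stage V y + (Kl * \<delta> + (e - \<delta>) * (indicator (X - {lost}) y * \<mu> y))" if y: "y \<in> X" for y
  proof (cases "y = lost")
    case True
    then show ?thesis
      by (simp add: stage_def g' algebra_simps)
  next
    case False
    have "capped V' y \<le> capped V y + e * \<mu> y"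
    proof (cases "y = 0")
      case True
      have "\<mu> 0 * gain V' \<le> \<mu> 0 * gain V + e * \<mu> 0"
        using \<delta> \<mu>_bounds[OF zero_in_X] by (simp add: g' algebra_simps mult_right_mono)
      with True le[OF zero_in_X] show ?thesis
        by (simp add: capped_def min_def)
    qed (use le[OF y] in \<open>simp add: capped_def\<close>)
    then show ?thesis
      using False y by (simp add: stage_def g' algebra_simps)
  qed
  have action_value: "action_value V' (x, a) \<le> action_value V (x, a) + (Kl * \<delta> + (e - \<delta>) * (\<mu> x - 1))" if a: "a \<in> {0..M}" for a
  proof -
    let ?w = "\<lambda>s. indicator (X - {lost}) (inv_F C 0 (level x + a) s) * \<mu> (inv_F C 0 (level x + a) s)"
    have w: "integrable D ?w"
      using taboo_weight_nonneg taboo_weight_le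
      by (intro integrable_bounded_demand[where B=Kl] taboo_weight_measurable) (simp add: abs_of_nonneg)
    have "expected_stage V' (level x + a) \<le>
        (LINT s|D. stage V (inv_F C 0 (level x + a) s) + (Kl * \<delta> + (e - \<delta>) * ?w s))"
      unfolding expected_stage_def using w
      by (intro integral_mono stage stage_integrable V V' Bochner_Integration.integrable_add
        integrable_mult_right integrable_const) simp_all
    also have "\<dots> = expected_stage V (level x + a) + (Kl * \<delta> + (e - \<delta>) * (LINT s|D. ?w s))"
      unfolding expected_stage_def using w stage_integrable[OF V] prob_space by simp
    also have "(LINT s|D. ?w s) = taboo_mu (x, a)"
      unfolding taboo_mu_eq by (simp add: inv_F_level[of x a])
    \<comment> \<open>The supersolution property of \<open>\<mu>\<close> enters here, with a
      nonnegative factor thanks to \<open>\<delta> \<le> e\<close>.\<close>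
    also have "(e - \<delta>) * taboo_mu (x, a) \<le> (e - \<delta>) * (\<mu> x - 1)"
      using taboo_mu_le[OF x a] \<delta> by (intro mult_left_mono) auto
    finally show ?thesis
      by (simp add: action_value_def)
  qed
  obtain a where a: "a \<in> {0..M}" "action_value V (x, a) = min_action_value V M x"
    using min_action_value_attained[OF V cond x M order_refl] by blast
  have "bellman_op V' x \<le> action_value V' (x, a) - (1 + Kl - \<mu> x) * gain V'"
    unfolding bellman_op_def using min_action_value_le[OF V' cond x M order_refl a(1)] by simp
  also have "\<dots> \<le> bellman_op V x + e * (\<mu> x - 1)"
    unfolding bellman_op_def using action_value[OF a(1)] a(2) by (simp add: g' algebra_simps)
  also have "e * (\<mu> x - 1) \<le> e * (\<beta> * \<mu> x)"
    using \<mu>_contraction[OF x] e by (rule mult_left_mono)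
  finally show ?thesis
    by (simp add: mult_ac)
qed

section \<open>Value iteration and the smallest minimizer\<close>

lemma admissible_zero: "admissible (\<lambda>_. 0)"
  unfolding admissible_def by (auto intro!: lsc_on_continuous exI[of _ 0])

definition iterate :: "nat \<Rightarrow> real \<Rightarrow> real" where
  "iterate n = (bellman_op ^^ n) (\<lambda>_. 0)"

text \<open>Iterates from 0 increase, so upper estimates suffice: both monotonicity and the
  geometric bound come from \<open>bellman_op_le\<close> by induction.\<close>

lemma value_iteration:
  assumes cond: demand_condition
  obtains E where "0 \<le> E" "\<And>n. admissible (iterate n)"
    "\<And>n x. x \<in> X \<Longrightarrow> iterate n x \<le> iterate (Suc n) x"
    "\<And>n x k. x \<in> X \<Longrightarrow> iterate (n + k) x \<le> iterate n x + \<beta> ^ n * E * \<mu> x"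
proof -
  obtain H where H: "\<And>x. x \<in> X \<Longrightarrow> h x \<le> H" "0 \<le> H"
    using h_bounded by blast
  note zero_bounds = min_action_value_attained[OF admissible_zero cond] min_action_value_le[OF admissible_zero cond]
  have stage0: "stage (\<lambda>_. 0) y = h y" for y
    by (simp add: stage_def gain_def capped_def)
  have bellman_op_zero: "0 \<le> bellman_op (\<lambda>_. 0) x \<and> bellman_op (\<lambda>_. 0) x \<le> H * \<mu> x" if x: "x \<in> X" for x
  proof -
    have "0 \<le> action_value (\<lambda>_. 0) (x, a)" if "a \<in> {0..M}" for a
      using that K cb expected_stage_nonneg[OF admissible_zero] by (simp add: action_value_def)
    moreover obtain a where "a \<in> {0..M}" "action_value (\<lambda>_. 0) (x, a) = min_action_value (\<lambda>_. 0) M x"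
      using zero_bounds(1)[OF x M order_refl] by blast
    ultimately have "0 \<le> min_action_value (\<lambda>_. 0) M x"
      by metis
    then have "0 \<le> bellman_op (\<lambda>_. 0) x"
      by (simp add: bellman_op_def gain_def)
    have "expected_stage (\<lambda>_. 0) z \<le> (LINT s|D. H)" for z
      unfolding expected_stage_def by (intro integral_mono stage_integrable admissible_zero) (simp_all add: stage0 H(1))
    then have "expected_stage (\<lambda>_. 0) z \<le> H" for z
      using prob_space by simp
    \<comment> \<open>Ordering nothing already keeps the first iterate below
      \<open>H\<close>.\<close>
    then have "action_value (\<lambda>_. 0) (x, 0) \<le> H"
      by (simp add: action_value_def)
    then have "bellman_op (\<lambda>_. 0) x \<le> H"
      using zero_bounds(2)[OF x M order_refl, of 0] M by (auto simp: bellman_op_def gain_def)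
    also have "H = H * 1"
      by simp
    also have "H * 1 \<le> H * \<mu> x"
      using H(2) \<mu>_bounds[OF x] by (intro mult_left_mono) auto
    finally show ?thesis
      using \<open>0 \<le> bellman_op (\<lambda>_. 0) x\<close> by simp
  qed
  \<comment> \<open>\<open>E\<close> is the fixed point of
    \<open>e \<mapsto> H + \<beta> * e\<close>, so the bound \<open>E * \<mu>\<close> reproduces
    itself under \<open>bellman_op\<close>.\<close>
  define E where "E = H / (1 - \<beta>)"
  have E: "0 \<le> E" "H + \<beta> * E = E"
    using H(2) \<beta>(2) by (simp_all add: E_def field_simps)
  have Suc: "iterate (Suc n) = bellman_op (iterate n)" for n
    by (simp add: iterate_def)
  have admissible: "admissible (iterate n) \<and> (\<forall>x\<in>X. 0 \<le> iterate n x \<and> iterate n x \<le> E * \<mu> x)" for n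
  proof (induction n)
    case 0
    show ?case
      using admissible_zero E(1) \<mu>_bounds by (force simp: iterate_def)
  next
    case (Suc n)
    then have g: "admissible (iterate n)" by simp
    have "0 \<le> iterate (Suc n) x \<and> iterate (Suc n) x \<le> E * \<mu> x" if x: "x \<in> X" for x
    proof
      have "bellman_op (\<lambda>_. 0) x \<le> bellman_op (iterate n) x + \<beta> * 0 * \<mu> x"
        by (rule bellman_op_le[OF g admissible_zero cond]) (use Suc x in auto)
      then show "0 \<le> iterate (Suc n) x"
        using bellman_op_zero[OF x] by (simp add: \<open>\<And>n. iterate (Suc n) = bellman_op (iterate n)\<close>)
      have "bellman_op (iterate n) x \<le> bellman_op (\<lambda>_. 0) x + \<beta> * E * \<mu> x"
        by (rule bellman_op_le[OF admissible_zero g cond]) (use Suc x E in auto)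
      also have "\<dots> \<le> H * \<mu> x + \<beta> * E * \<mu> x"
        using bellman_op_zero[OF x] by simp
      also have "\<dots> = E * \<mu> x"
        using E(2) by (metis distrib_right)
      finally show "iterate (Suc n) x \<le> E * \<mu> x"
        by (simp add: \<open>\<And>n. iterate (Suc n) = bellman_op (iterate n)\<close>)
    qed
    moreover have "lsc_on X (iterate (Suc n))"
      unfolding \<open>\<And>n. iterate (Suc n) = bellman_op (iterate n)\<close> by (rule lsc_bellman_op[OF g cond])
    ultimately show ?case
      unfolding admissible_def by blast
  qed
  have mono: "iterate n x \<le> iterate (Suc n) x" if "x \<in> X" for n x
    using that
  proof (induction n arbitrary: x)
    case 0
    then show ?case
      using admissible[of "Suc 0"] by (auto simp: iterate_def[of 0])
  next
    case (Suc n)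
    have "bellman_op (iterate n) x \<le> bellman_op (iterate (Suc n)) x + \<beta> * 0 * \<mu> x"
      by (rule bellman_op_le[OF _ _ cond]) (use admissible Suc in auto)
    then show ?case
      by (simp add: \<open>\<And>n. iterate (Suc n) = bellman_op (iterate n)\<close>)
  qed
  have "iterate (n + k) x \<le> iterate n x + \<beta> ^ n * E * \<mu> x" if "x \<in> X" for n k x
    using that
  proof (induction n arbitrary: x)
    case 0
    then show ?case
      using admissible[of k] by (auto simp: iterate_def[of 0])
  next
    case (Suc n)
    have "bellman_op (iterate (n + k)) x \<le> bellman_op (iterate n) x + \<beta> * (\<beta> ^ n * E) * \<mu> x"
      by (rule bellman_op_le[OF _ _ cond]) (use admissible Suc E(1) \<beta>_nonneg in auto)
    then show ?case
      by (simp add: \<open>\<And>n. iterate (Suc n) = bellman_op (iterate n)\<close> mult_ac)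
  qed
  with E(1) admissible mono show ?thesis
    using that by blast
qed

text \<open>An increasing limit keeps lower semicontinuity, and the geometric bound passes to it.
  Then \<open>bellman_op_le\<close>, with \<open>e = 0\<close> from below and
  \<open>e = \<beta> ^ n * E\<close> from above, squeezes \<open>bellman_op V\<close> between
  iterates without exchanging minimum and limit.\<close>

lemma fixed_point:
  assumes cond: demand_condition
  obtains V where "admissible V" "\<And>x. x \<in> X \<Longrightarrow> bellman_op V x = V x"
proof -
  obtain E where E: "0 \<le> E" and admissible: "\<And>n. admissible (iterate n)"
    and mono: "\<And>n x. x \<in> X \<Longrightarrow> iterate n x \<le> iterate (Suc n) x"
    and le: "\<And>n x k. x \<in> X \<Longrightarrow> iterate (n + k) x \<le> iterate n x + \<beta> ^ n * E * \<mu> x"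
    using value_iteration[OF cond] by blast
  define V where "V x = (SUP n. iterate n x)" for x
  have inc: "incseq (\<lambda>n. iterate n x)" if "x \<in> X" for x
    using mono[OF that] by (rule incseq_SucI)
  have bdd: "bdd_above (range (\<lambda>n. iterate n x))" if "x \<in> X" for x
    using le[OF that, of 0] by (auto intro!: bdd_aboveI)
  have lim: "(\<lambda>n. iterate n x) \<longlonglongrightarrow> V x" if "x \<in> X" for x
    unfolding V_def by (rule LIMSEQ_incseq_SUP[OF bdd[OF that] inc[OF that]])
  have ge: "iterate n x \<le> V x" if "x \<in> X" for n x
    unfolding V_def by (rule cSUP_upper[OF UNIV_I bdd[OF that]])
  have close: "V x \<le> iterate n x + \<beta> ^ n * E * \<mu> x" if "x \<in> X" for n x
    using LIMSEQ_le_const2[OF LIMSEQ_ignore_initial_segment[OF lim[OF that], of n]] le[OF that, of n]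
    by (auto simp: add.commute)
  have "lsc_on X V"
    by (rule lsc_on_lim[OF admissible_lsc[OF admissible] ge lim])
  moreover have "0 \<le> V x \<and> V x \<le> E * \<mu> x" if "x \<in> X" for x
    using ge[OF that, of 0] close[OF that, of 0] by (simp add: iterate_def)
  ultimately have V: "admissible V"
    unfolding admissible_def by blast
  have "bellman_op V x = V x" if x: "x \<in> X" for x
  proof (rule antisym)
    have "iterate (Suc n) x \<le> bellman_op V x" for n
      using bellman_op_le[OF V admissible cond order_refl _ x, of n] ge by (simp add: iterate_def)
    then show "V x \<le> bellman_op V x"
      using LIMSEQ_le_const2[OF LIMSEQ_Suc[OF lim[OF x]]] by auto
    have "bellman_op V x \<le> V x + \<beta> * (\<beta> ^ n * E) * \<mu> x" for n
    proof -
      have "bellman_op V x \<le> bellman_op (iterate n) x + \<beta> * (\<beta> ^ n * E) * \<mu> x"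
        by (rule bellman_op_le[OF admissible V cond _ close x]) (use E \<beta>_nonneg in simp)
      then show ?thesis
        using ge[OF x, of "Suc n"] by (simp add: iterate_def)
    qed
    moreover have "(\<lambda>n. V x + \<beta> * (\<beta> ^ n * E) * \<mu> x) \<longlonglongrightarrow> V x + \<beta> * (0 * E) * \<mu> x"
      using \<beta>_nonneg \<beta>(2) by (intro tendsto_intros LIMSEQ_power_zero) auto
    ultimately show "bellman_op V x \<le> V x"
      using LIMSEQ_le_const by fastforce
  qed
  with V show ?thesis
    using that by blast
qed

text \<open>Taking the smallest minimizer makes the selector Borel, see \<open>selector_le_iff\<close>.\<close>

definition selector :: "(real \<Rightarrow> real) \<Rightarrow> real \<Rightarrow> real" where
  "selector V x = Inf {a\<in>{0..M}. action_value V (x, a) \<le> min_action_value V M x}"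

context
  fixes V assumes V: "admissible V" and cond: demand_condition
begin

text \<open>The minimizers form a closed set, as a sublevel set of a lower semicontinuous section,
  so their infimum is a minimizer. It is at most \<open>t\<close> when some minimizer lies in
  \<open>{0..t}\<close>, a comparison of two minima.\<close>

lemma
  assumes x: "x \<in> X"
  shows selector_range: "selector V x \<in> {0..M}"
    and action_value_selector: "action_value V (x, selector V x) = min_action_value V M x"
    and selector_le_iff: "0 \<le> t \<Longrightarrow> t \<le> M \<Longrightarrow> selector V x \<le> t \<longleftrightarrow> min_action_value V t x \<le> min_action_value V M x"
proof -
  let ?S = "{a\<in>{0..M}. action_value V (x, a) \<le> min_action_value V M x}"
  note att = min_action_value_attained[OF V cond x] and le = min_action_value_le[OF V cond x]
  have "closed ?S"
    by (rule lsc_on_iff_closed[OF closed_atLeastAtMost, THEN iffD1,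
      OF lsc_action_value_section[OF V cond x order_refl], rule_format])
  moreover have "?S \<noteq> {}"
    using att[OF M order_refl] by auto
  moreover have bdd: "bdd_below ?S"
    by (auto intro!: bdd_belowI)
  ultimately have S: "selector V x \<in> ?S"
    unfolding selector_def by (intro closed_contains_Inf)
  then show "selector V x \<in> {0..M}"
    by simp
  show "action_value V (x, selector V x) = min_action_value V M x"
    using S le[OF M order_refl, of "selector V x"] by simp
  assume t: "0 \<le> t" "t \<le> M"
  show "selector V x \<le> t \<longleftrightarrow> min_action_value V t x \<le> min_action_value V M x"
  proof
    assume "selector V x \<le> t"
    then show "min_action_value V t x \<le> min_action_value V M x"
      using S le[OF t, of "selector V x"] by auto
  next
    assume "min_action_value V t x \<le> min_action_value V M x"
    moreover obtain a where "a \<in> {0..t}" "action_value V (x, a) = min_action_value V t x"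
      using att[OF t] by blast
    ultimately have "a \<in> ?S" "a \<le> t"
      using t by auto
    then show "selector V x \<le> t"
      unfolding selector_def using cInf_lower[OF _ bdd] by fastforce
  qed
qed

lemma selector_borel: "selector V \<in> borel_measurable SX"
  unfolding borel_measurable_iff_le
proof
  fix t
  have range: "0 \<le> selector V x" "selector V x \<le> M" if "x \<in> X" for x
    using selector_range[OF that] by auto
  consider "t < 0" | "0 \<le> t" "t \<le> M" | "M < t" by linarith
  then show "{x \<in> space SX. selector V x \<le> t} \<in> sets SX"
  proof cases
    case 1
    then have "{x \<in> space SX. selector V x \<le> t} = {}"
      using range by force
    then show ?thesis
      using sets.empty_sets by metis
  next
    case 2
    have m: "min_action_value V s \<in> borel_measurable SX" if "0 \<le> s" "s \<le> M" for s
      by (rule lsc_on_measurable[OF closed_X lsc_min_action_value[OF V cond that]])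
    have "{x \<in> space SX. min_action_value V t x \<le> min_action_value V M x} \<in> sets SX"
      by (rule borel_measurable_le[OF m[OF 2] m[OF M order_refl]])
    moreover have "{x \<in> space SX. selector V x \<le> t} = {x \<in> space SX. min_action_value V t x \<le> min_action_value V M x}"
      using selector_le_iff[OF _ 2] by auto
    ultimately show ?thesis
      by metis
  next
    case 3
    then have "{x \<in> space SX. selector V x \<le> t} = space SX"
      using range by force
    then show ?thesis
      using sets.top by metis
  qed
qed

lemma transformed_selector: "(\<lambda>x. if x = xbar then abar else selector V x) \<in> selectors transformed"
proof -
  have "(\<lambda>y. selector V y * indicator X y) \<in> borel_measurable borel"
    using selector_borel by (subst (asm) borel_measurable_restrict_space_iff) (simp_all add: mult.commute)
  then have "(\<lambda>x. if x = xbar then abar else selector V x * indicator X x) \<in> borel_measurable borel"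
    by measurable
  then have "(\<lambda>x. if x = xbar then abar else selector V x * indicator X x) \<in> borel_measurable SY"
    by (rule measurable_restrict_space1)
  then have "(\<lambda>x. if x = xbar then abar else selector V x * indicator X x) \<in> SY \<rightarrow>\<^sub>M SB"
    by (rule measurable_restrict_space2[rotated]) (use selector_range in auto)
  also have "?this \<longleftrightarrow> (\<lambda>x. if x = xbar then abar else selector V x) \<in> SY \<rightarrow>\<^sub>M SB"
    by (rule measurable_cong) auto
  finally show ?thesis
    using selector_range by (auto simp: selectors_def)
qed

end

section \<open>Verification of the optimal selector policy\<close>

theorem exists_disc_optimal:
  assumes cond: demand_condition
  shows "\<exists>\<phi>\<in>selectors transformed. disc_optimal transformed \<beta> (selector_policy transformed \<phi>)"
proof -
  obtain V where V: "admissible V" and fp: "\<And>x. x \<in> X \<Longrightarrow> bellman_op V x = V x"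
    using fixed_point[OF cond] by blast
  define w where "w = gain V"
  define v where "v y = (if y \<in> X then ennreal (V y / \<mu> y) else 0)" for y
  define \<phi> where "\<phi> x = (if x = xbar then abar else selector V x)" for x
  have \<phi>: "\<phi> \<in> selectors transformed"
    unfolding \<phi>_def[abs_def] by (rule transformed_selector[OF V cond])
  have w0: "0 \<le> w"
    unfolding w_def by (rule admissible_gain[OF V])
  have \<mu>1: "1 \<le> \<mu> x" "\<mu> x \<le> Kl" if "x \<in> X" for x
    using \<mu>_bounds[OF that] by auto
  have V_eq: "V x + (w + (Kl - \<mu> x) * w) = min_action_value V M x" if "x \<in> X" for x
    using fp[OF that] by (simp add: bellman_op_def w_def algebra_simps)
  \<comment> \<open>The equation at \<open>lost\<close> makes both minima equal to
    \<open>(1 + Kl) * w\<close>; at 0 this leaves \<open>V 0 = \<mu> 0 * w\<close>.\<close>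
  have "min_action_value V M 0 = min_action_value V M lost"
    by (simp add: min_action_value_def action_value_def)
  moreover have "V lost = \<mu> lost * w"
    using \<mu>1[OF lost_in_X] by (simp add: w_def gain_def)
  ultimately have "V 0 = \<mu> 0 * w"
    using V_eq[OF zero_in_X] V_eq[OF lost_in_X] by (simp add: algebra_simps)
  then have capped: "capped V y = V y" for y
    by (simp add: capped_def w_def)
  have v_meas: "v \<in> borel_measurable SY"
  proof -
    have "(\<lambda>y. V y / \<mu> y) \<in> borel_measurable SX"
      using admissible_measurable[OF V] by measurable
    then have "(\<lambda>y. V y / \<mu> y * indicator X y) \<in> borel_measurable borel"
      by (subst (asm) borel_measurable_restrict_space_iff) (simp_all add: mult.commute)
    then have "(\<lambda>y. ennreal (V y / \<mu> y * indicator X y)) \<in> borel_measurable borel"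
      by measurable
    then have "(\<lambda>y. ennreal (V y / \<mu> y * indicator X y)) \<in> borel_measurable SY"
      by (rule measurable_restrict_space1)
    moreover have "v y = ennreal (V y / \<mu> y * indicator X y)" for y
      by (simp add: v_def)
    ultimately show ?thesis
      by presburger
  qed
  have v_xbar: "v xbar = 0"
    by (simp add: v_def)
  have v_lost: "v lost = ennreal w"
    by (simp add: v_def w_def gain_def)
  have \<mu>v: "ennreal (\<mu> x) * v x = ennreal (V x)" if "x \<in> X" for x
    using that \<mu>1[OF that] admissible_nonneg[OF V that] by (simp add: v_def ennreal_mult[symmetric])
  have rel: "ennreal (h y) + relative_value v y = ennreal (stage V y)" if y: "y \<in> X" for y
  proof -
    have "relative_value v y = ennreal (V y) + ennreal ((Kl - \<mu> y) * w)"
      using \<mu>1[OF y] w0 by (simp add: relative_value_def \<mu>v[OF y] v_lost ennreal_mult)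
    moreover have "stage V y = h y + (V y + (Kl - \<mu> y) * w)"
      using \<open>V lost = \<mu> lost * w\<close> unfolding stage_def capped w_def[symmetric] by (simp add: algebra_simps)
    ultimately show ?thesis
      using h_nonneg[OF y] admissible_nonneg[OF V y] \<mu>1[OF y] w0 by simp
  qed
  have action_value: "ennreal (c (x, a)) + (\<integral>\<^sup>+y. relative_value v y \<partial>q (x, a)) = ennreal (action_value V (x, a))"
    if a: "a \<in> {0..M}" for x a
  proof -
    obtain H where H: "\<And>x. x \<in> X \<Longrightarrow> h x \<le> H" "0 \<le> H"
      using h_bounded by blast
    have r: "relative_value v \<in> borel_measurable SX"
      using measurable_compose[OF X_to_Y_measurable v_meas]
      unfolding relative_value_def[abs_def] by measurable
    have "integrable D (\<lambda>s. h (inv_F C x a s))"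
      by (rule integrable_bounded_demand[where B=H, OF h_measurable]) (simp add: h_nonneg H(1))
    then have hi: "(\<integral>\<^sup>+s. ennreal (h (inv_F C x a s)) \<partial>D) = ennreal (LINT s|D. h (inv_F C x a s))"
      by (intro nn_integral_eq_integral) (auto simp: h_nonneg)
    have "0 \<le> (LINT s|D. h (inv_F C x a s))"
      by (intro integral_nonneg_AE) (simp add: h_nonneg)
    then have "ennreal (c (x, a)) = ennreal (K * (if a > 0 then 1 else 0) + cb * a) +
        (\<integral>\<^sup>+s. ennreal (h (inv_F C x a s)) \<partial>D)"
      unfolding hi inv_cost_def using a K cb by (simp add: ennreal_plus[symmetric] del: ennreal_plus)
    moreover have "(\<integral>\<^sup>+s. ennreal (h (inv_F C x a s)) \<partial>D) + (\<integral>\<^sup>+y. relative_value v y \<partial>q (x, a)) =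
        (\<integral>\<^sup>+s. ennreal (h (inv_F C x a s)) + relative_value v (inv_F C x a s) \<partial>D)"
      unfolding nn_integral_q[OF r] fst_conv snd_conv
      by (rule nn_integral_add[symmetric])
        (simp_all add: measurable_compose[OF inv_F_measurable_demand r]
          measurable_compose[OF inv_F_measurable_demand measurable_compose[OF h_measurable measurable_ennreal]])
    moreover have "\<dots> = ennreal (expected_stage V (level x + a))"
      unfolding nn_integral_stage[OF V, symmetric] inv_F_level[of x a, symmetric] by (simp add: rel)
    ultimately show ?thesis
      using a K cb expected_stage_nonneg[OF V] by (simp add: action_value_def add.assoc)
  qed
  let ?rhs = "\<lambda>x a. ennreal (cost transformed (x, a)) + ennreal \<beta> * (\<integral>\<^sup>+y. v y \<partial>kernel transformed (x, a))"
  have bellman: "ennreal (\<mu> x) * ?rhs x a + ennreal (w + (Kl - \<mu> x) * w) = ennreal (action_value V (x, a))"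
    if x: "x \<in> X" and a: "a \<in> {0..M}" for x a
    using discounted_eq_average[OF v_meas v_xbar x a] \<mu>1[OF x] w0 unfolding action_value[OF a] v_lost
    by (simp add: ennreal_mult del: transformed_simps)
  have v_eq: "ennreal (\<mu> x) * v x + ennreal (w + (Kl - \<mu> x) * w) = ennreal (min_action_value V M x)" if x: "x \<in> X" for x
    unfolding \<mu>v[OF x] V_eq[OF x, symmetric] using admissible_nonneg[OF V x] \<mu>1[OF x] w0 by simp
  \<comment> \<open>\<open>bellman\<close> and \<open>v_eq\<close> share a finite summand and a
    positive finite factor, both of which can be cancelled in ennreal. Comparing \<open>v x\<close>
    with the one-step cost thus reduces to comparing \<open>min_action_value\<close> with
    \<open>action_value\<close>.\<close>
  have cancel: "p \<le> r" if "x \<in> X" "ennreal (\<mu> x) * p + ennreal (w + (Kl - \<mu> x) * w) \<le>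
      ennreal (\<mu> x) * r + ennreal (w + (Kl - \<mu> x) * w)" for x p r
  proof -
    have "ennreal (\<mu> x) * p \<le> ennreal (\<mu> x) * r"
      using that(2) by (simp add: add.commute[of _ "ennreal (w + (Kl - \<mu> x) * w)"] ennreal_add_left_cancel_le)
    then show ?thesis
      using \<mu>1[OF that(1)] by (simp add: ennreal_mult_le_mult_iff)
  qed
  have le: "v x \<le> ?rhs x a" if x: "x \<in> X" and a: "a \<in> {0..M}" for x a
    by (rule cancel[OF x]) (simp only: bellman[OF x a] v_eq[OF x] ennreal_leI[OF min_action_value_le[OF V cond x M order_refl a]])
  have ge: "?rhs x (\<phi> x) \<le> v x" if x: "x \<in> insert xbar X" for x
  proof (cases "x = xbar")
    case True
    then show ?thesis
      using v_meas v_xbar by (simp add: \<phi>_def hvag_kernel_eq nn_integral_return)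
  next
    case False
    with x have x: "x \<in> X" by simp
    have a: "\<phi> x \<in> {0..M}" "action_value V (x, \<phi> x) = min_action_value V M x"
      using False selector_range[OF V cond x] action_value_selector[OF V cond x] by (simp_all add: \<phi>_def)
    show ?thesis
      by (rule cancel[OF x]) (simp only: bellman[OF x a(1)] v_eq[OF x] a(2) order_refl)
  qed
  obtain B where B: "\<And>y. v y \<le> ennreal B"
  proof -
    obtain e where e: "\<And>x. x \<in> X \<Longrightarrow> V x \<le> e * \<mu> x"
      using V by (auto simp: admissible_def)
    have "v y \<le> ennreal e" for y
      using e[of y] \<mu>1[of y] by (auto simp: v_def pos_divide_le_eq intro!: ennreal_leI)
    then show ?thesis
      using that by blast
  qed
  have lower: "v x \<le> disc_cost transformed \<beta> \<pi> x"
    if \<pi>: "\<pi> \<in> policies transformed" and x: "x \<in> insert xbar X" for \<pi> x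
  proof -
    interpret mdp_process transformed \<pi> x
      by unfold_locales (use \<pi> x in auto)
    show ?thesis
    proof (rule disc_cost_ge[OF \<beta>_nonneg \<beta>(2)])
      show "v y \<le> ennreal B" for y
        by (rule B)
      show "v y \<le> ?rhs y a" if "y \<in> space (states transformed)" "a \<in> avail transformed y" for y a
      proof (cases "y = xbar")
        case False
        with that have "y \<in> X" "a \<in> {0..M}"
          by auto
        then show ?thesis
          by (rule le)
      qed (simp add: v_xbar)
    qed (use v_meas in simp)
  qed
  let ?\<sigma> = "selector_policy transformed \<phi>"
  have \<sigma>: "?\<sigma> \<in> policies transformed"
    by (rule H.selector_policy_policies[OF \<phi>])
  have upper: "disc_cost transformed \<beta> ?\<sigma> x \<le> v x" if x: "x \<in> insert xbar X" for x
  proof -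
    interpret mdp_process transformed ?\<sigma> x
      by unfold_locales (use \<sigma> x in auto)
    have v_meas': "v \<in> borel_measurable (states transformed)"
      using v_meas by simp
    have g0: "(\<lambda>z. ennreal (cost transformed z) + ennreal \<beta> * (\<integral>\<^sup>+y. v y \<partial>kernel transformed z))
        \<in> borel_measurable (sa transformed)"
      by (intro borel_measurable_add borel_measurable_times_ennreal measurable_const
          measurable_compose[OF H.kernel_subprob nn_integral_measurable_subprob_algebra[OF v_meas']]
          measurable_compose[OF H.cost_measurable measurable_ennreal]) simp
    show ?thesis
    proof (rule disc_cost_le[OF \<beta>_nonneg v_meas'])
      fix n z assume z: "z \<in> space (histories transformed n)"
      then have x: "snd z \<in> space (states transformed)"
        by (auto simp: H.space_histories)
      have "(\<integral>\<^sup>+a. ?rhs (snd z) a \<partial>?\<sigma> n z) = ?rhs (snd z) (\<phi> (snd z))"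
        by (rule H.nn_integral_selector_policy[OF \<phi> z measurable_compose[OF measurable_Pair1'[OF x] g0]])
      also have "\<dots> \<le> v (snd z)"
        using x by (intro ge) simp
      finally show "(\<integral>\<^sup>+a. ?rhs (snd z) a \<partial>?\<sigma> n z) \<le> v (snd z)" .
    qed
  qed
  have "disc_cost transformed \<beta> ?\<sigma> x = (INF \<pi>\<in>policies transformed. disc_cost transformed \<beta> \<pi> x)"
    if x: "x \<in> insert xbar X" for x
  proof (rule antisym)
    show "disc_cost transformed \<beta> ?\<sigma> x \<le> (INF \<pi>\<in>policies transformed. disc_cost transformed \<beta> \<pi> x)"
      using upper[OF x] lower[OF _ x] by (intro INF_greatest) (rule order_trans)
    show "(INF \<pi>\<in>policies transformed. disc_cost transformed \<beta> \<pi> x) \<le> disc_cost transformed \<beta> ?\<sigma> x"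
      by (rule INF_lower[OF \<sigma>])
  qed
  then have "disc_optimal transformed \<beta> ?\<sigma>"
    using \<sigma> by (simp add: disc_optimal_def)
  with \<phi> show ?thesis
    by blast
qed

end

theorem theorem9:
  fixes C M K cb :: real and h :: "real \<Rightarrow> real" and D :: "real measure"
    and K\<^sub>l :: real and \<mu> :: "real \<Rightarrow> real" and \<beta> :: real
  assumes "0 \<le> C" and "0 \<le> M" and "0 \<le> K" and "0 < cb"
    and demand: "real_distribution D" "AE s in D. 0 \<le> s" "cdf D 0 < 1"
    and holding: "\<And>x. x \<in> inv_X C \<Longrightarrow> 0 \<le> h x" "continuous_on {0..C} h"
    and K\<^sub>l: "\<And>\<phi> x. \<phi> \<in> selectors (inventory_mdp C M K cb h D) \<Longrightarrow> x \<in> inv_X C \<Longrightarrow>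
          (\<Sum>n. (taboo_op C D \<phi> ^^ n) (\<lambda>_. 1) x) \<le> ennreal K\<^sub>l"
    and \<mu>: "continuous_on (inv_X C) \<mu>"
      "\<And>x. x \<in> inv_X C \<Longrightarrow> 1 \<le> \<mu> x \<and> \<mu> x \<le> K\<^sub>l"
      "\<And>x a. x \<in> inv_X C \<Longrightarrow> a \<in> {0..M} \<Longrightarrow>
          1 + (LINT y:inv_X C - {lost}|inv_q C D (x, a). \<mu> y) \<le> \<mu> x"
    and \<beta>: "(K\<^sub>l - 1) / K\<^sub>l \<le> \<beta>" "\<beta> < 1"
    and demand_exceeds_order: "cdf D M < 1"
  shows "(h 0 \<le> h lost \<or> (\<forall>s\<in>{0<..C + M}. isCont (cdf D) s) \<longrightarrow>
           (\<exists>\<phi>\<in>selectors (hvag_mdp C M K cb h D \<mu> \<beta>).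
              disc_optimal (hvag_mdp C M K cb h D \<mu> \<beta>) \<beta>
                (selector_policy (hvag_mdp C M K cb h D \<mu> \<beta>) \<phi>))) \<and>
         (\<forall>\<pi>. stationary (hvag_mdp C M K cb h D \<mu> \<beta>) \<pi> \<and>
              disc_optimal (hvag_mdp C M K cb h D \<mu> \<beta>) \<beta> \<pi> \<longrightarrow>
            avg_optimal (inventory_mdp C M K cb h D) (as_inventory_policy M \<pi>))"
proof -
  interpret inventory D C M K cb h K\<^sub>l \<mu> \<beta>
    using assms by (intro inventory.intro inventory_axioms.intro) auto
  show ?thesis
    using exists_disc_optimal disc_optimal_imp_avg_optimal
    unfolding demand_condition_def by blast
qed

end
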